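(* For every $\varepsilon>0$, $f\in L^2(D,F)$ and $h\in L^2(D,E)$ there exists a unique element $u_\varepsilon(f,h)\in\mathcal{D}_T$ satisfying $$(Au_\varepsilon(f,h),Av)_{L^2(D,F)}+\varepsilon\,(u_\varepsilon(f,h),v)_{L^2(D,E)}=(f,Av)_{L^2(D,F)}+\varepsilon\,(h,v)_{L^2(D,E)}$$ for all $v\in\mathcal{D}_T$. Moreover, it satisfies $$\|u_\varepsilon(f,h)\|_\varepsilon\le\|f\|_{L^2(D,F)}+\sqrt{\varepsilon}\,\|h\|_{L^2(D,E)}.$$
   Context: Setting. $X$ is a $C^\infty$ manifold of dimension $n$ with smooth boundary, embedded in a smooth closed manifold of the same dimension; $X^\circ$ is its interior; $dx$ is a fixed volume form. $E, F$ are smooth complex vector bundles over $X$ with Hermitian metrics $(\cdot,\cdot)_x$. $A$ is a linear partial differential operator of order $m$ (with smooth coefficients) from sections of $E$ to sections of $F$ whose principal symbol is injective away from the zero section of $T^*X$. $D \subset X^\circ$ is a relatively compact domain with smooth boundary $\partial D$, and $\Gamma \subset \partial D$ is a closed subset ($\Gamma=\emptyset$ and $\Gamma=\partial D$ allowed). Fix a Dirichlet system $B_0,\dots,B_{m-1}$ of order $m-1$ on $\partial D$: each $B_j$ is a differential operator of type $E\to F_j$ and order $m_j\le m-1$ in a neighbourhood of $\partial D$, $m_i\ne m_j$ for $i\neq j$, and the principal symbols of $B_j$ restricted to the conormal bundle of $\partial D$ have rank equal to the dimension of $F_j$. Put $t(u)=\oplus_{j=0}^{m-1}B_ju$. For sections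 $u,v$ put $D(u,v)=(u,v)_{L^2(D,E)}+(Au,Av)_{L^2(D,F)}$, $D(u)=\sqrt{D(u,u)}$. $\mathcal{D}_T$ is the completion, with respect to the norm $D(\cdot)$, of the space of all $u\in C^\infty(\overline D,E)$ with $t(u)=0$ on $\Gamma$; it is a Hilbert space with scalar product $D(\cdot,\cdot)$. For $\varepsilon>0$: $(u,v)_\varepsilon=(Au,Av)_{L^2(D,F)}+\varepsilon\,(u,v)_{L^2(D,E)}$ and $\|u\|_\varepsilon=\sqrt{(u,u)_\varepsilon}$. *)

theory Defs
  imports "HOL-Analysis.Analysis" "Jordan_Normal_Form.DL_Rank"
begin

(* From here on, $ is the index operation of Jordan_Normal_Form; the coordinates of a point of
   real ^ 'n are written with vec_nth. *)
unbundle no vec_syntax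

section \<open>Smooth functions on subsets of Euclidean space\<close>

text \<open>Derivatives are taken within a set, so that they also make sense at the boundary points of a
  half space; at interior points of the set they are the ordinary partial derivatives.\<close>

fun partial_derivs ::
  "(real ^ 'n) set \<Rightarrow> 'n list \<Rightarrow> (real ^ 'n \<Rightarrow> 'b::real_normed_vector) \<Rightarrow> real ^ 'n \<Rightarrow> 'b" where
  "partial_derivs S [] f = f"
| "partial_derivs S (i # l) f =
     (\<lambda>y. frechet_derivative (partial_derivs S l f) (at y within S) (axis i 1))"

definition C_infinity_on :: "(real ^ 'n) set \<Rightarrow> (real ^ 'n \<Rightarrow> 'b::real_normed_vector) \<Rightarrow> bool" where
  "C_infinity_on V f \<longleftrightarrow> open V \<and> (\<forall>l. partial_derivs UNIV l f differentiable_on V)"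

definition smooth_on :: "(real ^ 'n) set \<Rightarrow> (real ^ 'n \<Rightarrow> 'b::real_normed_vector) \<Rightarrow> bool" where
  "smooth_on S f \<longleftrightarrow> (\<forall>y\<in>S. \<exists>V g. y \<in> V \<and> C_infinity_on V g \<and> (\<forall>z\<in>S \<inter> V. g z = f z))"


section \<open>Manifolds\<close>

text \<open>A chart is a pair of its domain and its coordinate map; the values of the coordinate map
  outside the domain are irrelevant.\<close>

type_synonym ('p, 'n) chart = "'p set \<times> ('p \<Rightarrow> real ^ 'n)"

definition chart_inv :: "('p, 'n) chart \<Rightarrow> real ^ 'n \<Rightarrow> 'p" where
  "chart_inv c = inv_into (fst c) (snd c)"

definition is_chart :: "('p::topological_space, 'n::finite) chart \<Rightarrow> bool" where
  "is_chart c \<longleftrightarrow> open (fst c) \<and> open (snd c ` fst c) \<and>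
     homeomorphism (fst c) (snd c ` fst c) (snd c) (chart_inv c)"

definition compatible :: "('p, 'n::finite) chart \<Rightarrow> ('p, 'n) chart \<Rightarrow> bool" where
  "compatible c d \<longleftrightarrow>
     smooth_on (snd c ` (fst c \<inter> fst d)) (snd d \<circ> chart_inv c) \<and>
     smooth_on (snd d ` (fst c \<inter> fst d)) (snd c \<circ> chart_inv d)"

definition carrier_of :: "('p, 'n) chart set \<Rightarrow> 'p set" where
  "carrier_of atlas = (\<Union>c\<in>atlas. fst c)"

text \<open>A closed manifold: compact and without boundary. The atlas is the maximal one.\<close>

definition closed_manifold ::
  "('p::{t2_space,second_countable_topology}, 'n::finite) chart set \<Rightarrow> bool" where
  "closed_manifold atlas \<longleftrightarrow>
     (\<forall>c\<in>atlas. is_chart c) \<and>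
     (\<forall>c\<in>atlas. \<forall>d\<in>atlas. compatible c d) \<and>
     (\<forall>c. is_chart c \<and> fst c \<subseteq> carrier_of atlas \<and> (\<forall>d\<in>atlas. compatible c d) \<longrightarrow> c \<in> atlas) \<and>
     compact (carrier_of atlas)"

text \<open>A manifold with smooth boundary, embedded in the closed manifold and of the same dimension,
  identified with its image. Its interior as a manifold with boundary is its topological interior.\<close>

definition submanifold_with_boundary ::
  "('p::topological_space, 'n::finite) chart set \<Rightarrow> 'p set \<Rightarrow> bool" where
  "submanifold_with_boundary atlas X \<longleftrightarrow> X \<subseteq> carrier_of atlas \<and>
     (\<forall>p\<in>X. \<exists>c\<in>atlas. p \<in> fst c \<and>
        (fst c \<subseteq> X \<or> (\<exists>i. X \<inter> fst c = {q \<in> fst c. vec_nth (snd c q) i \<le> 0})))"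

definition smooth_domain ::
  "('p::topological_space, 'n::finite) chart set \<Rightarrow> 'p set \<Rightarrow> 'p set \<Rightarrow> bool" where
  "smooth_domain atlas X D \<longleftrightarrow>
     open D \<and> connected D \<and> D \<noteq> {} \<and> compact (closure D) \<and> closure D \<subseteq> interior X \<and>
     (\<forall>p\<in>frontier D. \<exists>c\<in>atlas. p \<in> fst c \<and>
        (\<exists>i. D \<inter> fst c = {q \<in> fst c. vec_nth (snd c q) i < 0}))"

definition smooth_fun ::
  "('p, 'n::finite) chart set \<Rightarrow> 'p set \<Rightarrow> ('p \<Rightarrow> 'b::real_normed_vector) \<Rightarrow> bool" where
  "smooth_fun atlas S f \<longleftrightarrow> (\<forall>c\<in>atlas. smooth_on (snd c ` (fst c \<inter> S)) (f \<circ> chart_inv c))"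

text \<open>A volume form is given by its coefficients: in the chart \<open>c\<close> it is
  \<open>\<omega> c\<close> times \<open>dy1 \<and> \<dots> \<and> dyn\<close>.\<close>

definition volume_form ::
  "('p, 'n::finite) chart set \<Rightarrow> 'p set \<Rightarrow> (('p, 'n) chart \<Rightarrow> 'p \<Rightarrow> real) \<Rightarrow> bool" where
  "volume_form atlas X \<omega> \<longleftrightarrow>
     (\<forall>c\<in>atlas. smooth_fun atlas (fst c \<inter> X) (\<omega> c) \<and> (\<forall>x\<in>fst c \<inter> X. \<omega> c x \<noteq> 0)) \<and>
     (\<forall>c\<in>atlas. \<forall>d\<in>atlas. \<forall>x\<in>fst c \<inter> fst d \<inter> X.
        \<omega> c x = \<omega> d x *
          Determinants.det (matrix (frechet_derivative (snd d \<circ> chart_inv c) (at (snd c x)))))"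

text \<open>The measure on \<open>X\<close> induced by a volume form; its values off \<open>X\<close> are irrelevant.\<close>

definition induced_measure ::
  "('p::topological_space, 'n::finite) chart set \<Rightarrow> 'p set \<Rightarrow> (('p, 'n) chart \<Rightarrow> 'p \<Rightarrow> real)
     \<Rightarrow> 'p measure \<Rightarrow> bool" where
  "induced_measure atlas X \<omega> dx \<longleftrightarrow> sets dx = sets borel \<and>
     (\<forall>c\<in>atlas. \<forall>S\<in>sets borel. S \<subseteq> fst c \<inter> X \<longrightarrow>
        emeasure dx S =
          (\<integral>\<^sup>+y. ennreal \<bar>\<omega> c (chart_inv c y)\<bar> * indicator (snd c ` S) y \<partial>lborel))"


section \<open>Hermitian vector bundles\<close>

text \<open>
  Every fibre of a bundle of rank \<open>k\<close> is identified, as a vector space only, with the space of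
  complex vectors of length \<open>k\<close>, by a linear isomorphism which need not depend continuously on the
  base point. Topology and smooth structure of the bundle are carried by the local trivializations
  \<open>(V, \<tau>)\<close>, where the invertible matrix \<open>\<tau> x\<close> maps the fibre over \<open>x \<in> V\<close> to the model fibre. Every
  smooth complex vector bundle is of this form.
\<close>

type_synonym 'p triv = "'p set \<times> ('p \<Rightarrow> complex mat)"
type_synonym 'p bsection = "'p \<Rightarrow> complex vec"

record 'p vbundle =
  rk :: nat
  trivs :: "'p triv set"

record 'p hbundle = "'p vbundle" +
  metric :: "'p \<Rightarrow> complex vec \<Rightarrow> complex vec \<Rightarrow> complex"

definition in_triv :: "'p triv \<Rightarrow> 'p bsection \<Rightarrow> 'p \<Rightarrow> complex vec" where
  "in_triv t u = (\<lambda>x. snd t x *\<^sub>v u x)"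

definition is_vbundle ::
  "('p::topological_space, 'n::finite) chart set \<Rightarrow> 'p set \<Rightarrow> ('p, 'z) vbundle_scheme \<Rightarrow> bool" where
  "is_vbundle atlas X E \<longleftrightarrow>
     (\<Union>t\<in>trivs E. fst t) = X \<and>
     (\<forall>t\<in>trivs E. openin (top_of_set X) (fst t) \<and>
        (\<forall>x\<in>fst t. snd t x \<in> carrier_mat (rk E) (rk E) \<and> invertible_mat (snd t x))) \<and>
     (\<forall>s\<in>trivs E. \<forall>t\<in>trivs E. \<exists>g.
        (\<forall>x\<in>fst s \<inter> fst t. g x \<in> carrier_mat (rk E) (rk E) \<and> snd t x = g x * snd s x) \<and>
        (\<forall>i<rk E. \<forall>j<rk E. smooth_fun atlas (fst s \<inter> fst t) (\<lambda>x. g x $$ (i, j))))"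

definition smooth_section ::
  "('p, 'n::finite) chart set \<Rightarrow> 'p set \<Rightarrow> ('p, 'z) vbundle_scheme \<Rightarrow> 'p bsection \<Rightarrow> bool" where
  "smooth_section atlas S E u \<longleftrightarrow>
     (\<forall>x\<in>S. u x \<in> carrier_vec (rk E)) \<and>
     (\<forall>t\<in>trivs E. \<forall>i<rk E. smooth_fun atlas (S \<inter> fst t) (\<lambda>x. in_triv t u x $ i))"

text \<open>The metric is linear in its first and conjugate linear in its second argument; this is
  contained in the local formula.\<close>

definition hermitian_bundle ::
  "('p::topological_space, 'n::finite) chart set \<Rightarrow> 'p set \<Rightarrow> ('p, 'z) hbundle_scheme \<Rightarrow> bool" where
  "hermitian_bundle atlas X E \<longleftrightarrow> is_vbundle atlas X E \<and>
     (\<forall>x\<in>X. \<forall>v\<in>carrier_vec (rk E). \<forall>w\<in>carrier_vec (rk E). metric E x w v = cnj (metric E x v w)) \<and>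
     (\<forall>x\<in>X. \<forall>v\<in>carrier_vec (rk E). v \<noteq> 0\<^sub>v (rk E) \<longrightarrow> Re (metric E x v v) > 0) \<and>
     (\<forall>t\<in>trivs E. \<exists>g.
        (\<forall>i<rk E. \<forall>j<rk E. smooth_fun atlas (fst t) (g i j)) \<and>
        (\<forall>x\<in>fst t. \<forall>v\<in>carrier_vec (rk E). \<forall>w\<in>carrier_vec (rk E).
           metric E x v w =
             (\<Sum>i<rk E. \<Sum>j<rk E. g i j x * (snd t x *\<^sub>v v) $ i * cnj ((snd t x *\<^sub>v w) $ j))))"


section \<open>Differential operators\<close>

text \<open>
  A differential operator over \<open>S\<close> acts on sections that are smooth on some relatively open
  subset of \<open>S\<close>; where the argument is not smooth, the value of the action is irrelevant. In a chart
  \<open>c\<close> and trivializations \<open>s\<close>, \<open>t\<close> of the two bundles it is the sum of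
  \<open>coeff c s t [i1, \<dots>, ij] \<partial>i1 \<cdots> \<partial>ij\<close> over all tuples of length at most the order. Tuples are used
  instead of multi-indices since the index type has no order; distinct tuples with the same
  underlying multi-index give the same derivative, and their coefficients add up.
\<close>

record ('p, 'n) diffop =
  act :: "'p bsection \<Rightarrow> 'p bsection"
  coeff :: "('p, 'n) chart \<Rightarrow> 'p triv \<Rightarrow> 'p triv \<Rightarrow> 'n list \<Rightarrow> 'p \<Rightarrow> complex mat"

definition diff_operator ::
  "('p::topological_space, 'n::finite) chart set \<Rightarrow> 'p set \<Rightarrow> ('p, 'y) vbundle_scheme
     \<Rightarrow> ('p, 'z) vbundle_scheme \<Rightarrow> nat \<Rightarrow> ('p, 'n) diffop \<Rightarrow> bool" where
  "diff_operator atlas S E F k P \<longleftrightarrow>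
     (\<forall>c\<in>atlas. \<forall>s\<in>trivs E. \<forall>t\<in>trivs F. let \<Omega> = fst c \<inter> fst s \<inter> fst t \<inter> S in
        (\<forall>l. length l \<le> k \<longrightarrow>
           (\<forall>x\<in>\<Omega>. coeff P c s t l x \<in> carrier_mat (rk F) (rk E)) \<and>
           (\<forall>i<rk F. \<forall>j<rk E. smooth_fun atlas \<Omega> (\<lambda>x. coeff P c s t l x $$ (i, j)))) \<and>
        (\<forall>W u. openin (top_of_set S) W \<and> smooth_section atlas W E u \<longrightarrow>
           (\<forall>x\<in>\<Omega> \<inter> W. act P u x \<in> carrier_vec (rk F) \<and>
              in_triv t (act P u) x =
                vec (rk F) (\<lambda>i. \<Sum>l | length l \<le> k. \<Sum>j<rk E.
                  coeff P c s t l x $$ (i, j) *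
                  partial_derivs (snd c ` (fst c \<inter> S)) l
                    (\<lambda>y. in_triv s u (chart_inv c y) $ j) (snd c x)))))"

text \<open>The principal symbol at the covector with coordinates \<open>\<xi>\<close> over \<open>x\<close>, in the chart \<open>c\<close> and the
  trivializations \<open>s\<close>, \<open>t\<close>.\<close>

definition principal_symbol ::
  "('p, 'y) vbundle_scheme \<Rightarrow> ('p, 'z) vbundle_scheme \<Rightarrow> nat \<Rightarrow> ('p, 'n::finite) diffop
     \<Rightarrow> ('p, 'n) chart \<Rightarrow> 'p triv \<Rightarrow> 'p triv \<Rightarrow> 'p \<Rightarrow> real ^ 'n \<Rightarrow> complex mat" where
  "principal_symbol E F k P c s t x \<xi> =
     mat (rk F) (rk E) (\<lambda>(i, j). \<Sum>l | length l = k.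
       (\<Prod>a\<leftarrow>l. \<i> * of_real (vec_nth \<xi> a)) * coeff P c s t l x $$ (i, j))"

definition injective_symbol ::
  "('p, 'n::finite) chart set \<Rightarrow> 'p set \<Rightarrow> ('p, 'y) vbundle_scheme
     \<Rightarrow> ('p, 'z) vbundle_scheme \<Rightarrow> nat \<Rightarrow> ('p, 'n) diffop \<Rightarrow> bool" where
  "injective_symbol atlas X E F k P \<longleftrightarrow>
     (\<forall>c\<in>atlas. \<forall>s\<in>trivs E. \<forall>t\<in>trivs F. \<forall>x\<in>fst c \<inter> fst s \<inter> fst t \<inter> X. \<forall>\<xi>. \<xi> \<noteq> 0 \<longrightarrow>
        inj_on (\<lambda>v. principal_symbol E F k P c s t x \<xi> *\<^sub>v v) (carrier_vec (rk E)))"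

text \<open>Tangent vectors and conormal covectors of a hypersurface \<open>H\<close> at \<open>p\<close>, in the coordinates of
  the chart \<open>c\<close>.\<close>

definition tangent_vectors :: "('p, 'n::finite) chart \<Rightarrow> 'p set \<Rightarrow> 'p \<Rightarrow> (real ^ 'n) set" where
  "tangent_vectors c H p =
     {v. \<exists>\<gamma>. \<gamma> 0 = p \<and> (\<forall>\<tau>. \<gamma> \<tau> \<in> H \<inter> fst c) \<and> ((snd c \<circ> \<gamma>) has_vector_derivative v) (at (0::real))}"

definition conormal :: "('p, 'n::finite) chart \<Rightarrow> 'p set \<Rightarrow> 'p \<Rightarrow> (real ^ 'n) set" where
  "conormal c H p = {\<xi>. \<forall>v\<in>tangent_vectors c H p. \<xi> \<bullet> v = 0}"

text \<open>\<open>N\<close> is the neighbourhood of the boundary of \<open>D\<close> on which the operators \<open>B j\<close>, of order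
  \<open>ord j\<close> and with values in the bundle \<open>G j\<close> over \<open>N\<close>, are given.\<close>

definition dirichlet_system ::
  "('p::topological_space, 'n::finite) chart set \<Rightarrow> 'p set \<Rightarrow> ('p, 'z) vbundle_scheme \<Rightarrow> 'p set
     \<Rightarrow> nat \<Rightarrow> 'p set \<Rightarrow> (nat \<Rightarrow> 'p vbundle) \<Rightarrow> (nat \<Rightarrow> nat) \<Rightarrow> (nat \<Rightarrow> ('p, 'n) diffop) \<Rightarrow> bool" where
  "dirichlet_system atlas X E D m N G ord B \<longleftrightarrow>
     open N \<and> frontier D \<subseteq> N \<and> N \<subseteq> X \<and> inj_on ord {..<m} \<and>
     (\<forall>j<m. is_vbundle atlas N (G j) \<and> ord j \<le> m - 1 \<and> diff_operator atlas N E (G j) (ord j) (B j) \<and>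
        (\<forall>c\<in>atlas. \<forall>s\<in>trivs E. \<forall>t\<in>trivs (G j). \<forall>p\<in>frontier D \<inter> fst c \<inter> fst s \<inter> fst t.
           \<forall>\<xi>\<in>conormal c (frontier D) p. \<xi> \<noteq> 0 \<longrightarrow>
             vec_space.rank (rk (G j)) (principal_symbol E (G j) (ord j) (B j) c s t p \<xi>) = rk (G j)))"


section \<open>Square integrable sections\<close>

definition L2_sections ::
  "'p::topological_space measure \<Rightarrow> 'p set \<Rightarrow> ('p, 'z) hbundle_scheme \<Rightarrow> 'p bsection set" where
  "L2_sections dx D E = {f.
     (\<forall>x\<in>D. f x \<in> carrier_vec (rk E)) \<and>
     (\<forall>t\<in>trivs E. \<forall>i<rk E.
        (\<lambda>x. in_triv t f x $ i) \<in> borel_measurable (restrict_space borel (D \<inter> fst t))) \<and>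
     set_integrable dx D (\<lambda>x. Re (metric E x (f x) (f x)))}"

definition L2_inner ::
  "'p measure \<Rightarrow> 'p set \<Rightarrow> ('p, 'z) hbundle_scheme \<Rightarrow> 'p bsection \<Rightarrow> 'p bsection \<Rightarrow> complex" where
  "L2_inner dx D E f g = (LINT x:D|dx. metric E x (f x) (g x))"

definition L2_norm ::
  "'p measure \<Rightarrow> 'p set \<Rightarrow> ('p, 'z) hbundle_scheme \<Rightarrow> 'p bsection \<Rightarrow> real" where
  "L2_norm dx D E f = sqrt (Re (L2_inner dx D E f f))"

definition section_diff :: "'p bsection \<Rightarrow> 'p bsection \<Rightarrow> 'p bsection" where
  "section_diff u v = (\<lambda>x. u x - v x)"


section \<open>The completion\<close>

text \<open>Smooth sections over the closure of \<open>D\<close> are represented by sections that are smooth in a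
  neighbourhood of it. Representatives of the same section have distance zero, so they are identified
  in the completion.\<close>

definition smooth_sections_vanishing ::
  "('p::topological_space, 'n::finite) chart set \<Rightarrow> 'p set \<Rightarrow> ('p, 'z) vbundle_scheme \<Rightarrow> 'p set
     \<Rightarrow> nat \<Rightarrow> (nat \<Rightarrow> 'p vbundle) \<Rightarrow> (nat \<Rightarrow> ('p, 'n) diffop) \<Rightarrow> 'p set \<Rightarrow> 'p bsection set" where
  "smooth_sections_vanishing atlas X E D m G B \<Gamma> = {u.
     (\<exists>W. open W \<and> closure D \<subseteq> W \<and> W \<subseteq> X \<and> smooth_section atlas W E u) \<and>
     (\<forall>j<m. \<forall>x\<in>\<Gamma>. act (B j) u x = 0\<^sub>v (rk (G j)))}"

definition D_inner ::
  "'p measure \<Rightarrow> 'p set \<Rightarrow> ('p, 'y) hbundle_scheme \<Rightarrow> ('p, 'z) hbundle_scheme \<Rightarrow> ('p, 'n) diffop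
     \<Rightarrow> 'p bsection \<Rightarrow> 'p bsection \<Rightarrow> complex" where
  "D_inner dx D E F A u v = L2_inner dx D E u v + L2_inner dx D F (act A u) (act A v)"

definition D_norm ::
  "'p measure \<Rightarrow> 'p set \<Rightarrow> ('p, 'y) hbundle_scheme \<Rightarrow> ('p, 'z) hbundle_scheme \<Rightarrow> ('p, 'n) diffop
     \<Rightarrow> 'p bsection \<Rightarrow> real" where
  "D_norm dx D E F A u = sqrt (Re (D_inner dx D E F A u u))"

definition cauchy_seqs :: "'s set \<Rightarrow> ('s \<Rightarrow> 's \<Rightarrow> real) \<Rightarrow> (nat \<Rightarrow> 's) set" where
  "cauchy_seqs S d =
     {\<sigma>. (\<forall>k. \<sigma> k \<in> S) \<and> (\<forall>e>0. \<exists>K. \<forall>j\<ge>K. \<forall>k\<ge>K. d (\<sigma> j) (\<sigma> k) < e)}"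

definition completion :: "'s set \<Rightarrow> ('s \<Rightarrow> 's \<Rightarrow> real) \<Rightarrow> (nat \<Rightarrow> 's) set set" where
  "completion S d = cauchy_seqs S d //
     {(\<sigma>, \<tau>). \<sigma> \<in> cauchy_seqs S d \<and> \<tau> \<in> cauchy_seqs S d \<and> (\<lambda>k. d (\<sigma> k) (\<tau> k)) \<longlonglongrightarrow> 0}"

definition D_T ::
  "('p::topological_space, 'n::finite) chart set \<Rightarrow> 'p set \<Rightarrow> 'p measure
     \<Rightarrow> ('p, 'y) hbundle_scheme \<Rightarrow> ('p, 'z) hbundle_scheme \<Rightarrow> ('p, 'n) diffop \<Rightarrow> 'p set
     \<Rightarrow> nat \<Rightarrow> (nat \<Rightarrow> 'p vbundle) \<Rightarrow> (nat \<Rightarrow> ('p, 'n) diffop) \<Rightarrow> 'p set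
     \<Rightarrow> (nat \<Rightarrow> 'p bsection) set set" where
  "D_T atlas X dx E F A D m G B \<Gamma> =
     completion (smooth_sections_vanishing atlas X E D m G B \<Gamma>)
       (\<lambda>u v. D_norm dx D E F A (section_diff u v))"

text \<open>The identity and \<open>A\<close> are continuous from the smooth sections with the norm \<open>D_norm\<close> to the
  spaces of square integrable sections, so they extend to the completion by continuity. The values
  of the extensions are determined up to equality almost everywhere; the definitions pick a
  representative.\<close>

definition to_L2 ::
  "'p::topological_space measure \<Rightarrow> 'p set \<Rightarrow> ('p, 'z) hbundle_scheme
     \<Rightarrow> (nat \<Rightarrow> 'p bsection) set \<Rightarrow> 'p bsection" where
  "to_L2 dx D E U = (SOME w. w \<in> L2_sections dx D E \<and>
     (\<forall>\<sigma>\<in>U. (\<lambda>k. L2_norm dx D E (section_diff (\<sigma> k) w)) \<longlonglongrightarrow> 0))"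

definition A_ext ::
  "'p::topological_space measure \<Rightarrow> 'p set \<Rightarrow> ('p, 'z) hbundle_scheme \<Rightarrow> ('p, 'n) diffop
     \<Rightarrow> (nat \<Rightarrow> 'p bsection) set \<Rightarrow> 'p bsection" where
  "A_ext dx D F A U = (SOME w. w \<in> L2_sections dx D F \<and>
     (\<forall>\<sigma>\<in>U. (\<lambda>k. L2_norm dx D F (section_diff (act A (\<sigma> k)) w)) \<longlonglongrightarrow> 0))"

definition eps_inner ::
  "'p::topological_space measure \<Rightarrow> 'p set \<Rightarrow> ('p, 'y) hbundle_scheme \<Rightarrow> ('p, 'z) hbundle_scheme
     \<Rightarrow> ('p, 'n) diffop \<Rightarrow> real \<Rightarrow> (nat \<Rightarrow> 'p bsection) set \<Rightarrow> (nat \<Rightarrow> 'p bsection) set \<Rightarrow> complex" where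
  "eps_inner dx D E F A \<epsilon> u v =
     L2_inner dx D F (A_ext dx D F A u) (A_ext dx D F A v)
     + of_real \<epsilon> * L2_inner dx D E (to_L2 dx D E u) (to_L2 dx D E v)"

definition eps_norm ::
  "'p::topological_space measure \<Rightarrow> 'p set \<Rightarrow> ('p, 'y) hbundle_scheme \<Rightarrow> ('p, 'z) hbundle_scheme
     \<Rightarrow> ('p, 'n) diffop \<Rightarrow> real \<Rightarrow> (nat \<Rightarrow> 'p bsection) set \<Rightarrow> real" where
  "eps_norm dx D E F A \<epsilon> u = sqrt (Re (eps_inner dx D E F A \<epsilon> u u))"

definition solves ::
  "'p::topological_space measure \<Rightarrow> 'p set \<Rightarrow> ('p, 'y) hbundle_scheme \<Rightarrow> ('p, 'z) hbundle_scheme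
     \<Rightarrow> ('p, 'n) diffop \<Rightarrow> (nat \<Rightarrow> 'p bsection) set set \<Rightarrow> real \<Rightarrow> 'p bsection \<Rightarrow> 'p bsection
     \<Rightarrow> (nat \<Rightarrow> 'p bsection) set \<Rightarrow> bool" where
  "solves dx D E F A DT \<epsilon> f h u \<longleftrightarrow> (\<forall>v\<in>DT.
     L2_inner dx D F (A_ext dx D F A u) (A_ext dx D F A v)
     + of_real \<epsilon> * L2_inner dx D E (to_L2 dx D E u) (to_L2 dx D E v)
     = L2_inner dx D F f (A_ext dx D F A v) + of_real \<epsilon> * L2_inner dx D E h (to_L2 dx D E v))"

end

theory Submission
  imports Defs
begin

text \<open>
  The problem is an orthogonal projection. Pairs of square integrable sections \<open>(a, u)\<close> of \<open>F\<close> and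
  \<open>E\<close> carry the form \<open>(a, b) + \<epsilon> (u, v)\<close>, and the equation says that \<open>(A u, u)\<close> and \<open>(f, h)\<close> have
  the same inner product with \<open>(A v, v)\<close> for all \<open>v\<close>: the pair \<open>(A u, u)\<close> is the projection of
  \<open>(f, h)\<close> onto the closure of the graph of \<open>A\<close> on the smooth sections with vanishing boundary data.
  Since the weighted norm and the norm \<open>D(\<cdot>)\<close> are equivalent on the graph, this closure is the
  completion. The projection is reached by a minimizing sequence, whose near minimality makes it
  Cauchy and nearly orthogonal to the graph (\<open>best_approximation_sequence\<close>,
  \<open>weak_solution_exists\<close>). A difference of two solutions is orthogonal to itself, and the bound
  follows by pairing the solution with itself and Cauchy--Schwarz.

  The substance lies in showing that the concrete objects fit this scheme
  (\<open>graph_completion_smooth_sections\<close>). The extensions of the identity and of \<open>A\<close> to the completion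
  exist because square integrable sections of a Hermitian bundle form a complete space
  (\<open>L2_complete\<close>); here the pointwise limit is taken in the fibre, whose coordinates are controlled
  by the metric (\<open>fibre_coordinate_bound\<close>). Smooth sections \<open>u\<close> and their images \<open>A u\<close> are square
  integrable because they are continuous near the compact closure of \<open>D\<close>, which has finite volume
  (\<open>continuous_section_L2\<close>, \<open>induced_measure_compact_finite\<close>). Finally \<open>A\<close> and the boundary
  operators are linear where their arguments are smooth (\<open>act_comb\<close>), so the sections in question
  form a subspace.
\<close>

section \<open>Semi-inner products and best approximation\<close>

lemma discriminant_bound:
  fixes a b \<delta> :: real
  assumes "a \<ge> 0" "b \<ge> 0" "\<delta> \<ge> 0"
    and le: "\<And>t. 2 * t * a \<le> \<delta> + t\<^sup>2 * a * b"
  shows "a \<le> \<delta> * b"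
proof (cases "b = 0")
  case True
  have "a = 0"
  proof (rule ccontr)
    assume "a \<noteq> 0"
    with \<open>a \<ge> 0\<close> have "2 * ((\<delta> + 1) / a) * a = 2 * (\<delta> + 1)"
      by simp
    with le[of "(\<delta> + 1) / a"] True \<open>\<delta> \<ge> 0\<close> show False
      by simp
  qed
  with True show ?thesis
    by simp
next
  case False
  with \<open>b \<ge> 0\<close> have "b > 0"
    by simp
  have "2 * (1 / b) * a \<le> \<delta> + a / b"
    using le[of "1 / b"] \<open>b > 0\<close> by (simp add: power2_eq_square)
  then have "a / b \<le> \<delta>"
    by simp
  with \<open>b > 0\<close> show ?thesis
    by (simp add: field_simps)
qed

lemma mult_self_le_imp_le:
  fixes a b :: real
  assumes "a * a \<le> b * a" "b \<ge> 0"
  shows "a \<le> b"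
proof (cases "a > 0")
  case True
  with assms(1) show ?thesis
    by (simp add: mult_le_cancel_right_pos)
qed (use assms(2) in linarith)

text \<open>
  Sections are functions whose values off the domain are junk, so they do not form a vector space
  on the nose. All that the Hilbert space argument uses is one operation \<open>comb u c v\<close>, standing
  for \<open>u + c v\<close>, with respect to which the form is linear. The same interface serves for a single
  fibre, for the square integrable sections of a bundle, and for pairs of such sections.
\<close>

locale semi_inner_space =
  fixes V :: "'s set" and comb :: "'s \<Rightarrow> complex \<Rightarrow> 's \<Rightarrow> 's" and ip :: "'s \<Rightarrow> 's \<Rightarrow> complex"
  assumes comb_closed: "u \<in> V \<Longrightarrow> v \<in> V \<Longrightarrow> comb u c v \<in> V"
    and ip_comb_left: "u \<in> V \<Longrightarrow> v \<in> V \<Longrightarrow> w \<in> V \<Longrightarrow> ip (comb u c v) w = ip u w + c * ip v w"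
    and ip_commute: "u \<in> V \<Longrightarrow> v \<in> V \<Longrightarrow> ip v u = cnj (ip u v)"
    and ip_nonneg: "u \<in> V \<Longrightarrow> Re (ip u u) \<ge> 0"
begin

definition nm :: "'s \<Rightarrow> real" where "nm u = sqrt (Re (ip u u))"

definition dst :: "'s \<Rightarrow> 's \<Rightarrow> real" where "dst u v = nm (comb u (- 1) v)"

lemma ip_comb_right:
  "u \<in> V \<Longrightarrow> v \<in> V \<Longrightarrow> w \<in> V \<Longrightarrow> ip w (comb u c v) = ip w u + cnj c * ip w v"
  by (subst (1 2 3) ip_commute[of _ w]) (simp_all add: comb_closed ip_comb_left)

lemma ip_self: "u \<in> V \<Longrightarrow> ip u u = of_real ((nm u)\<^sup>2)"
proof -
  assume u: "u \<in> V"
  then have "Im (ip u u) = Im (cnj (ip u u))"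
    using ip_commute by metis
  then show ?thesis
    using ip_nonneg[OF u] by (simp add: nm_def complex_eq_iff)
qed

lemma cmod_ip_self: "u \<in> V \<Longrightarrow> cmod (ip u u) = nm u * nm u"
  by (simp add: ip_self power2_eq_square norm_mult)

lemma nm_nonneg: "u \<in> V \<Longrightarrow> nm u \<ge> 0"
  using ip_nonneg by (simp add: nm_def)

lemma nm_power2: "u \<in> V \<Longrightarrow> (nm u)\<^sup>2 = Re (ip u u)"
  using ip_nonneg by (simp add: nm_def)

lemma dst_nonneg: "u \<in> V \<Longrightarrow> v \<in> V \<Longrightarrow> dst u v \<ge> 0"
  by (simp add: dst_def nm_nonneg comb_closed)

lemma nm_comb_power2:
  assumes "u \<in> V" "v \<in> V"
  shows "(nm (comb u c v))\<^sup>2 = (nm u)\<^sup>2 + 2 * Re (cnj c * ip u v) + (cmod c)\<^sup>2 * (nm v)\<^sup>2"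
proof -
  have "ip (comb u c v) (comb u c v) = ip u u + cnj c * ip u v + c * (ip v u + cnj c * ip v v)"
    using assms by (simp add: ip_comb_left ip_comb_right comb_closed algebra_simps)
  also have "ip v u = cnj (ip u v)"
    using assms by (rule ip_commute)
  also have "ip v v = of_real ((nm v)\<^sup>2)"
    using assms by (simp add: ip_self)
  finally have "Re (ip (comb u c v) (comb u c v)) =
      Re (ip u u) + 2 * Re (cnj c * ip u v) + (cmod c)\<^sup>2 * (nm v)\<^sup>2"
    unfolding cmod_power2 by (simp add: power2_eq_square algebra_simps)
  then show ?thesis
    using assms by (simp add: nm_power2 comb_closed)
qed

text \<open>
  The step behind both Cauchy--Schwarz and the near orthogonality of a near minimizer: if adding a
  multiple of \<open>v\<close> to \<open>r\<close> decreases the squared norm by at most \<open>\<delta>\<close>, then the component of \<open>r\<close>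
  along \<open>v\<close> is at most \<open>sqrt \<delta>\<close>. The multiples \<open>- t * ip r v\<close>, with \<open>t\<close> real, give a quadratic
  inequality in \<open>t\<close>. For Cauchy--Schwarz take \<open>\<delta>\<close> to be the full squared norm of \<open>r\<close>.
\<close>

lemma near_minimizer_near_orthogonal:
  assumes r: "r \<in> V" and v: "v \<in> V" and "\<delta> \<ge> 0"
    and min: "\<And>c. (nm r)\<^sup>2 - \<delta> \<le> (nm (comb r c v))\<^sup>2"
  shows "cmod (ip r v) \<le> sqrt \<delta> * nm v"
proof -
  define a where "a = (cmod (ip r v))\<^sup>2"
  have "2 * t * a \<le> \<delta> + t\<^sup>2 * a * (nm v)\<^sup>2" for t :: real
  proof -
    define c where "c = of_real (- t) * ip r v"
    have "Re (cnj c * ip r v) = - t * a"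
      unfolding c_def a_def cmod_power2 by (simp add: power2_eq_square algebra_simps)
    moreover have "(cmod c)\<^sup>2 = t\<^sup>2 * a"
      by (simp add: c_def a_def norm_mult power_mult_distrib)
    ultimately show ?thesis
      using min[of c] r v by (simp add: nm_comb_power2)
  qed
  then have "a \<le> \<delta> * (nm v)\<^sup>2"
    using \<open>\<delta> \<ge> 0\<close> by (intro discriminant_bound) (auto simp: a_def)
  then have "sqrt a \<le> sqrt (\<delta> * (nm v)\<^sup>2)"
    by simp
  then show ?thesis
    using nm_nonneg[OF v] by (simp add: a_def real_sqrt_mult)
qed

lemma Cauchy_Schwarz:
  assumes "u \<in> V" "v \<in> V"
  shows "cmod (ip u v) \<le> nm u * nm v"
  using near_minimizer_near_orthogonal[OF assms, of "(nm u)\<^sup>2"] nm_nonneg[OF assms(1)] by simp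

lemma nm_eqI:
  assumes "u \<in> V" "v \<in> V" "\<And>z. z \<in> V \<Longrightarrow> ip u z = ip v z"
  shows "nm u = nm v"
proof -
  have "Re (ip u u) = Re (ip v u)"
    using assms by simp
  also have "\<dots> = Re (ip u v)"
    using ip_commute[OF assms(1,2)] by simp
  also have "\<dots> = Re (ip v v)"
    using assms by simp
  finally show ?thesis
    by (simp add: nm_def)
qed

lemma ip_diff_bound:
  assumes "u \<in> V" "v \<in> V" "w \<in> V"
  shows "cmod (ip u w - ip v w) \<le> dst u v * nm w"
  using Cauchy_Schwarz[of "comb u (- 1) v" w] assms by (simp add: dst_def ip_comb_left comb_closed)

lemma dst_self: "u \<in> V \<Longrightarrow> dst u u = 0"
  using nm_comb_power2[of u u "- 1"] by (simp add: dst_def ip_self)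

lemma dst_commute: "u \<in> V \<Longrightarrow> v \<in> V \<Longrightarrow> dst u v = dst v u"
proof -
  assume "u \<in> V" "v \<in> V"
  then have "(dst u v)\<^sup>2 = (dst v u)\<^sup>2"
    using ip_commute[of u v] by (simp add: dst_def nm_comb_power2)
  with \<open>u \<in> V\<close> \<open>v \<in> V\<close> show ?thesis
    by (simp add: dst_nonneg)
qed

lemma nm_comb_le:
  assumes "u \<in> V" "v \<in> V"
  shows "nm (comb u c v) \<le> nm u + cmod c * nm v"
proof -
  let ?w = "comb u c v"
  have w: "?w \<in> V"
    using assms by (rule comb_closed)
  have "nm ?w * nm ?w = cmod (ip ?w ?w)"
    using w by (simp add: cmod_ip_self)
  also have "\<dots> = cmod (ip u ?w + c * ip v ?w)"
    using assms w by (subst ip_comb_left) auto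
  also have "\<dots> \<le> cmod (ip u ?w) + cmod c * cmod (ip v ?w)"
    by (metis norm_mult norm_triangle_ineq)
  also have "\<dots> \<le> nm u * nm ?w + cmod c * (nm v * nm ?w)"
    using assms w by (intro add_mono mult_left_mono Cauchy_Schwarz) auto
  finally have "nm ?w * nm ?w \<le> (nm u + cmod c * nm v) * nm ?w"
    by (simp add: algebra_simps)
  then show ?thesis
    by (rule mult_self_le_imp_le) (use assms in \<open>auto simp: nm_nonneg\<close>)
qed

lemma dst_triangle:
  assumes "u \<in> V" "v \<in> V" "w \<in> V"
  shows "dst u w \<le> dst u v + dst v w"
proof -
  let ?z = "comb u (- 1) w"
  have z: "?z \<in> V"
    using assms by (simp add: comb_closed)
  have "dst u w * dst u w = cmod (ip ?z ?z)"
    using z by (simp add: cmod_ip_self dst_def)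
  also have "ip ?z ?z = (ip u ?z - ip v ?z) + (ip v ?z - ip w ?z)"
    using assms z by (subst ip_comb_left) auto
  also have "cmod \<dots> \<le> cmod (ip u ?z - ip v ?z) + cmod (ip v ?z - ip w ?z)"
    by (rule norm_triangle_ineq)
  also have "\<dots> \<le> dst u v * nm ?z + dst v w * nm ?z"
    using assms z by (intro add_mono ip_diff_bound) auto
  finally have "dst u w * dst u w \<le> (dst u v + dst v w) * dst u w"
    by (simp add: algebra_simps dst_def)
  then show ?thesis
    by (rule mult_self_le_imp_le) (use assms in \<open>auto simp: dst_nonneg\<close>)
qed

lemma tendsto_ip_left:
  assumes \<sigma>: "\<And>k. \<sigma> k \<in> V" and "w \<in> V" "v \<in> V"
    and lim: "(\<lambda>k. dst (\<sigma> k) w) \<longlonglongrightarrow> 0"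
  shows "(\<lambda>k. ip (\<sigma> k) v) \<longlonglongrightarrow> ip w v"
proof -
  have "(\<lambda>k. dst (\<sigma> k) w * nm v) \<longlonglongrightarrow> 0"
    using lim by (rule tendsto_mult_left_zero)
  then have "(\<lambda>k. ip (\<sigma> k) v - ip w v) \<longlonglongrightarrow> 0"
    by (rule Lim_null_comparison[rotated]) (use assms in \<open>auto intro!: always_eventually ip_diff_bound\<close>)
  then show ?thesis
    by (simp add: LIM_zero_iff)
qed

lemma tendsto_ip_right:
  assumes "\<And>k. \<sigma> k \<in> V" "w \<in> V" "v \<in> V" "(\<lambda>k. dst (\<sigma> k) w) \<longlonglongrightarrow> 0"
  shows "(\<lambda>k. ip v (\<sigma> k)) \<longlonglongrightarrow> ip v w"
proof -
  have "(\<lambda>k. cnj (ip (\<sigma> k) v)) \<longlonglongrightarrow> cnj (ip w v)"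
    using assms by (intro tendsto_cnj tendsto_ip_left)
  moreover have "cnj (ip u v) = ip v u" if "u \<in> V" for u
    using ip_commute[OF that assms(3)] by simp
  ultimately show ?thesis
    using assms(1,2) by simp
qed

text \<open>
  Best approximation of \<open>p\<close> from a subspace \<open>S\<close>. The graph to which this is applied is not closed,
  so the projection appears as a minimizing sequence. Its residuals are nearly orthogonal to \<open>S\<close>; testing them with the
  difference of two terms of the sequence shows that it is Cauchy. Closure of \<open>S\<close> under \<open>comb\<close> is
  asked for up to seminorm zero because the graph of a differential operator, whose values are
  determined only on the domain, has it only in this sense.
\<close>

lemma best_approximation_sequence:
  assumes "S \<subseteq> V" "S \<noteq> {}" and p: "p \<in> V"
    and S_comb: "\<And>u v c. u \<in> S \<Longrightarrow> v \<in> S \<Longrightarrow> \<exists>w\<in>S. \<forall>z\<in>V. ip w z = ip (comb u c v) z"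
  obtains \<sigma> where "\<forall>k. \<sigma> k \<in> S"
    and "\<forall>e>0. \<exists>K. \<forall>j\<ge>K. \<forall>k\<ge>K. dst (\<sigma> j) (\<sigma> k) < e"
    and "\<forall>v\<in>S. (\<lambda>k. ip (\<sigma> k) v) \<longlonglongrightarrow> ip p v"
proof -
  have S: "u \<in> V" if "u \<in> S" for u
    using that assms(1) by auto
  define \<delta> where "\<delta> k = 1 / real (Suc k)" for k
  define I where "I = (INF s\<in>S. (dst p s)\<^sup>2)"
  have bdd: "bdd_below ((\<lambda>s. (dst p s)\<^sup>2) ` S)"
    by (rule bdd_belowI2[of _ 0]) simp
  have "\<exists>s\<in>S. (dst p s)\<^sup>2 < I + \<delta> k" for k
    using cINF_less_iff[OF assms(2) bdd, of "I + \<delta> k"] by (simp add: I_def[symmetric] \<delta>_def)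
  then obtain \<sigma> where \<sigma>: "\<And>k. \<sigma> k \<in> S" and I: "\<And>k. (dst p (\<sigma> k))\<^sup>2 < I + \<delta> k"
    by metis
  have near: "cmod (ip p v - ip (\<sigma> k) v) \<le> sqrt (\<delta> k) * nm v" if v: "v \<in> S" for v k
  proof -
    let ?r = "comb p (- 1) (\<sigma> k)"
    have "(nm ?r)\<^sup>2 - \<delta> k \<le> (nm (comb ?r c v))\<^sup>2" for c
    proof -
      obtain w where w: "w \<in> S" and eq: "\<And>z. z \<in> V \<Longrightarrow> ip w z = ip (comb (\<sigma> k) (- c) v) z"
        using S_comb[OF \<sigma> v] by metis
      have "ip (comb p (- 1) w) z = ip (comb ?r c v) z" if "z \<in> V" for z
        using that p w v S \<sigma> by (simp add: ip_comb_left comb_closed eq)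
      then have "(dst p w)\<^sup>2 = (nm (comb ?r c v))\<^sup>2"
        unfolding dst_def using p w v S \<sigma> by (subst nm_eqI) (auto simp: comb_closed)
      moreover have "I \<le> (dst p w)\<^sup>2"
        unfolding I_def using bdd w by (rule cINF_lower)
      ultimately show ?thesis
        using I[of k] by (simp add: dst_def)
    qed
    then have "cmod (ip ?r v) \<le> sqrt (\<delta> k) * nm v"
      using p v S \<sigma> by (intro near_minimizer_near_orthogonal) (auto simp: comb_closed \<delta>_def)
    then show ?thesis
      using p v S \<sigma> by (simp add: ip_comb_left)
  qed
  have \<delta>0: "(\<lambda>k. sqrt (\<delta> k)) \<longlonglongrightarrow> 0"
    using tendsto_real_sqrt[OF LIMSEQ_Suc[OF lim_1_over_n]] by (simp add: \<delta>_def)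
  have orth: "(\<lambda>k. ip (\<sigma> k) v) \<longlonglongrightarrow> ip p v" if "v \<in> S" for v
  proof -
    have "(\<lambda>k. sqrt (\<delta> k) * nm v) \<longlonglongrightarrow> 0"
      using \<delta>0 by (rule tendsto_mult_left_zero)
    then have "(\<lambda>k. ip p v - ip (\<sigma> k) v) \<longlonglongrightarrow> 0"
      by (rule Lim_null_comparison[rotated]) (use near[OF that] in \<open>auto intro!: always_eventually\<close>)
    then have "(\<lambda>k. ip p v - (ip p v - ip (\<sigma> k) v)) \<longlonglongrightarrow> ip p v - 0"
      by (intro tendsto_diff tendsto_const)
    then show ?thesis
      by simp
  qed
  have dist: "dst (\<sigma> j) (\<sigma> k) \<le> sqrt (\<delta> j) + sqrt (\<delta> k)" for j k
  proof -
    let ?d = "comb (\<sigma> j) (- 1) (\<sigma> k)"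
    obtain v where v: "v \<in> S" and eq: "\<And>z. z \<in> V \<Longrightarrow> ip v z = ip ?d z"
      using S_comb[OF \<sigma> \<sigma>] by metis
    have d: "?d \<in> V"
      using \<sigma> S by (simp add: comb_closed)
    have nm: "nm v = nm ?d"
      using eq d v S by (intro nm_eqI) auto
    have "cmod (ip ?d v) = cmod (ip ?d ?d)"
      using eq[OF d] ip_commute[OF d S[OF v]] complex_mod_cnj by metis
    then have "nm ?d * nm ?d = cmod (ip ?d v)"
      using d by (simp add: cmod_ip_self)
    also have "ip ?d v = (ip p v - ip (\<sigma> k) v) - (ip p v - ip (\<sigma> j) v)"
      using \<sigma> v S by (simp add: ip_comb_left)
    also have "cmod \<dots> \<le> cmod (ip p v - ip (\<sigma> k) v) + cmod (ip p v - ip (\<sigma> j) v)"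
      by (rule norm_triangle_ineq4)
    also have "\<dots> \<le> sqrt (\<delta> k) * nm v + sqrt (\<delta> j) * nm v"
      using near[OF v] by (intro add_mono) auto
    finally have "nm ?d * nm ?d \<le> (sqrt (\<delta> j) + sqrt (\<delta> k)) * nm ?d"
      by (simp add: nm algebra_simps)
    then show ?thesis
      unfolding dst_def by (rule mult_self_le_imp_le) (simp add: \<delta>_def)
  qed
  have cauchy: "\<exists>K. \<forall>j\<ge>K. \<forall>k\<ge>K. dst (\<sigma> j) (\<sigma> k) < e" if "e > 0" for e
  proof -
    obtain K where K: "\<And>k. k \<ge> K \<Longrightarrow> sqrt (\<delta> k) < e / 2"
      using order_tendstoD(2)[OF \<delta>0, of "e / 2"] \<open>e > 0\<close> by (auto simp: eventually_sequentially)
    show ?thesis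
    proof (intro exI[of _ K] allI impI)
      fix j k assume "j \<ge> K" "k \<ge> K"
      then show "dst (\<sigma> j) (\<sigma> k) < e"
        using dist[of j k] K[of j] K[of k] by linarith
    qed
  qed
  show ?thesis
    using \<sigma> cauchy orth by (intro that[of \<sigma>]) blast+
qed

end

lemma semi_inner_space_weighted_product:
  assumes "semi_inner_space V comb\<^sub>V ip\<^sub>V" and "semi_inner_space W comb\<^sub>W ip\<^sub>W" and "\<epsilon> \<ge> 0"
  shows "semi_inner_space (V \<times> W) (\<lambda>x c y. (comb\<^sub>V (fst x) c (fst y), comb\<^sub>W (snd x) c (snd y)))
           (\<lambda>x y. ip\<^sub>V (fst x) (fst y) + of_real \<epsilon> * ip\<^sub>W (snd x) (snd y))"
proof -
  interpret V: semi_inner_space V comb\<^sub>V ip\<^sub>V by fact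
  interpret W: semi_inner_space W comb\<^sub>W ip\<^sub>W by fact
  show ?thesis
  proof
    fix x y assume "x \<in> V \<times> W" "y \<in> V \<times> W"
    then show "ip\<^sub>V (fst y) (fst x) + of_real \<epsilon> * ip\<^sub>W (snd y) (snd x) =
        cnj (ip\<^sub>V (fst x) (fst y) + of_real \<epsilon> * ip\<^sub>W (snd x) (snd y))"
      using V.ip_commute[of "fst x" "fst y"] W.ip_commute[of "snd x" "snd y"] by auto
  qed (use \<open>\<epsilon> \<ge> 0\<close> in \<open>auto simp: V.comb_closed W.comb_closed V.ip_comb_left W.ip_comb_left
      V.ip_nonneg W.ip_nonneg algebra_simps\<close>)
qed

section \<open>Completion of a pseudometric\<close>

lemma equiv_cauchy_seqs:
  assumes self: "\<And>u. u \<in> S \<Longrightarrow> d u u = 0"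
    and sym: "\<And>u v. u \<in> S \<Longrightarrow> v \<in> S \<Longrightarrow> d u v = d v u"
    and nonneg: "\<And>u v. u \<in> S \<Longrightarrow> v \<in> S \<Longrightarrow> d u v \<ge> 0"
    and triangle: "\<And>u v w. u \<in> S \<Longrightarrow> v \<in> S \<Longrightarrow> w \<in> S \<Longrightarrow> d u w \<le> d u v + d v w"
  shows "equiv (cauchy_seqs S d)
    {(\<sigma>, \<tau>). \<sigma> \<in> cauchy_seqs S d \<and> \<tau> \<in> cauchy_seqs S d \<and> (\<lambda>k. d (\<sigma> k) (\<tau> k)) \<longlonglongrightarrow> 0}"
    (is "equiv ?C ?R")
proof (rule equivI)
  have C: "\<sigma> k \<in> S" if "\<sigma> \<in> ?C" for \<sigma> k
    using that by (simp add: cauchy_seqs_def)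
  show "?R \<subseteq> ?C \<times> ?C"
    by auto
  show "refl_on ?C ?R"
    by (rule refl_onI) (auto simp: self C)
  show "sym ?R"
    by (rule symI) (auto simp: sym C)
  show "trans ?R"
  proof (rule transI, clarsimp)
    fix \<sigma> \<tau> \<rho> assume *: "\<sigma> \<in> ?C" "\<tau> \<in> ?C" "\<rho> \<in> ?C"
      and "(\<lambda>k. d (\<sigma> k) (\<tau> k)) \<longlonglongrightarrow> 0" "(\<lambda>k. d (\<tau> k) (\<rho> k)) \<longlonglongrightarrow> 0"
    then have "(\<lambda>k. d (\<sigma> k) (\<tau> k) + d (\<tau> k) (\<rho> k)) \<longlonglongrightarrow> 0"
      using tendsto_add_zero by blast
    then show "(\<lambda>k. d (\<sigma> k) (\<rho> k)) \<longlonglongrightarrow> 0"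
      by (rule Lim_null_comparison[rotated])
        (use * in \<open>auto intro!: always_eventually triangle simp: nonneg C\<close>)
  qed
qed

section \<open>The variational problem on a completion\<close>

text \<open>
  \<open>S\<close> is a subspace of \<open>H\<close>, to be completed with respect to the graph norm of \<open>T\<close>. Completeness
  of \<open>H\<close> and \<open>K\<close> provides the continuous extensions \<open>emb\<close> and \<open>ext\<close> of the inclusion and of \<open>T\<close>
  to the completion; limits are unique only up to seminorm zero, so the extensions are choices.
  Linearity of \<open>T\<close> is expressed through pairings because a differential operator is linear only
  over the domain, and pairings see nothing else.
\<close>

locale graph_completion =
  H: semi_inner_space H comb\<^sub>H ip\<^sub>H + K: semi_inner_space K comb\<^sub>K ip\<^sub>K
  for H :: "'s set" and comb\<^sub>H ip\<^sub>H and K :: "'t set" and comb\<^sub>K ip\<^sub>K +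
  fixes S :: "'s set" and T :: "'s \<Rightarrow> 't"
  assumes S_H: "S \<subseteq> H" and S_nonempty: "S \<noteq> {}"
    and S_comb: "u \<in> S \<Longrightarrow> v \<in> S \<Longrightarrow> comb\<^sub>H u c v \<in> S"
    and T_K: "u \<in> S \<Longrightarrow> T u \<in> K"
    and T_comb: "u \<in> S \<Longrightarrow> v \<in> S \<Longrightarrow> z \<in> K \<Longrightarrow> ip\<^sub>K (T (comb\<^sub>H u c v)) z = ip\<^sub>K (comb\<^sub>K (T u) c (T v)) z"
    and H_complete: "(\<And>k. \<sigma> k \<in> H) \<Longrightarrow>
      (\<And>e. e > 0 \<Longrightarrow> \<exists>N. \<forall>j\<ge>N. \<forall>k\<ge>N. H.dst (\<sigma> j) (\<sigma> k) < e) \<Longrightarrow> \<exists>w\<in>H. (\<lambda>k. H.dst (\<sigma> k) w) \<longlonglongrightarrow> 0"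
    and K_complete: "(\<And>k. \<rho> k \<in> K) \<Longrightarrow>
      (\<And>e. e > 0 \<Longrightarrow> \<exists>N. \<forall>j\<ge>N. \<forall>k\<ge>N. K.dst (\<rho> j) (\<rho> k) < e) \<Longrightarrow> \<exists>w\<in>K. (\<lambda>k. K.dst (\<rho> k) w) \<longlonglongrightarrow> 0"
begin

definition gdist :: "'s \<Rightarrow> 's \<Rightarrow> real" where
  "gdist u v = (let w = comb\<^sub>H u (- 1) v in sqrt (Re (ip\<^sub>H w w + ip\<^sub>K (T w) (T w))))"

definition emb :: "(nat \<Rightarrow> 's) set \<Rightarrow> 's" where
  "emb U = (SOME w. w \<in> H \<and> (\<forall>\<sigma>\<in>U. (\<lambda>k. H.dst (\<sigma> k) w) \<longlonglongrightarrow> 0))"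

definition ext :: "(nat \<Rightarrow> 's) set \<Rightarrow> 't" where
  "ext U = (SOME w. w \<in> K \<and> (\<forall>\<sigma>\<in>U. (\<lambda>k. K.dst (T (\<sigma> k)) w) \<longlonglongrightarrow> 0))"

definition pair_comb :: "'t \<times> 's \<Rightarrow> complex \<Rightarrow> 't \<times> 's \<Rightarrow> 't \<times> 's" where
  "pair_comb x c y = (comb\<^sub>K (fst x) c (fst y), comb\<^sub>H (snd x) c (snd y))"

text \<open>On pairs \<open>(T u, u)\<close> the weight 1 gives the graph norm, and a weight \<open>\<epsilon>\<close> the form of the
  variational problem.\<close>

definition pair_ip :: "real \<Rightarrow> 't \<times> 's \<Rightarrow> 't \<times> 's \<Rightarrow> complex" where
  "pair_ip \<epsilon> x y = ip\<^sub>K (fst x) (fst y) + of_real \<epsilon> * ip\<^sub>H (snd x) (snd y)"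

abbreviation graph :: "'s \<Rightarrow> 't \<times> 's" where "graph u \<equiv> (T u, u)"

abbreviation limit_pair :: "(nat \<Rightarrow> 's) set \<Rightarrow> 't \<times> 's" where "limit_pair U \<equiv> (ext U, emb U)"

lemma S_in_H: "u \<in> S \<Longrightarrow> u \<in> H"
  using S_H by auto

lemma pair_semi_inner_space: "\<epsilon> \<ge> 0 \<Longrightarrow> semi_inner_space (K \<times> H) pair_comb (pair_ip \<epsilon>)"
  using semi_inner_space_weighted_product[OF K.semi_inner_space_axioms H.semi_inner_space_axioms]
  unfolding pair_comb_def[abs_def] pair_ip_def[abs_def] by blast

lemma pair_nm:
  assumes "\<epsilon> \<ge> 0" "x \<in> K \<times> H"
  shows "semi_inner_space.nm (pair_ip \<epsilon>) x = sqrt ((K.nm (fst x))\<^sup>2 + \<epsilon> * (H.nm (snd x))\<^sup>2)"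
  using assms by (auto simp: semi_inner_space.nm_def[OF pair_semi_inner_space] pair_ip_def K.nm_power2 H.nm_power2)

lemma pair_dst:
  assumes "\<epsilon> \<ge> 0" "x \<in> K \<times> H" "y \<in> K \<times> H"
  shows "semi_inner_space.dst pair_comb (pair_ip \<epsilon>) x y =
    sqrt ((K.dst (fst x) (fst y))\<^sup>2 + \<epsilon> * (H.dst (snd x) (snd y))\<^sup>2)"
proof -
  have "pair_comb x (- 1) y \<in> K \<times> H"
    using assms(2,3) by (auto simp: pair_comb_def K.comb_closed H.comb_closed)
  then show ?thesis
    using assms(1) by (simp add: semi_inner_space.dst_def[OF pair_semi_inner_space] pair_nm)
      (simp add: pair_comb_def K.dst_def H.dst_def)
qed

lemma gdist_eq:
  assumes "u \<in> S" "v \<in> S"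
  shows "gdist u v = sqrt ((K.dst (T u) (T v))\<^sup>2 + (H.dst u v)\<^sup>2)"
proof -
  let ?w = "comb\<^sub>H u (- 1) v"
  have w: "?w \<in> S" "?w \<in> H" "T ?w \<in> K"
    using assms by (auto simp: S_comb S_in_H T_K)
  have "K.nm (T ?w) = K.dst (T u) (T v)"
    unfolding K.dst_def using assms w by (intro K.nm_eqI) (auto simp: K.comb_closed T_K T_comb)
  then show ?thesis
    using w by (simp add: gdist_def H.dst_def K.nm_power2[symmetric] H.nm_power2[symmetric] add.commute)
qed

lemma gdist_eq_pair_dst:
  "u \<in> S \<Longrightarrow> v \<in> S \<Longrightarrow> gdist u v = semi_inner_space.dst pair_comb (pair_ip 1) (graph u) (graph v)"
  by (simp add: gdist_eq pair_dst T_K S_in_H)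

lemma dst_le_gdist:
  assumes "u \<in> S" "v \<in> S"
  shows "H.dst u v \<le> gdist u v" "K.dst (T u) (T v) \<le> gdist u v"
  by (simp_all add: gdist_eq[OF assms] real_le_rsqrt)

lemma gdist_le_add:
  assumes "u \<in> S" "v \<in> S"
  shows "gdist u v \<le> K.dst (T u) (T v) + H.dst u v"
  unfolding gdist_eq[OF assms]
  using assms by (intro sqrt_sum_squares_le_sum K.dst_nonneg H.dst_nonneg) (auto simp: T_K S_in_H)

abbreviation cauchy_rel :: "((nat \<Rightarrow> 's) \<times> (nat \<Rightarrow> 's)) set" where
  "cauchy_rel \<equiv> {(\<sigma>, \<tau>). \<sigma> \<in> cauchy_seqs S gdist \<and> \<tau> \<in> cauchy_seqs S gdist \<and>
     (\<lambda>k. gdist (\<sigma> k) (\<tau> k)) \<longlonglongrightarrow> 0}"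

lemma equiv_cauchy_rel: "equiv (cauchy_seqs S gdist) cauchy_rel"
proof -
  interpret P: semi_inner_space "K \<times> H" pair_comb "pair_ip 1"
    by (rule pair_semi_inner_space) simp
  have g: "graph u \<in> K \<times> H" if "u \<in> S" for u
    using that by (simp add: T_K S_in_H)
  show ?thesis
    by (rule equiv_cauchy_seqs)
      (simp_all add: gdist_eq_pair_dst P.dst_self[OF g] P.dst_nonneg[OF g g] P.dst_commute[OF g g] P.dst_triangle[OF g g g] g del: mem_Times_iff)
qed

lemma cauchy_seqsD:
  assumes "\<sigma> \<in> cauchy_seqs S gdist"
  shows "\<sigma> k \<in> S" and "e > 0 \<Longrightarrow> \<exists>N. \<forall>j\<ge>N. \<forall>k\<ge>N. gdist (\<sigma> j) (\<sigma> k) < e"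
  using assms by (auto simp: cauchy_seqs_def)

lemma completion_members:
  assumes "U \<in> completion S gdist"
  obtains \<sigma> where "\<sigma> \<in> cauchy_seqs S gdist" "\<sigma> \<in> U" "U = cauchy_rel `` {\<sigma>}"
proof -
  obtain \<sigma> where "\<sigma> \<in> cauchy_seqs S gdist" "U = cauchy_rel `` {\<sigma>}"
    using assms unfolding completion_def by (rule quotientE)
  with equiv_class_self[OF equiv_cauchy_rel this(1)] show ?thesis
    by (intro that[of \<sigma>]) simp_all
qed

lemma emb_ext:
  assumes U: "U \<in> completion S gdist"
  shows "emb U \<in> H" "\<And>\<sigma>. \<sigma> \<in> U \<Longrightarrow> (\<lambda>k. H.dst (\<sigma> k) (emb U)) \<longlonglongrightarrow> 0"
    and "ext U \<in> K" "\<And>\<sigma>. \<sigma> \<in> U \<Longrightarrow> (\<lambda>k. K.dst (T (\<sigma> k)) (ext U)) \<longlonglongrightarrow> 0"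
proof -
  obtain \<sigma> where \<sigma>: "\<sigma> \<in> cauchy_seqs S gdist" and U_eq: "U = cauchy_rel `` {\<sigma>}"
    by (rule completion_members[OF U])
  note \<sigma>S = cauchy_seqsD(1)[OF \<sigma>]
  have "\<exists>N. \<forall>j\<ge>N. \<forall>k\<ge>N. H.dst (\<sigma> j) (\<sigma> k) < e" if "e > 0" for e
    using cauchy_seqsD(2)[OF \<sigma> that] dst_le_gdist(1)[OF \<sigma>S \<sigma>S] order_le_less_trans by metis
  then obtain w where w: "w \<in> H" "(\<lambda>k. H.dst (\<sigma> k) w) \<longlonglongrightarrow> 0"
    using H_complete[of \<sigma>] S_in_H[OF \<sigma>S] by blast
  have "\<exists>N. \<forall>j\<ge>N. \<forall>k\<ge>N. K.dst (T (\<sigma> j)) (T (\<sigma> k)) < e" if "e > 0" for e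
    using cauchy_seqsD(2)[OF \<sigma> that] dst_le_gdist(2)[OF \<sigma>S \<sigma>S] order_le_less_trans by metis
  then obtain z where z: "z \<in> K" "(\<lambda>k. K.dst (T (\<sigma> k)) z) \<longlonglongrightarrow> 0"
    using K_complete[of "\<lambda>k. T (\<sigma> k)"] T_K[OF \<sigma>S] by blast
  have lim: "(\<lambda>k. H.dst (\<tau> k) w) \<longlonglongrightarrow> 0 \<and> (\<lambda>k. K.dst (T (\<tau> k)) z) \<longlonglongrightarrow> 0" if "\<tau> \<in> U" for \<tau>
  proof
    have \<tau>: "\<tau> \<in> cauchy_seqs S gdist" and rel: "(\<lambda>k. gdist (\<sigma> k) (\<tau> k)) \<longlonglongrightarrow> 0"
      using that by (auto simp: U_eq)
    note \<tau>S = cauchy_seqsD(1)[OF \<tau>]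
    show "(\<lambda>k. H.dst (\<tau> k) w) \<longlonglongrightarrow> 0"
    proof (rule Lim_null_comparison[OF always_eventually tendsto_add_zero[OF rel w(2)]], rule allI)
      fix k
      have "H.dst (\<tau> k) w \<le> H.dst (\<sigma> k) (\<tau> k) + H.dst (\<sigma> k) w"
        using H.dst_triangle[OF S_in_H[OF \<tau>S] S_in_H[OF \<sigma>S] w(1), of k k]
          H.dst_commute[OF S_in_H[OF \<tau>S] S_in_H[OF \<sigma>S], of k k] by linarith
      then show "norm (H.dst (\<tau> k) w) \<le> gdist (\<sigma> k) (\<tau> k) + H.dst (\<sigma> k) w"
        using dst_le_gdist(1)[OF \<sigma>S \<tau>S, of k k] H.dst_nonneg[OF S_in_H[OF \<tau>S] w(1), of k] by simp
    qed
    show "(\<lambda>k. K.dst (T (\<tau> k)) z) \<longlonglongrightarrow> 0"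
    proof (rule Lim_null_comparison[OF always_eventually tendsto_add_zero[OF rel z(2)]], rule allI)
      fix k
      have "K.dst (T (\<tau> k)) z \<le> K.dst (T (\<sigma> k)) (T (\<tau> k)) + K.dst (T (\<sigma> k)) z"
        using K.dst_triangle[OF T_K[OF \<tau>S] T_K[OF \<sigma>S] z(1), of k k]
          K.dst_commute[OF T_K[OF \<tau>S] T_K[OF \<sigma>S], of k k] by linarith
      then show "norm (K.dst (T (\<tau> k)) z) \<le> gdist (\<sigma> k) (\<tau> k) + K.dst (T (\<sigma> k)) z"
        using dst_le_gdist(2)[OF \<sigma>S \<tau>S, of k k] K.dst_nonneg[OF T_K[OF \<tau>S] z(1), of k] by simp
    qed
  qed
  have "\<exists>w. w \<in> H \<and> (\<forall>\<sigma>\<in>U. (\<lambda>k. H.dst (\<sigma> k) w) \<longlonglongrightarrow> 0)"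
    using w(1) lim by blast
  from someI_ex[OF this] have "emb U \<in> H \<and> (\<forall>\<sigma>\<in>U. (\<lambda>k. H.dst (\<sigma> k) (emb U)) \<longlonglongrightarrow> 0)"
    unfolding emb_def .
  then show "emb U \<in> H" "\<And>\<sigma>. \<sigma> \<in> U \<Longrightarrow> (\<lambda>k. H.dst (\<sigma> k) (emb U)) \<longlonglongrightarrow> 0"
    by blast+
  have "\<exists>w. w \<in> K \<and> (\<forall>\<sigma>\<in>U. (\<lambda>k. K.dst (T (\<sigma> k)) w) \<longlonglongrightarrow> 0)"
    using z(1) lim by blast
  from someI_ex[OF this] have "ext U \<in> K \<and> (\<forall>\<sigma>\<in>U. (\<lambda>k. K.dst (T (\<sigma> k)) (ext U)) \<longlonglongrightarrow> 0)"
    unfolding ext_def .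
  then show "ext U \<in> K" "\<And>\<sigma>. \<sigma> \<in> U \<Longrightarrow> (\<lambda>k. K.dst (T (\<sigma> k)) (ext U)) \<longlonglongrightarrow> 0"
    by blast+
qed

lemma limit_pair_closed: "U \<in> completion S gdist \<Longrightarrow> limit_pair U \<in> K \<times> H"
  by (simp add: emb_ext)

text \<open>
  The pair \<open>(ext U, emb U)\<close> determines the class \<open>U\<close>, because the graph distance of two
  representing sequences tends to the distance of the pairs. This is what turns uniqueness up to
  seminorm zero into uniqueness in the completion.
\<close>

lemma completion_eqI:
  assumes U: "U \<in> completion S gdist" and V: "V \<in> completion S gdist"
    and eq: "H.dst (emb U) (emb V) = 0" "K.dst (ext U) (ext V) = 0"
  shows "U = V"
proof -
  obtain \<sigma> where \<sigma>: "\<sigma> \<in> cauchy_seqs S gdist" "\<sigma> \<in> U" "U = cauchy_rel `` {\<sigma>}"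
    using completion_members[OF U] .
  obtain \<tau> where \<tau>: "\<tau> \<in> cauchy_seqs S gdist" "\<tau> \<in> V" "V = cauchy_rel `` {\<tau>}"
    using completion_members[OF V] .
  note \<sigma>S = cauchy_seqsD(1)[OF \<sigma>(1)] and \<tau>S = cauchy_seqsD(1)[OF \<tau>(1)]
  note limU = emb_ext[OF U] and limV = emb_ext[OF V]
  have lim: "(\<lambda>k. (K.dst (T (\<sigma> k)) (ext U) + K.dst (T (\<tau> k)) (ext V)) +
      (H.dst (\<sigma> k) (emb U) + H.dst (\<tau> k) (emb V))) \<longlonglongrightarrow> 0"
    by (intro tendsto_add_zero limU(2,4) limV(2,4) \<sigma>(2) \<tau>(2))
  have "(\<lambda>k. gdist (\<sigma> k) (\<tau> k)) \<longlonglongrightarrow> 0"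
  proof (rule Lim_null_comparison[OF always_eventually lim], rule allI)
    fix k
    have s: "\<sigma> k \<in> H" "T (\<sigma> k) \<in> K" "\<tau> k \<in> H" "T (\<tau> k) \<in> K"
      using \<sigma>S \<tau>S by (auto simp: S_in_H T_K)
    have "H.dst (\<sigma> k) (\<tau> k) \<le> H.dst (\<sigma> k) (emb U) + (H.dst (emb U) (emb V) + H.dst (emb V) (\<tau> k))"
      using H.dst_triangle[of "\<sigma> k" "emb U" "\<tau> k"] H.dst_triangle[of "emb U" "emb V" "\<tau> k"] s limU(1) limV(1)
      by simp
    moreover have "K.dst (T (\<sigma> k)) (T (\<tau> k)) \<le>
        K.dst (T (\<sigma> k)) (ext U) + (K.dst (ext U) (ext V) + K.dst (ext V) (T (\<tau> k)))"
      using K.dst_triangle[of "T (\<sigma> k)" "ext U" "T (\<tau> k)"] K.dst_triangle[of "ext U" "ext V" "T (\<tau> k)"]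
        s limU(3) limV(3) by simp
    moreover have "H.dst (emb V) (\<tau> k) = H.dst (\<tau> k) (emb V)" "K.dst (ext V) (T (\<tau> k)) = K.dst (T (\<tau> k)) (ext V)"
      using s limV by (auto intro: H.dst_commute K.dst_commute)
    moreover have "0 \<le> gdist (\<sigma> k) (\<tau> k)"
      using \<sigma>S \<tau>S by (simp add: gdist_eq)
    ultimately show "norm (gdist (\<sigma> k) (\<tau> k)) \<le>
        (K.dst (T (\<sigma> k)) (ext U) + K.dst (T (\<tau> k)) (ext V)) + (H.dst (\<sigma> k) (emb U) + H.dst (\<tau> k) (emb V))"
      using gdist_le_add[OF \<sigma>S \<tau>S, of k k] eq by simp
  qed
  then have "(\<sigma>, \<tau>) \<in> cauchy_rel"
    using \<sigma>(1) \<tau>(1) by simp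
  then show ?thesis
    using equiv_class_eq[OF equiv_cauchy_rel] \<sigma>(3) \<tau>(3) by simp
qed

lemma graph_tendsto_limit_pair:
  assumes "\<epsilon> \<ge> 0" and U: "U \<in> completion S gdist" "\<sigma> \<in> U" and \<sigma>: "\<And>k. \<sigma> k \<in> S"
  shows "(\<lambda>k. semi_inner_space.dst pair_comb (pair_ip \<epsilon>) (graph (\<sigma> k)) (limit_pair U)) \<longlonglongrightarrow> 0"
proof -
  have "(\<lambda>k. sqrt ((K.dst (T (\<sigma> k)) (ext U))\<^sup>2 + \<epsilon> * (H.dst (\<sigma> k) (emb U))\<^sup>2)) \<longlonglongrightarrow> sqrt (0\<^sup>2 + \<epsilon> * 0\<^sup>2)"
    by (intro tendsto_intros emb_ext[OF U(1)] U(2))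
  then show ?thesis
    using assms emb_ext[OF U(1)] by (simp add: pair_dst T_K S_in_H)
qed

definition weak_solution :: "real \<Rightarrow> 't \<Rightarrow> 's \<Rightarrow> (nat \<Rightarrow> 's) set \<Rightarrow> bool" where
  "weak_solution \<epsilon> f h U \<longleftrightarrow>
     (\<forall>V\<in>completion S gdist. pair_ip \<epsilon> (limit_pair U) (limit_pair V) = pair_ip \<epsilon> (f, h) (limit_pair V))"

text \<open>
  The solution is the orthogonal projection of \<open>(f, h)\<close> onto the closure of the graph of \<open>T\<close>.
  A minimizing sequence in the graph is Cauchy for the weighted norm, hence for the graph norm, and
  its class solves the equation: orthogonality to the graph passes to limits in both arguments.
\<close>

lemma weak_solution_exists:
  assumes \<epsilon>: "\<epsilon> > 0" and f: "f \<in> K" and h: "h \<in> H"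
  obtains U where "U \<in> completion S gdist" "weak_solution \<epsilon> f h U"
proof -
  interpret P: semi_inner_space "K \<times> H" pair_comb "pair_ip \<epsilon>"
    using \<epsilon> by (intro pair_semi_inner_space) simp
  have p: "(f, h) \<in> K \<times> H"
    using f h by simp
  have graph: "graph u \<in> K \<times> H" if "u \<in> S" for u
    using that by (simp add: T_K S_in_H)
  have graph_S: "graph ` S \<subseteq> K \<times> H" "graph ` S \<noteq> {}"
    using graph S_nonempty by auto
  have graph_comb: "\<exists>w\<in>graph ` S. \<forall>z\<in>K \<times> H. pair_ip \<epsilon> w z = pair_ip \<epsilon> (pair_comb x c y) z"
    if "x \<in> graph ` S" "y \<in> graph ` S" for x y c
  proof -
    obtain u v where uv: "x = graph u" "u \<in> S" "y = graph v" "v \<in> S"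
      using \<open>x \<in> graph ` S\<close> \<open>y \<in> graph ` S\<close> by auto
    then show ?thesis
      by (intro bexI[of _ "graph (comb\<^sub>H u c v)"]) (auto simp: S_comb pair_ip_def pair_comb_def T_comb)
  qed
  obtain \<rho> where \<rho>: "\<forall>k. \<rho> k \<in> graph ` S"
    and cauchy: "\<forall>e>0. \<exists>N. \<forall>j\<ge>N. \<forall>k\<ge>N. P.dst (\<rho> j) (\<rho> k) < e"
    and orth: "\<forall>v\<in>graph ` S. (\<lambda>k. pair_ip \<epsilon> (\<rho> k) v) \<longlonglongrightarrow> pair_ip \<epsilon> (f, h) v"
    by (rule P.best_approximation_sequence[OF graph_S p graph_comb])
  define \<sigma> where "\<sigma> k = snd (\<rho> k)" for k
  have \<sigma>: "\<sigma> k \<in> S" "\<rho> k = graph (\<sigma> k)" for k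
    using spec[OF \<rho>, of k] by (auto simp: \<sigma>_def)
  \<comment> \<open>\<open>c\<close> compares the two norms: \<open>c (a + \<epsilon> b)\<close> exceeds \<open>a + b\<close> by \<open>a / \<epsilon> + \<epsilon> b\<close>\<close>
  define c where "c = 1 + 1 / \<epsilon>"
  have c: "c > 0"
    using \<epsilon> by (simp add: c_def add_pos_pos)
  have gdist_le: "gdist (\<sigma> j) (\<sigma> k) \<le> sqrt c * P.dst (\<rho> j) (\<rho> k)" for j k
  proof -
    let ?a = "(K.dst (T (\<sigma> j)) (T (\<sigma> k)))\<^sup>2" and ?b = "(H.dst (\<sigma> j) (\<sigma> k))\<^sup>2"
    have "c * (?a + \<epsilon> * ?b) = (?a + ?b) + (?a / \<epsilon> + \<epsilon> * ?b)"
      using \<epsilon> by (simp add: c_def field_simps)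
    then have "?a + ?b \<le> c * (?a + \<epsilon> * ?b)"
      using \<epsilon> by simp
    then have "sqrt (?a + ?b) \<le> sqrt c * sqrt (?a + \<epsilon> * ?b)"
      by (simp flip: real_sqrt_mult)
    then show ?thesis
      using \<epsilon> \<sigma> by (simp add: gdist_eq pair_dst T_K S_in_H)
  qed
  have "\<sigma> \<in> cauchy_seqs S gdist"
    unfolding cauchy_seqs_def
  proof (intro CollectI conjI allI impI)
    fix e :: real assume "e > 0"
    then obtain N where N: "\<And>j k. j \<ge> N \<Longrightarrow> k \<ge> N \<Longrightarrow> P.dst (\<rho> j) (\<rho> k) < e / sqrt c"
      using cauchy[rule_format, of "e / sqrt c"] c by auto
    have "gdist (\<sigma> j) (\<sigma> k) < e" if "j \<ge> N" "k \<ge> N" for j k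
    proof -
      have "sqrt c * P.dst (\<rho> j) (\<rho> k) < e"
        using N[OF that] c by (simp add: field_simps)
      with gdist_le[of j k] show ?thesis
        by linarith
    qed
    then show "\<exists>N. \<forall>j\<ge>N. \<forall>k\<ge>N. gdist (\<sigma> j) (\<sigma> k) < e"
      by blast
  qed (rule \<sigma>)
  define U where "U = cauchy_rel `` {\<sigma>}"
  have U: "U \<in> completion S gdist" "\<sigma> \<in> U"
    unfolding U_def completion_def
    using quotientI[OF \<open>\<sigma> \<in> cauchy_seqs S gdist\<close>] equiv_class_self[OF equiv_cauchy_rel \<open>\<sigma> \<in> cauchy_seqs S gdist\<close>]
    by blast+
  have graph_orth: "pair_ip \<epsilon> (limit_pair U) (graph v) = pair_ip \<epsilon> (f, h) (graph v)" if "v \<in> S" for v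
  proof (rule LIMSEQ_unique)
    show "(\<lambda>k. pair_ip \<epsilon> (\<rho> k) (graph v)) \<longlonglongrightarrow> pair_ip \<epsilon> (f, h) (graph v)"
      using that orth by simp
    show "(\<lambda>k. pair_ip \<epsilon> (\<rho> k) (graph v)) \<longlonglongrightarrow> pair_ip \<epsilon> (limit_pair U) (graph v)"
      unfolding \<sigma>(2) using that \<epsilon> \<sigma>(1) U
      by (intro P.tendsto_ip_left graph limit_pair_closed graph_tendsto_limit_pair) auto
  qed
  have "weak_solution \<epsilon> f h U"
    unfolding weak_solution_def
  proof
    fix V assume V: "V \<in> completion S gdist"
    obtain \<tau> where \<tau>: "\<tau> \<in> cauchy_seqs S gdist" "\<tau> \<in> V"
      by (rule completion_members[OF V])
    note \<tau>S = cauchy_seqsD(1)[OF \<tau>(1)]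
    have lim: "(\<lambda>k. pair_ip \<epsilon> x (graph (\<tau> k))) \<longlonglongrightarrow> pair_ip \<epsilon> x (limit_pair V)" if "x \<in> K \<times> H" for x
      using that \<epsilon> \<tau>S V \<tau>(2)
      by (intro P.tendsto_ip_right graph limit_pair_closed graph_tendsto_limit_pair) auto
    show "pair_ip \<epsilon> (limit_pair U) (limit_pair V) = pair_ip \<epsilon> (f, h) (limit_pair V)"
      using lim[OF limit_pair_closed[OF U(1)]] lim[OF p] LIMSEQ_unique by (simp add: graph_orth \<tau>S) blast
  qed
  with U(1) show ?thesis
    by (rule that)
qed

text \<open>Both solutions may serve as test elements, so their difference pairs to zero with itself.\<close>

lemma weak_solution_unique:
  assumes \<epsilon>: "\<epsilon> > 0"
    and U: "U \<in> completion S gdist" "weak_solution \<epsilon> f h U"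
    and V: "V \<in> completion S gdist" "weak_solution \<epsilon> f h V"
  shows "U = V"
proof -
  interpret P: semi_inner_space "K \<times> H" pair_comb "pair_ip \<epsilon>"
    using \<epsilon> by (intro pair_semi_inner_space) simp
  note c = limit_pair_closed[OF U(1)] limit_pair_closed[OF V(1)]
  let ?d = "pair_comb (limit_pair U) (- 1) (limit_pair V)"
  have "pair_ip \<epsilon> (limit_pair U) (limit_pair W) = pair_ip \<epsilon> (limit_pair V) (limit_pair W)"
    if "W \<in> completion S gdist" for W
    using U(2) V(2) that by (simp add: weak_solution_def)
  then have "pair_ip \<epsilon> ?d ?d = 0"
    using U(1) V(1) c by (simp add: P.ip_comb_left P.ip_comb_right P.comb_closed del: mem_Times_iff)
  then have "P.dst (limit_pair U) (limit_pair V) = 0"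
    by (simp add: P.dst_def P.nm_def)
  then have "(K.dst (ext U) (ext V))\<^sup>2 + \<epsilon> * (H.dst (emb U) (emb V))\<^sup>2 = 0"
    using \<epsilon> c by (simp add: pair_dst)
  then have "(K.dst (ext U) (ext V))\<^sup>2 = 0 \<and> \<epsilon> * (H.dst (emb U) (emb V))\<^sup>2 = 0"
    using \<epsilon> by (subst (asm) add_nonneg_eq_0_iff) auto
  then show ?thesis
    using \<epsilon> by (intro completion_eqI[OF U(1) V(1)]) auto
qed

text \<open>Testing with the solution itself shows that its weighted norm is at most that of \<open>(f, h)\<close>.\<close>

lemma weak_solution_bound:
  assumes \<epsilon>: "\<epsilon> > 0" and f: "f \<in> K" and h: "h \<in> H"
    and U: "U \<in> completion S gdist" "weak_solution \<epsilon> f h U"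
  shows "sqrt (Re (pair_ip \<epsilon> (limit_pair U) (limit_pair U))) \<le> K.nm f + sqrt \<epsilon> * H.nm h"
proof -
  interpret P: semi_inner_space "K \<times> H" pair_comb "pair_ip \<epsilon>"
    using \<epsilon> by (intro pair_semi_inner_space) simp
  have p: "(f, h) \<in> K \<times> H"
    using f h by simp
  note c = limit_pair_closed[OF U(1)]
  have "P.nm (limit_pair U) * P.nm (limit_pair U) = cmod (pair_ip \<epsilon> (limit_pair U) (limit_pair U))"
    using c by (rule P.cmod_ip_self[symmetric])
  also have "\<dots> = cmod (pair_ip \<epsilon> (f, h) (limit_pair U))"
    using U by (simp add: weak_solution_def)
  also have "\<dots> \<le> P.nm (f, h) * P.nm (limit_pair U)"
    using p c by (rule P.Cauchy_Schwarz)
  finally have "P.nm (limit_pair U) \<le> P.nm (f, h)"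
    by (rule mult_self_le_imp_le) (rule P.nm_nonneg[OF p])
  also have "\<dots> = sqrt ((K.nm f)\<^sup>2 + (sqrt \<epsilon> * H.nm h)\<^sup>2)"
    using \<epsilon> p by (simp add: pair_nm power_mult_distrib)
  also have "\<dots> \<le> K.nm f + sqrt \<epsilon> * H.nm h"
    using \<epsilon> f h by (intro sqrt_sum_squares_le_sum) (auto simp: K.nm_nonneg H.nm_nonneg)
  finally show ?thesis
    by (simp add: P.nm_def)
qed

end

section \<open>The fibres of a Hermitian bundle\<close>

lemma invertible_mat_obtain_inverse:
  assumes "M \<in> carrier_mat k k" "invertible_mat M"
  obtains N where "N \<in> carrier_mat k k" "M * N = 1\<^sub>m k" "N * M = 1\<^sub>m k"
proof -
  obtain N where N: "M * N = 1\<^sub>m (dim_row M)" "N * M = 1\<^sub>m (dim_row N)"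
    using assms(2) by (auto simp: invertible_mat_def inverts_mat_def)
  have "dim_col (M * N) = k"
    unfolding N(1) using assms(1) by simp
  moreover have "dim_col (N * M) = dim_row N"
    unfolding N(2) by simp
  ultimately have "N \<in> carrier_mat k k"
    using assms(1) by auto
  with N assms(1) show ?thesis
    by (intro that[of N]) auto
qed

lemma det_nonzero_obtain_left_inverse:
  fixes M :: "'a::field mat"
  assumes M: "M \<in> carrier_mat k k"
    and inj: "\<And>z. z \<in> carrier_vec k \<Longrightarrow> M *\<^sub>v z = 0\<^sub>v k \<Longrightarrow> z = 0\<^sub>v k"
  obtains N where "N \<in> carrier_mat k k" "N * M = 1\<^sub>m k"
proof -
  have "Determinant.det M \<noteq> 0"
    using det_0_iff_vec_prod_zero[OF M] inj by blast
  from det_non_zero_imp_unit[OF M this, unfolded Units_def, of "()"] show ?thesis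
    using that by (auto simp: ring_mat_def)
qed

lemma mult_mat_vec_invertible_cancel:
  assumes M: "M \<in> carrier_mat k k" "invertible_mat M"
    and "v \<in> carrier_vec k" "w \<in> carrier_vec k" "M *\<^sub>v v = M *\<^sub>v w"
  shows "v = w"
proof -
  obtain N where N: "N \<in> carrier_mat k k" "N * M = 1\<^sub>m k"
    using invertible_mat_obtain_inverse[OF M] by metis
  have "v = N *\<^sub>v (M *\<^sub>v v)"
    using M(1) N assms(3) by (simp flip: assoc_mult_mat_vec)
  also have "\<dots> = w"
    unfolding assms(5) using M(1) N assms(4) by (simp flip: assoc_mult_mat_vec)
  finally show ?thesis .
qed

lemma mult_mat_vec_comb_index:
  fixes M :: "complex mat"
  assumes "M \<in> carrier_mat r k" "v \<in> carrier_vec k" "w \<in> carrier_vec k" "i < r"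
  shows "(M *\<^sub>v (v + c \<cdot>\<^sub>v w)) $ i = (M *\<^sub>v v) $ i + c * (M *\<^sub>v w) $ i"
proof -
  have "M *\<^sub>v (v + c \<cdot>\<^sub>v w) = M *\<^sub>v v + c \<cdot>\<^sub>v (M *\<^sub>v w)"
    using assms by (simp add: mult_add_distrib_mat_vec[OF assms(1)] mult_mat_vec[OF assms(1)])
  then show ?thesis
    using assms by simp
qed

lemma minus_vec_as_comb: "(v :: complex vec) - w = v + (- 1) \<cdot>\<^sub>v w"
  by (intro eq_vecI) auto

lemma is_vbundle_triv:
  assumes "is_vbundle atlas X E" "x \<in> X"
  obtains t where "t \<in> trivs E" "x \<in> fst t"
  using assms by (auto simp: is_vbundle_def)

lemma is_vbundle_trivD:
  assumes "is_vbundle atlas X E" "t \<in> trivs E" "x \<in> fst t"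
  shows "snd t x \<in> carrier_mat (rk E) (rk E)" "invertible_mat (snd t x)" "x \<in> X"
  using assms by (auto simp: is_vbundle_def)

lemma is_vbundle_triv_open:
  assumes "is_vbundle atlas X E" "s \<in> trivs E" "open W" "W \<subseteq> X"
  shows "open (fst s \<inter> W)"
proof -
  have "openin (top_of_set X) (fst s)"
    using assms by (auto simp: is_vbundle_def)
  then obtain T where "open T" "fst s = X \<inter> T"
    by (auto simp: openin_open)
  moreover have "X \<inter> T \<inter> W = T \<inter> W"
    using assms(4) by auto
  ultimately show ?thesis
    using assms(3) by auto
qed

lemma hermitian_bundle_local_formula:
  assumes "hermitian_bundle atlas X E" "t \<in> trivs E"
  obtains g where "\<And>i j. i < rk E \<Longrightarrow> j < rk E \<Longrightarrow> smooth_fun atlas (fst t) (g i j)"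
    and "\<And>x v w. x \<in> fst t \<Longrightarrow> v \<in> carrier_vec (rk E) \<Longrightarrow> w \<in> carrier_vec (rk E) \<Longrightarrow>
      metric E x v w =
        (\<Sum>i<rk E. \<Sum>j<rk E. g i j x * (snd t x *\<^sub>v v) $ i * cnj ((snd t x *\<^sub>v w) $ j))"
proof -
  have "\<exists>g. (\<forall>i<rk E. \<forall>j<rk E. smooth_fun atlas (fst t) (g i j)) \<and>
      (\<forall>x\<in>fst t. \<forall>v\<in>carrier_vec (rk E). \<forall>w\<in>carrier_vec (rk E). metric E x v w =
        (\<Sum>i<rk E. \<Sum>j<rk E. g i j x * (snd t x *\<^sub>v v) $ i * cnj ((snd t x *\<^sub>v w) $ j)))"
    using assms by (simp add: hermitian_bundle_def)
  then obtain g where "\<forall>i<rk E. \<forall>j<rk E. smooth_fun atlas (fst t) (g i j)"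
    and "\<forall>x\<in>fst t. \<forall>v\<in>carrier_vec (rk E). \<forall>w\<in>carrier_vec (rk E). metric E x v w =
        (\<Sum>i<rk E. \<Sum>j<rk E. g i j x * (snd t x *\<^sub>v v) $ i * cnj ((snd t x *\<^sub>v w) $ j))"
    by blast
  then show ?thesis
    by (intro that[of g]) auto
qed

lemma hermitian_bundle_metric_at:
  assumes "hermitian_bundle atlas X E" "t \<in> trivs E" "x \<in> fst t"
  obtains g where "\<And>v w. v \<in> carrier_vec (rk E) \<Longrightarrow> w \<in> carrier_vec (rk E) \<Longrightarrow>
      metric E x v w =
        (\<Sum>i<rk E. \<Sum>j<rk E. g i j * (snd t x *\<^sub>v v) $ i * cnj ((snd t x *\<^sub>v w) $ j))"
proof -
  obtain h where h: "\<And>x v w. x \<in> fst t \<Longrightarrow> v \<in> carrier_vec (rk E) \<Longrightarrow> w \<in> carrier_vec (rk E) \<Longrightarrow>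
      metric E x v w =
        (\<Sum>i<rk E. \<Sum>j<rk E. h i j x * (snd t x *\<^sub>v v) $ i * cnj ((snd t x *\<^sub>v w) $ j))"
    by (rule hermitian_bundle_local_formula[OF assms(1,2)]) (rule that; simp)
  show ?thesis
    by (rule that[of "\<lambda>i j. h i j x"]) (rule h[OF assms(3)])
qed

lemma fibre_semi_inner_space:
  assumes E: "hermitian_bundle atlas X E" and x: "x \<in> X"
  shows "semi_inner_space (carrier_vec (rk E)) (\<lambda>v c w. v + c \<cdot>\<^sub>v w) (metric E x)"
proof
  have b: "is_vbundle atlas X E"
    using E by (simp add: hermitian_bundle_def)
  obtain t where t: "t \<in> trivs E" "x \<in> fst t"
    using is_vbundle_triv[OF b x] .
  obtain g where g: "\<And>v w. v \<in> carrier_vec (rk E) \<Longrightarrow> w \<in> carrier_vec (rk E) \<Longrightarrow>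
      metric E x v w =
        (\<Sum>i<rk E. \<Sum>j<rk E. g i j * (snd t x *\<^sub>v v) $ i * cnj ((snd t x *\<^sub>v w) $ j))"
    by (rule hermitian_bundle_metric_at[OF E t]) (rule that; simp)
  fix u v w :: "complex vec" and c
  assume u: "u \<in> carrier_vec (rk E)" and v: "v \<in> carrier_vec (rk E)" and w: "w \<in> carrier_vec (rk E)"
  have "metric E x (u + c \<cdot>\<^sub>v v) w =
      (\<Sum>i<rk E. \<Sum>j<rk E. g i j * ((snd t x *\<^sub>v u) $ i + c * (snd t x *\<^sub>v v) $ i) * cnj ((snd t x *\<^sub>v w) $ j))"
    using u v w by (simp add: g mult_mat_vec_comb_index[OF is_vbundle_trivD(1)[OF b t]])
  also have "\<dots> = metric E x u w + c * metric E x v w"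
    using u v w by (simp add: g algebra_simps sum.distrib sum_distrib_left)
  finally show "metric E x (u + c \<cdot>\<^sub>v v) w = metric E x u w + c * metric E x v w" .
next
  fix u :: "complex vec"
  assume u: "u \<in> carrier_vec (rk E)"
  obtain t where t: "t \<in> trivs E" "x \<in> fst t"
    using is_vbundle_triv[of atlas X E x] E x unfolding hermitian_bundle_def by metis
  obtain g where g: "\<And>v w. v \<in> carrier_vec (rk E) \<Longrightarrow> w \<in> carrier_vec (rk E) \<Longrightarrow>
      metric E x v w =
        (\<Sum>i<rk E. \<Sum>j<rk E. g i j * (snd t x *\<^sub>v v) $ i * cnj ((snd t x *\<^sub>v w) $ j))"
    by (rule hermitian_bundle_metric_at[OF E t]) (rule that; simp)
  have T: "snd t x \<in> carrier_mat (rk E) (rk E)"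
    using E t unfolding hermitian_bundle_def by (blast intro: is_vbundle_trivD(1))
  show "0 \<le> Re (metric E x u u)"
  proof (cases "u = 0\<^sub>v (rk E)")
    case True
    have "snd t x *\<^sub>v u = 0\<^sub>v (rk E)"
      unfolding True by (intro eq_vecI) (use T in auto)
    then show ?thesis
      using u by (simp add: g)
  next
    case False
    with E u x show ?thesis
      unfolding hermitian_bundle_def by (metis less_eq_real_def)
  qed
next
  fix v w :: "complex vec"
  assume "v \<in> carrier_vec (rk E)" "w \<in> carrier_vec (rk E)"
  then show "metric E x w v = cnj (metric E x v w)"
    using E x unfolding hermitian_bundle_def by blast
qed auto

definition fibre_norm :: "('p, 'z) hbundle_scheme \<Rightarrow> 'p \<Rightarrow> complex vec \<Rightarrow> real" where
  "fibre_norm E x v = sqrt (Re (metric E x v v))"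

text \<open>
  On the finite-dimensional fibre the norm of the metric controls the coordinates. In the
  trivialization the metric has a Gram matrix \<open>K\<close>, which is injective by definiteness. The pairings
  of \<open>v\<close> with the frame \<open>e j\<close> are the entries of \<open>K\<close> applied to the coordinates of \<open>v\<close>, so a left
  inverse of \<open>K\<close> recovers the coordinates from pairings that Cauchy--Schwarz bounds.
\<close>

lemma fibre_coordinate_bound:
  assumes E: "hermitian_bundle atlas X E" and t: "t \<in> trivs E" and x: "x \<in> fst t"
  obtains C where "C \<ge> 0"
    and "\<And>v i. v \<in> carrier_vec (rk E) \<Longrightarrow> i < rk E \<Longrightarrow> cmod ((snd t x *\<^sub>v v) $ i) \<le> C * fibre_norm E x v"
proof -
  let ?k = "rk E" and ?T = "snd t x"
  have b: "is_vbundle atlas X E"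
    using E by (simp add: hermitian_bundle_def)
  note T = is_vbundle_trivD[OF b t x]
  interpret semi_inner_space "carrier_vec ?k" "\<lambda>v c w. v + c \<cdot>\<^sub>v w" "metric E x"
    using E T(3) by (rule fibre_semi_inner_space)
  have nm: "nm = fibre_norm E x"
    by (intro ext) (simp add: nm_def fibre_norm_def)
  obtain Ti where Ti: "Ti \<in> carrier_mat ?k ?k" "?T * Ti = 1\<^sub>m ?k"
    using invertible_mat_obtain_inverse[OF T(1,2)] by metis
  have TTi: "?T *\<^sub>v (Ti *\<^sub>v z) = z" if "z \<in> carrier_vec ?k" for z
    using T(1) Ti that by (simp flip: assoc_mult_mat_vec)
  have Ti_closed: "Ti *\<^sub>v z \<in> carrier_vec ?k" if "z \<in> carrier_vec ?k" for z
    using Ti that by auto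
  have T_closed: "?T *\<^sub>v z \<in> carrier_vec ?k" if "z \<in> carrier_vec ?k" for z
    using T(1) that by auto
  obtain g where g: "\<And>v w. v \<in> carrier_vec ?k \<Longrightarrow> w \<in> carrier_vec ?k \<Longrightarrow>
      metric E x v w = (\<Sum>i<?k. \<Sum>j<?k. g i j * (?T *\<^sub>v v) $ i * cnj ((?T *\<^sub>v w) $ j))"
    by (rule hermitian_bundle_metric_at[OF E t x]) (rule that; simp)
  define K where "K = mat ?k ?k (\<lambda>(j, i). g i j)"
  have K: "K \<in> carrier_mat ?k ?k"
    by (simp add: K_def)
  have Kz: "(K *\<^sub>v z) $ j = (\<Sum>i<?k. g i j * z $ i)" if "z \<in> carrier_vec ?k" "j < ?k" for z j
    using that by (simp add: K_def scalar_prod_def atLeast0LessThan)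
  have form: "metric E x v w = (\<Sum>j<?k. (K *\<^sub>v (?T *\<^sub>v v)) $ j * cnj ((?T *\<^sub>v w) $ j))"
    if "v \<in> carrier_vec ?k" "w \<in> carrier_vec ?k" for v w
    unfolding g[OF that] by (subst sum.swap) (simp add: Kz T_closed that sum_distrib_right)
  have "z = 0\<^sub>v ?k" if z: "z \<in> carrier_vec ?k" and "K *\<^sub>v z = 0\<^sub>v ?k" for z
  proof -
    have "metric E x (Ti *\<^sub>v z) (Ti *\<^sub>v z) = 0"
      using that by (simp add: form Ti_closed TTi)
    then have "Ti *\<^sub>v z = 0\<^sub>v ?k"
      using E T(3) Ti_closed[OF z] unfolding hermitian_bundle_def
      by (metis less_irrefl zero_complex.simps(1))
    then have "z = ?T *\<^sub>v 0\<^sub>v ?k"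
      using TTi[OF z] by simp
    also have "\<dots> = 0\<^sub>v ?k"
      by (intro eq_vecI) (use T(1) in auto)
    finally show ?thesis .
  qed
  then obtain L where L: "L \<in> carrier_mat ?k ?k" "L * K = 1\<^sub>m ?k"
    using det_nonzero_obtain_left_inverse[OF K] by metis
  define e where "e j = Ti *\<^sub>v unit_vec ?k j" for j
  have e: "e j \<in> carrier_vec ?k" for j
    by (simp add: e_def Ti_closed)
  have pair: "metric E x v (e j) = (K *\<^sub>v (?T *\<^sub>v v)) $ j" if "v \<in> carrier_vec ?k" "j < ?k" for v j
  proof -
    have "metric E x v (e j) = (\<Sum>i<?k. if i = j then (K *\<^sub>v (?T *\<^sub>v v)) $ i else 0)"
      unfolding form[OF that(1) e] using that(2) by (intro sum.cong) (auto simp: e_def TTi)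
    with that(2) show ?thesis
      by simp
  qed
  have coord: "(?T *\<^sub>v v) $ i = (\<Sum>j<?k. L $$ (i, j) * metric E x v (e j))"
    if v: "v \<in> carrier_vec ?k" and i: "i < ?k" for v :: "complex vec" and i
  proof -
    have "?T *\<^sub>v v = L *\<^sub>v (K *\<^sub>v (?T *\<^sub>v v))"
      using L K T_closed[OF v] by (simp flip: assoc_mult_mat_vec)
    also have "\<dots> $ i = (\<Sum>j<?k. L $$ (i, j) * (K *\<^sub>v (?T *\<^sub>v v)) $ j)"
      using L K i by (simp add: scalar_prod_def atLeast0LessThan)
    finally show ?thesis
      using v by (simp add: pair)
  qed
  define C where "C = (\<Sum>i<?k. \<Sum>j<?k. cmod (L $$ (i, j)) * nm (e j))"
  show ?thesis
  proof (rule that[of C])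
    show "C \<ge> 0"
      by (auto simp: C_def intro!: sum_nonneg mult_nonneg_nonneg nm_nonneg e)
    fix v :: "complex vec" and i assume v: "v \<in> carrier_vec ?k" and i: "i < ?k"
    have "cmod ((?T *\<^sub>v v) $ i) \<le> (\<Sum>j<?k. cmod (L $$ (i, j)) * (nm v * nm (e j)))"
      unfolding coord[OF v i] using v e
      by (intro order_trans[OF norm_sum] sum_mono) (auto simp: norm_mult intro!: mult_left_mono Cauchy_Schwarz)
    also have "\<dots> = (\<Sum>j<?k. cmod (L $$ (i, j)) * nm (e j)) * nm v"
      by (simp add: sum_distrib_right sum_distrib_left mult_ac)
    also have "\<dots> \<le> C * nm v"
      unfolding C_def using i v
      by (intro mult_right_mono member_le_sum[of i "{..<?k}" "\<lambda>i. \<Sum>j<?k. cmod (L $$ (i, j)) * nm (e j)"])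
        (auto intro!: sum_nonneg mult_nonneg_nonneg nm_nonneg e)
    finally show "cmod ((?T *\<^sub>v v) $ i) \<le> C * fibre_norm E x v"
      by (simp add: nm)
  qed
qed

lemma fibre_norm_tendsto_imp_coordinates:
  assumes E: "hermitian_bundle atlas X E" and t: "t \<in> trivs E" "x \<in> fst t"
    and s: "\<And>k. s k \<in> carrier_vec (rk E)" "v \<in> carrier_vec (rk E)"
    and lim: "(\<lambda>k. fibre_norm E x (s k - v)) \<longlonglongrightarrow> 0" and i: "i < rk E"
  shows "(\<lambda>k. (snd t x *\<^sub>v s k) $ i) \<longlonglongrightarrow> (snd t x *\<^sub>v v) $ i"
proof -
  have T: "snd t x \<in> carrier_mat (rk E) (rk E)"
    using E t unfolding hermitian_bundle_def by (blast intro: is_vbundle_trivD(1))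
  obtain C where C: "\<And>v i. v \<in> carrier_vec (rk E) \<Longrightarrow> i < rk E \<Longrightarrow>
      cmod ((snd t x *\<^sub>v v) $ i) \<le> C * fibre_norm E x v"
    using fibre_coordinate_bound[OF E t] by metis
  have "(\<lambda>k. C * fibre_norm E x (s k - v)) \<longlonglongrightarrow> 0"
    using lim by (rule tendsto_mult_right_zero)
  then have "(\<lambda>k. (snd t x *\<^sub>v s k) $ i - (snd t x *\<^sub>v v) $ i) \<longlonglongrightarrow> 0"
  proof (rule Lim_null_comparison[rotated], intro always_eventually allI)
    fix k
    have "(snd t x *\<^sub>v s k) $ i - (snd t x *\<^sub>v v) $ i = (snd t x *\<^sub>v (s k - v)) $ i"
      using mult_mat_vec_comb_index[OF T s i, where c = "- 1"] by (simp add: minus_vec_as_comb)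
    then show "norm ((snd t x *\<^sub>v s k) $ i - (snd t x *\<^sub>v v) $ i) \<le> C * fibre_norm E x (s k - v)"
      using C[of "s k - v" i] s i by auto
  qed
  then show ?thesis
    by (simp add: LIM_zero_iff)
qed

lemma fibre_complete:
  assumes E: "hermitian_bundle atlas X E" and x: "x \<in> X"
    and s: "\<And>k. s k \<in> carrier_vec (rk E)"
    and cauchy: "\<And>e. e > 0 \<Longrightarrow> \<exists>K. \<forall>j\<ge>K. \<forall>k\<ge>K. fibre_norm E x (s j - s k) < e"
  obtains v where "v \<in> carrier_vec (rk E)" "(\<lambda>k. fibre_norm E x (s k - v)) \<longlonglongrightarrow> 0"
proof -
  let ?k = "rk E"
  have b: "is_vbundle atlas X E"
    using E by (simp add: hermitian_bundle_def)
  obtain t where t: "t \<in> trivs E" "x \<in> fst t"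
    using is_vbundle_triv[OF b x] .
  let ?T = "snd t x"
  note T = is_vbundle_trivD[OF b t]
  obtain C where C: "C \<ge> 0" "\<And>v i. v \<in> carrier_vec ?k \<Longrightarrow> i < ?k \<Longrightarrow>
      cmod ((?T *\<^sub>v v) $ i) \<le> C * fibre_norm E x v"
    using fibre_coordinate_bound[OF E t] by metis
  obtain Ti where Ti: "Ti \<in> carrier_mat ?k ?k" "?T * Ti = 1\<^sub>m ?k"
    using invertible_mat_obtain_inverse[OF T(1,2)] by metis
  obtain g where g: "\<And>v w. v \<in> carrier_vec ?k \<Longrightarrow> w \<in> carrier_vec ?k \<Longrightarrow>
      metric E x v w = (\<Sum>i<?k. \<Sum>j<?k. g i j * (?T *\<^sub>v v) $ i * cnj ((?T *\<^sub>v w) $ j))"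
    by (rule hermitian_bundle_metric_at[OF E t]) (rule that; simp)
  have coord_minus: "(?T *\<^sub>v (v - w)) $ i = (?T *\<^sub>v v) $ i - (?T *\<^sub>v w) $ i"
    if "v \<in> carrier_vec ?k" "w \<in> carrier_vec ?k" "i < ?k" for v w i
    using mult_mat_vec_comb_index[OF T(1) that, where c = "- 1"] by (simp add: minus_vec_as_comb)
  have "Cauchy (\<lambda>k. (?T *\<^sub>v s k) $ i)" if i: "i < ?k" for i
  proof (rule CauchyI)
    fix e :: real assume "e > 0"
    then have "e / (C + 1) > 0"
      using C(1) by simp
    then obtain K where K: "\<And>j k. j \<ge> K \<Longrightarrow> k \<ge> K \<Longrightarrow> fibre_norm E x (s j - s k) < e / (C + 1)"
      using cauchy by metis
    have "norm ((?T *\<^sub>v s j) $ i - (?T *\<^sub>v s k) $ i) < e" if "j \<ge> K" "k \<ge> K" for j k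
    proof -
      have "norm ((?T *\<^sub>v s j) $ i - (?T *\<^sub>v s k) $ i) \<le> C * fibre_norm E x (s j - s k)"
        using C(2)[of "s j - s k" i] s i by (simp add: coord_minus)
      also have "\<dots> \<le> C * (e / (C + 1))"
        using K[OF that] C(1) by (intro mult_left_mono) auto
      also have "\<dots> < e"
        using C(1) \<open>e > 0\<close> by (simp add: field_simps)
      finally show ?thesis .
    qed
    then show "\<exists>M. \<forall>m\<ge>M. \<forall>n\<ge>M. norm ((?T *\<^sub>v s m) $ i - (?T *\<^sub>v s n) $ i) < e"
      by blast
  qed
  then have "\<exists>z. (\<lambda>k. (?T *\<^sub>v s k) $ i) \<longlonglongrightarrow> z" if "i < ?k" for i
    using that Cauchy_convergent convergent_def by blast
  then obtain z where z: "\<And>i. i < ?k \<Longrightarrow> (\<lambda>k. (?T *\<^sub>v s k) $ i) \<longlonglongrightarrow> z i"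
    by metis
  define v where "v = Ti *\<^sub>v vec ?k z"
  have v: "v \<in> carrier_vec ?k"
    using Ti by (auto simp: v_def)
  have Tv: "?T *\<^sub>v v = vec ?k z"
    using T(1) Ti by (simp add: v_def flip: assoc_mult_mat_vec)
  have coord0: "(\<lambda>k. (?T *\<^sub>v (s k - v)) $ i) \<longlonglongrightarrow> 0" if i: "i < ?k" for i
    using z[OF i] s v i by (simp add: coord_minus Tv LIM_zero_iff)
  have "(\<lambda>k. metric E x (s k - v) (s k - v)) \<longlonglongrightarrow> (\<Sum>i<?k. \<Sum>j<?k. g i j * 0 * cnj 0)"
    using s v by (simp only: g minus_carrier_vec) (intro tendsto_intros coord0; simp)
  then have "(\<lambda>k. sqrt (Re (metric E x (s k - v) (s k - v)))) \<longlonglongrightarrow> sqrt (Re 0)"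
    by (intro tendsto_real_sqrt tendsto_Re) simp
  with v show ?thesis
    by (intro that[of v]) (auto simp: fibre_norm_def)
qed

section \<open>Smooth functions are continuous\<close>

lemma C_infinity_on_imp_continuous_on: "C_infinity_on V g \<Longrightarrow> continuous_on V g"
  unfolding C_infinity_on_def by (metis differentiable_imp_continuous_on partial_derivs.simps(1))

lemma smooth_on_imp_continuous_on:
  assumes "smooth_on S f"
  shows "continuous_on S f"
  unfolding continuous_on_eq_continuous_within
proof
  fix y assume y: "y \<in> S"
  then obtain V g where V: "y \<in> V" "C_infinity_on V g" "\<And>z. z \<in> S \<inter> V \<Longrightarrow> g z = f z"
    using assms unfolding smooth_on_def by metis
  have "open V"
    using V(2) by (simp add: C_infinity_on_def)
  have "continuous (at y) g"
    using C_infinity_on_imp_continuous_on[OF V(2)] V(1) \<open>open V\<close> continuous_on_eq_continuous_at by blast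
  then have "(g \<longlongrightarrow> f y) (at y within S)"
    using continuous_at_imp_continuous_within[of y g S] V(3)[of y] V(1) y by (simp add: continuous_within)
  moreover have "\<forall>\<^sub>F z in at y within S. g z = f z"
    unfolding eventually_at_topological using V(1,3) \<open>open V\<close> by (intro exI[of _ V]) auto
  ultimately show "continuous (at y within S) f"
    unfolding continuous_within by (rule Lim_transform_eventually)
qed

lemma chart_inv_eq: "is_chart c \<Longrightarrow> q \<in> fst c \<Longrightarrow> chart_inv c (snd c q) = q"
  by (simp add: is_chart_def homeomorphism_def)

lemma is_chart_continuous_on: "is_chart c \<Longrightarrow> continuous_on (fst c) (snd c)"
  by (simp add: is_chart_def homeomorphism_def)

lemma is_chart_open_image:
  assumes "is_chart c" "open U" "U \<subseteq> fst c"
  shows "open (snd c ` U)"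
proof -
  have "homeomorphism (fst c) (snd c ` fst c) (snd c) (chart_inv c)" "open (snd c ` fst c)"
    using assms(1) by (auto simp: is_chart_def)
  moreover have "openin (top_of_set (fst c)) U"
    using assms(2,3) by (rule open_subset[rotated])
  ultimately show ?thesis
    using homeomorphism_imp_open_map openin_open_trans by blast
qed

lemma continuous_on_locally:
  fixes f :: "'a::t2_space \<Rightarrow> 'b::topological_space"
  assumes "\<And>x. x \<in> S \<Longrightarrow> \<exists>U. open U \<and> x \<in> U \<and> continuous_on (S \<inter> U) f"
  shows "continuous_on S f"
  unfolding continuous_on_eq_continuous_within
proof
  fix x assume x: "x \<in> S"
  obtain U where U: "open U" "x \<in> U" "continuous_on (S \<inter> U) f"
    using assms[OF x] by auto
  have "at x within S = at x within S \<inter> U"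
    using U by (intro at_within_nhd[of x U]) auto
  with U x show "continuous (at x within S) f"
    by (simp add: continuous_on_eq_continuous_within)
qed

lemma smooth_fun_imp_continuous_on:
  fixes S :: "'p::t2_space set"
  assumes charts: "\<And>c. c \<in> atlas \<Longrightarrow> is_chart c" and S: "S \<subseteq> carrier_of atlas"
    and f: "smooth_fun atlas S f"
  shows "continuous_on S f"
proof (rule continuous_on_locally)
  fix x assume x: "x \<in> S"
  then obtain c where c: "c \<in> atlas" "x \<in> fst c"
    using S by (auto simp: carrier_of_def)
  have "continuous_on (snd c ` (fst c \<inter> S)) (f \<circ> chart_inv c)"
    by (rule smooth_on_imp_continuous_on) (use f c(1) in \<open>simp add: smooth_fun_def\<close>)
  then have "continuous_on (fst c \<inter> S) (f \<circ> chart_inv c \<circ> snd c)"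
    using continuous_on_subset[OF is_chart_continuous_on[OF charts[OF c(1)]], of "fst c \<inter> S"]
    by (rule continuous_on_compose[rotated]) auto
  then have "continuous_on (fst c \<inter> S) f"
    by (rule continuous_on_eq) (use chart_inv_eq[OF charts[OF c(1)]] in auto)
  moreover have "open (fst c)"
    using charts[OF c(1)] by (simp add: is_chart_def)
  ultimately show "\<exists>U. open U \<and> x \<in> U \<and> continuous_on (S \<inter> U) f"
    using c(2) by (auto simp: Int_commute)
qed

section \<open>Square integrable sections form a complete space\<close>

definition sec_comb :: "'p bsection \<Rightarrow> complex \<Rightarrow> 'p bsection \<Rightarrow> 'p bsection" where
  "sec_comb u c v = (\<lambda>x. u x + c \<cdot>\<^sub>v v x)"

lemma section_diff_eq_sec_comb: "section_diff u v = sec_comb u (- 1) v"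
  by (auto simp: section_diff_def sec_comb_def minus_vec_as_comb)

lemma in_triv_comb_index:
  assumes "is_vbundle atlas X E" "t \<in> trivs E" "x \<in> fst t"
    and "u x \<in> carrier_vec (rk E)" "v x \<in> carrier_vec (rk E)" "i < rk E"
  shows "in_triv t (sec_comb u c v) x $ i = in_triv t u x $ i + c * in_triv t v x $ i"
  unfolding in_triv_def sec_comb_def
  using mult_mat_vec_comb_index is_vbundle_trivD(1)[OF assms(1-3)] assms by blast

lemma (in semi_inner_space) summable_dst_imp_Cauchy:
  assumes s: "\<And>k. s k \<in> V" and sum: "summable (\<lambda>k. dst (s k) (s (Suc k)))" and "e > 0"
  shows "\<exists>K. \<forall>j\<ge>K. \<forall>k\<ge>K. dst (s j) (s k) < e"
proof -
  have le: "dst (s m) (s (m + d)) \<le> (\<Sum>k=m..<m + d. dst (s k) (s (Suc k)))" for m d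
  proof (induction d)
    case (Suc d)
    have "dst (s m) (s (m + Suc d)) \<le> dst (s m) (s (m + d)) + dst (s (m + d)) (s (Suc (m + d)))"
      using s by (simp add: dst_triangle)
    with Suc show ?case
      by simp
  qed (simp add: dst_self s)
  obtain K where K: "\<And>m n. m \<ge> K \<Longrightarrow> norm (\<Sum>k=m..<n. dst (s k) (s (Suc k))) < e"
    using sum \<open>e > 0\<close> unfolding summable_Cauchy by metis
  have *: "dst (s j) (s k) < e" if "K \<le> j" "j \<le> k" for j k
    using le[of j "k - j"] K[of j k] that by simp
  show ?thesis
  proof (intro exI[of _ K] allI impI)
    fix j k assume "j \<ge> K" "k \<ge> K"
    then show "dst (s j) (s k) < e"
      using *[of j k] *[of k j] dst_commute[OF s s, of j k] by (cases "j \<le> k") auto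
  qed
qed

locale hermitian_domain =
  fixes atlas :: "('p::{t2_space,second_countable_topology}, 'n::finite) chart set"
    and X D :: "'p set" and dx :: "'p measure" and E :: "('p, 'z) hbundle_scheme"
  assumes charts: "\<And>c. c \<in> atlas \<Longrightarrow> is_chart c"
    and X_covered: "X \<subseteq> carrier_of atlas"
    and herm: "hermitian_bundle atlas X E"
    and D_open: "open D" and D_sub: "D \<subseteq> X"
    and sets_dx: "sets dx = sets borel"
begin

abbreviation M :: "'p measure" where "M \<equiv> restrict_space dx D"
abbreviation L2 :: "'p bsection set" where "L2 \<equiv> L2_sections dx D E"

lemma vbundle: "is_vbundle atlas X E"
  using herm by (simp add: hermitian_bundle_def)

lemma D_X: "x \<in> D \<Longrightarrow> x \<in> X"
  using D_sub by auto

lemma D_meas: "D \<in> sets dx"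
  using D_open by (simp add: sets_dx)

lemma space_dx: "space dx = UNIV"
  using sets_eq_imp_space_eq[OF sets_dx] by simp

lemma space_M: "space M = D"
  by (simp add: space_restrict_space space_dx)

lemma triv_open: "t \<in> trivs E \<Longrightarrow> open (D \<inter> fst t)"
  using is_vbundle_triv_open[OF vbundle _ D_open D_sub] by (simp add: Int_commute)

lemma triv_mat:
  "t \<in> trivs E \<Longrightarrow> x \<in> fst t \<Longrightarrow> snd t x \<in> carrier_mat (rk E) (rk E)"
  using is_vbundle_trivD[OF vbundle] by blast

lemma sets_restrict_M: "S \<subseteq> D \<Longrightarrow> sets (restrict_space M S) = sets (restrict_space borel S)"
  unfolding sets_restrict_space by (auto simp: sets_dx image_image Int_absorb1 Int_assoc[symmetric])

text \<open>By the Lindelof property countably many trivializations cover \<open>D\<close>.\<close>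

lemma measurable_from_trivs:
  fixes f :: "'p \<Rightarrow> 'b::topological_space"
  assumes "\<And>t. t \<in> trivs E \<Longrightarrow> f \<in> borel_measurable (restrict_space borel (D \<inter> fst t))"
  shows "f \<in> borel_measurable M"
proof -
  let ?C = "(\<lambda>t. D \<inter> fst t) ` trivs E"
  obtain C where C: "C \<subseteq> ?C" "countable C" "\<Union>C = \<Union>?C"
    using Lindelof[of ?C] triv_open by blast
  show ?thesis
  proof (rule measurable_piecewise_restrict[OF C(2)])
    have "\<Union>?C = D"
      using D_sub vbundle by (auto simp: is_vbundle_def)
    then show "space M \<subseteq> \<Union>C"
      by (simp add: C(3) space_M)
    fix S assume "S \<in> C"
    then obtain t where t: "t \<in> trivs E" "S = D \<inter> fst t"
      using C(1) by auto
    then have "S \<in> sets dx"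
      using triv_open by (simp add: sets_dx)
    then show "S \<inter> space M \<in> sets M"
      using D_meas t by (auto simp: sets_restrict_space_iff space_M space_dx)
    show "f \<in> borel_measurable (restrict_space M S)"
      using assms[OF t(1)] measurable_cong_sets[OF sets_restrict_M refl, of S] t(2) by auto
  qed
qed

text \<open>
  Measurability of a section refers to its coordinates in the trivializations, since the
  identification of the fibres with a model space depends on the base point in an arbitrary way.
\<close>

definition measurable_section :: "'p bsection \<Rightarrow> bool" where
  "measurable_section u \<longleftrightarrow> (\<forall>x\<in>D. u x \<in> carrier_vec (rk E)) \<and>
     (\<forall>t\<in>trivs E. \<forall>i<rk E.
        (\<lambda>x. in_triv t u x $ i) \<in> borel_measurable (restrict_space borel (D \<inter> fst t)))"

lemma measurable_sectionD:
  assumes "measurable_section u"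
  shows "x \<in> D \<Longrightarrow> u x \<in> carrier_vec (rk E)"
    and "t \<in> trivs E \<Longrightarrow> i < rk E \<Longrightarrow>
      (\<lambda>x. in_triv t u x $ i) \<in> borel_measurable (restrict_space borel (D \<inter> fst t))"
  using assms by (auto simp: measurable_section_def)

lemma metric_coefficient_measurable:
  assumes "t \<in> trivs E" "smooth_fun atlas (fst t) a"
  shows "a \<in> borel_measurable (restrict_space borel (D \<inter> fst t))"
proof -
  have "fst t \<subseteq> X"
    using assms(1) vbundle by (auto simp: is_vbundle_def)
  then have "continuous_on (fst t) a"
    using assms X_covered by (intro smooth_fun_imp_continuous_on[OF charts]) auto
  then have "continuous_on (D \<inter> fst t) a"
    by (rule continuous_on_subset) auto
  then show ?thesis
    by (rule borel_measurable_continuous_on_restrict)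
qed

lemma metric_measurable:
  assumes u: "measurable_section u" and v: "measurable_section v"
  shows "(\<lambda>x. metric E x (u x) (v x)) \<in> borel_measurable M"
proof (rule measurable_from_trivs)
  fix t assume t: "t \<in> trivs E"
  obtain g where g: "\<And>i j. i < rk E \<Longrightarrow> j < rk E \<Longrightarrow> smooth_fun atlas (fst t) (g i j)"
    and metric: "\<And>x v w. x \<in> fst t \<Longrightarrow> v \<in> carrier_vec (rk E) \<Longrightarrow> w \<in> carrier_vec (rk E) \<Longrightarrow>
      metric E x v w =
        (\<Sum>i<rk E. \<Sum>j<rk E. g i j x * (snd t x *\<^sub>v v) $ i * cnj ((snd t x *\<^sub>v w) $ j))"
    by (rule hermitian_bundle_local_formula[OF herm t]) (rule that; simp)
  let ?N = "restrict_space borel (D \<inter> fst t)"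
  have "(\<lambda>x. \<Sum>i<rk E. \<Sum>j<rk E. g i j x * in_triv t u x $ i * cnj (in_triv t v x $ j))
      \<in> borel_measurable ?N"
  proof (intro borel_measurable_sum borel_measurable_times)
    fix i j assume "i \<in> {..<rk E}" "j \<in> {..<rk E}"
    then show "g i j \<in> borel_measurable ?N" "(\<lambda>x. in_triv t u x $ i) \<in> borel_measurable ?N"
      and "(\<lambda>x. cnj (in_triv t v x $ j)) \<in> borel_measurable ?N"
      using g metric_coefficient_measurable[OF t] measurable_sectionD(2)[OF u t]
        measurable_compose[OF measurable_sectionD(2)[OF v t] borel_measurable_continuous_onI[OF continuous_on_cnj[OF continuous_on_id]]]
      by auto
  qed
  then show "(\<lambda>x. metric E x (u x) (v x)) \<in> borel_measurable ?N"
    by (rule measurable_cong[THEN iffD1, rotated])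
      (auto simp: space_restrict_space metric in_triv_def measurable_sectionD(1)[OF u] measurable_sectionD(1)[OF v])
qed

lemma fibre: "x \<in> D \<Longrightarrow> semi_inner_space (carrier_vec (rk E)) (\<lambda>v c w. v + c \<cdot>\<^sub>v w) (metric E x)"
  using fibre_semi_inner_space[OF herm] D_X by blast

lemma fibre_norm_eq_nm: "x \<in> D \<Longrightarrow> semi_inner_space.nm (metric E x) = fibre_norm E x"
  by (intro ext) (simp add: semi_inner_space.nm_def[OF fibre] fibre_norm_def)

lemma fibre_norm_eq_dst:
  "x \<in> D \<Longrightarrow> semi_inner_space.dst (\<lambda>v c w. v + c \<cdot>\<^sub>v w) (metric E x) v w = fibre_norm E x (v - w)"
  by (simp add: semi_inner_space.dst_def[OF fibre] fibre_norm_eq_nm minus_vec_as_comb)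

lemma fibre_norm_power2:
  "x \<in> D \<Longrightarrow> v \<in> carrier_vec (rk E) \<Longrightarrow> (fibre_norm E x v)\<^sup>2 = Re (metric E x v v)"
  using semi_inner_space.nm_power2[OF fibre] by (simp add: fibre_norm_eq_nm)

lemma fibre_norm_nonneg: "x \<in> D \<Longrightarrow> v \<in> carrier_vec (rk E) \<Longrightarrow> 0 \<le> fibre_norm E x v"
  using semi_inner_space.nm_nonneg[OF fibre] by (simp add: fibre_norm_eq_nm)

lemma fibre_norm_comb_power2_le:
  assumes "x \<in> D" "v \<in> carrier_vec (rk E)" "w \<in> carrier_vec (rk E)"
  shows "(fibre_norm E x (v + c \<cdot>\<^sub>v w))\<^sup>2 \<le> 2 * (fibre_norm E x v)\<^sup>2 + 2 * (cmod c)\<^sup>2 * (fibre_norm E x w)\<^sup>2"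
proof -
  let ?a = "fibre_norm E x v" and ?b = "cmod c * fibre_norm E x w"
  have "fibre_norm E x (v + c \<cdot>\<^sub>v w) \<le> ?a + ?b"
    using semi_inner_space.nm_comb_le[OF fibre[OF assms(1)] assms(2,3)] by (simp add: fibre_norm_eq_nm assms(1))
  then have "(fibre_norm E x (v + c \<cdot>\<^sub>v w))\<^sup>2 \<le> (?a + ?b)\<^sup>2"
    using assms by (intro power_mono fibre_norm_nonneg) auto
  also have "\<dots> \<le> 2 * ?a\<^sup>2 + 2 * ?b\<^sup>2"
    using sum_squares_bound[of ?a ?b] by (simp add: power2_sum)
  finally show ?thesis
    by (simp add: power_mult_distrib)
qed

lemma metric_le_squares:
  assumes "x \<in> D" "v \<in> carrier_vec (rk E)" "w \<in> carrier_vec (rk E)"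
  shows "cmod (metric E x v w) \<le> (fibre_norm E x v)\<^sup>2 + (fibre_norm E x w)\<^sup>2"
proof -
  let ?a = "fibre_norm E x v" and ?b = "fibre_norm E x w"
  have "cmod (metric E x v w) \<le> ?a * ?b"
    using semi_inner_space.Cauchy_Schwarz[OF fibre[OF assms(1)] assms(2,3)] by (simp add: fibre_norm_eq_nm assms(1))
  also have "\<dots> \<le> ?a\<^sup>2 + ?b\<^sup>2"
  proof -
    have "0 \<le> ?a * ?b"
      using assms by (simp add: fibre_norm_nonneg)
    then show ?thesis
      using sum_squares_bound[of ?a ?b] by linarith
  qed
  finally show ?thesis .
qed

lemma fibre_norm_measurable:
  "measurable_section u \<Longrightarrow> (\<lambda>x. fibre_norm E x (u x)) \<in> borel_measurable M"
  unfolding fibre_norm_def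
  using measurable_compose[OF measurable_compose[OF metric_measurable borel_measurable_continuous_onI[OF continuous_on_Re[OF continuous_on_id]]] borel_measurable_continuous_onI[OF continuous_on_real_sqrt[OF continuous_on_id]]]
  by auto

lemma integrable_M_iff:
  fixes f :: "'p \<Rightarrow> 'b::{banach,second_countable_topology}"
  shows "set_integrable dx D f \<longleftrightarrow> integrable M f"
  unfolding set_integrable_def using integrable_restrict_space[of D dx f] D_meas by (simp add: space_dx)

lemma L2_iff:
  "u \<in> L2 \<longleftrightarrow> measurable_section u \<and> integrable M (\<lambda>x. (fibre_norm E x (u x))\<^sup>2)"
proof -
  have "integrable M (\<lambda>x. Re (metric E x (u x) (u x))) \<longleftrightarrow> integrable M (\<lambda>x. (fibre_norm E x (u x))\<^sup>2)"
    if "measurable_section u"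
    using that by (intro Bochner_Integration.integrable_cong) (auto simp: space_M fibre_norm_power2 measurable_sectionD)
  then show ?thesis
    by (auto simp: L2_sections_def measurable_section_def integrable_M_iff)
qed

lemma L2D:
  assumes "u \<in> L2"
  shows "measurable_section u" "x \<in> D \<Longrightarrow> u x \<in> carrier_vec (rk E)"
    "integrable M (\<lambda>x. (fibre_norm E x (u x))\<^sup>2)"
  using assms by (auto simp: L2_iff measurable_section_def)

lemma L2_inner_eq: "L2_inner dx D E u v = (LINT x|M. metric E x (u x) (v x))"
  unfolding L2_inner_def set_lebesgue_integral_def
  using integral_restrict_space[of D dx "\<lambda>x. metric E x (u x) (v x)"] D_meas by (simp add: space_dx)

lemma integrable_metric:
  assumes "u \<in> L2" "v \<in> L2"
  shows "integrable M (\<lambda>x. metric E x (u x) (v x))"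
proof (rule Bochner_Integration.integrable_bound)
  show "integrable M (\<lambda>x. (fibre_norm E x (u x))\<^sup>2 + (fibre_norm E x (v x))\<^sup>2)"
    using assms by (simp add: L2D)
  show "(\<lambda>x. metric E x (u x) (v x)) \<in> borel_measurable M"
    using assms by (simp add: L2D metric_measurable)
  show "AE x in M. norm (metric E x (u x) (v x)) \<le> norm ((fibre_norm E x (u x))\<^sup>2 + (fibre_norm E x (v x))\<^sup>2)"
    using assms metric_le_squares by (intro AE_I2) (auto simp: L2D space_M)
qed

lemma measurable_section_comb:
  assumes u: "measurable_section u" and v: "measurable_section v"
  shows "measurable_section (sec_comb u c v)"
  unfolding measurable_section_def
proof (intro conjI ballI allI impI)
  fix x assume "x \<in> D"
  then show "sec_comb u c v x \<in> carrier_vec (rk E)"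
    using u v by (simp add: sec_comb_def measurable_sectionD)
next
  fix t i assume t: "t \<in> trivs E" and i: "i < rk E"
  have "(\<lambda>x. in_triv t u x $ i + c * in_triv t v x $ i) \<in> borel_measurable (restrict_space borel (D \<inter> fst t))"
    using measurable_sectionD(2)[OF u t i] measurable_sectionD(2)[OF v t i] by auto
  then show "(\<lambda>x. in_triv t (sec_comb u c v) x $ i) \<in> borel_measurable (restrict_space borel (D \<inter> fst t))"
    by (rule measurable_cong[THEN iffD1, rotated])
      (use t i u v in \<open>auto simp: space_restrict_space in_triv_comb_index[OF vbundle] measurable_sectionD\<close>)
qed

lemma L2_comb:
  assumes "u \<in> L2" "v \<in> L2"
  shows "sec_comb u c v \<in> L2"
  unfolding L2_iff
proof
  show m: "measurable_section (sec_comb u c v)"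
    using assms by (simp add: L2D measurable_section_comb)
  show "integrable M (\<lambda>x. (fibre_norm E x (sec_comb u c v x))\<^sup>2)"
  proof (rule Bochner_Integration.integrable_bound)
    show "integrable M (\<lambda>x. 2 * (fibre_norm E x (u x))\<^sup>2 + 2 * (cmod c)\<^sup>2 * (fibre_norm E x (v x))\<^sup>2)"
      using assms by (simp add: L2D)
    show "(\<lambda>x. (fibre_norm E x (sec_comb u c v x))\<^sup>2) \<in> borel_measurable M"
      using fibre_norm_measurable[OF m] by simp
    show "AE x in M. norm ((fibre_norm E x (sec_comb u c v x))\<^sup>2) \<le>
        norm (2 * (fibre_norm E x (u x))\<^sup>2 + 2 * (cmod c)\<^sup>2 * (fibre_norm E x (v x))\<^sup>2)"
      using assms fibre_norm_comb_power2_le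
      by (intro AE_I2) (auto simp: L2D space_M sec_comb_def)
  qed
qed

lemma L2_semi_inner_space: "semi_inner_space L2 sec_comb (L2_inner dx D E)"
proof
  fix u v w :: "'p bsection" and c
  assume uvw: "u \<in> L2" "v \<in> L2" "w \<in> L2"
  have "(LINT x|M. metric E x (sec_comb u c v x) (w x)) =
      (LINT x|M. metric E x (u x) (w x) + c * metric E x (v x) (w x))"
    using uvw semi_inner_space.ip_comb_left[OF fibre]
    by (intro Bochner_Integration.integral_cong) (auto simp: space_M sec_comb_def L2D)
  also have "\<dots> = (LINT x|M. metric E x (u x) (w x)) + c * (LINT x|M. metric E x (v x) (w x))"
    using uvw by (simp add: integrable_metric)
  finally show "L2_inner dx D E (sec_comb u c v) w = L2_inner dx D E u w + c * L2_inner dx D E v w"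
    by (simp add: L2_inner_eq)
next
  fix u v :: "'p bsection"
  assume uv: "u \<in> L2" "v \<in> L2"
  have "(LINT x|M. metric E x (v x) (u x)) = (LINT x|M. cnj (metric E x (u x) (v x)))"
    using uv by (intro Bochner_Integration.integral_cong refl semi_inner_space.ip_commute[OF fibre])
      (auto simp: space_M L2D)
  then show "L2_inner dx D E v u = cnj (L2_inner dx D E u v)"
    by (simp add: L2_inner_eq)
next
  fix u :: "'p bsection"
  assume u: "u \<in> L2"
  have "Re (LINT x|M. metric E x (u x) (u x)) = (LINT x|M. Re (metric E x (u x) (u x)))"
    using integral_Re[OF integrable_metric[OF u u]] by simp
  also have "\<dots> \<ge> 0"
    using u semi_inner_space.ip_nonneg[OF fibre] by (intro integral_nonneg_AE AE_I2) (auto simp: space_M L2D)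
  finally show "0 \<le> Re (L2_inner dx D E u u)"
    by (simp add: L2_inner_eq)
qed (rule L2_comb)

sublocale L2: semi_inner_space L2 sec_comb "L2_inner dx D E"
  by (rule L2_semi_inner_space)

lemma L2_cong:
  assumes "u \<in> L2" "\<And>x. x \<in> D \<Longrightarrow> u x = v x"
  shows "v \<in> L2"
  unfolding L2_iff measurable_section_def
proof (intro conjI ballI allI impI)
  fix x assume "x \<in> D"
  then show "v x \<in> carrier_vec (rk E)"
    using assms L2D(2) by metis
next
  fix t i assume "t \<in> trivs E" "i < rk E"
  then have "(\<lambda>x. in_triv t u x $ i) \<in> borel_measurable (restrict_space borel (D \<inter> fst t))"
    using L2D(1)[OF assms(1)] measurable_sectionD(2) by blast
  then show "(\<lambda>x. in_triv t v x $ i) \<in> borel_measurable (restrict_space borel (D \<inter> fst t))"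
    by (rule measurable_cong[THEN iffD1, rotated]) (use assms(2) in \<open>auto simp: space_restrict_space in_triv_def\<close>)
next
  show "integrable M (\<lambda>x. (fibre_norm E x (v x))\<^sup>2)"
    using L2D(3)[OF assms(1)]
    by (rule Bochner_Integration.integrable_cong[THEN iffD1, rotated 2]) (use assms(2) in \<open>auto simp: space_M\<close>)
qed

text \<open>The squared norm with values in \<open>[0, \<infinity>]\<close>, so that Fatou's lemma applies before integrability
  of the limit is known.\<close>

definition energy :: "'p bsection \<Rightarrow> ennreal" where
  "energy u = (\<integral>\<^sup>+x. ennreal ((fibre_norm E x (u x))\<^sup>2) \<partial>M)"

lemma L2_iff_energy: "u \<in> L2 \<longleftrightarrow> measurable_section u \<and> energy u < \<infinity>"
  unfolding L2_iff energy_def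
  using fibre_norm_measurable by (auto simp: integrable_iff_bounded)

lemma energy_eq: "u \<in> L2 \<Longrightarrow> energy u = ennreal ((L2.nm u)\<^sup>2)"
proof -
  assume u: "u \<in> L2"
  have "energy u = ennreal (LINT x|M. (fibre_norm E x (u x))\<^sup>2)"
    unfolding energy_def using L2D(3)[OF u] by (intro nn_integral_eq_integral) auto
  also have "(LINT x|M. (fibre_norm E x (u x))\<^sup>2) = (LINT x|M. Re (metric E x (u x) (u x)))"
    using u by (intro Bochner_Integration.integral_cong) (auto simp: space_M fibre_norm_power2 L2D)
  also have "\<dots> = Re (L2_inner dx D E u u)"
    using integral_Re[OF integrable_metric[OF u u]] by (simp add: L2_inner_eq)
  finally show ?thesis
    using L2.nm_power2[OF u] by simp
qed


text \<open>
  Riesz--Fischer. Along indices \<open>r k\<close> whose successive \<open>L2\<close> distances are at most \<open>4\<^sup>-\<^sup>k\<close>, the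
  series of the squared pointwise distances, weighted by \<open>4\<^sup>k\<close>, has finite integral. Hence it
  converges at almost every point, so that the pointwise distances decay like \<open>2\<^sup>-\<^sup>k\<close> there and
  completeness of the fibre gives a pointwise limit. Fatou's lemma turns it into a limit in \<open>L2\<close>.
\<close>

lemma L2_complete:
  assumes \<sigma>: "\<And>k. \<sigma> k \<in> L2"
    and cauchy: "\<And>e. e > 0 \<Longrightarrow> \<exists>K. \<forall>j\<ge>K. \<forall>k\<ge>K. L2.dst (\<sigma> j) (\<sigma> k) < e"
  obtains w where "w \<in> L2" "(\<lambda>k. L2.dst (\<sigma> k) w) \<longlonglongrightarrow> 0"
proof -
  have "\<forall>k. \<exists>K. \<forall>i\<ge>K. \<forall>j\<ge>K. L2.dst (\<sigma> i) (\<sigma> j) < (1/4) ^ k"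
    by (intro allI cauchy) simp
  then obtain K where K: "\<And>k i j. i \<ge> K k \<Longrightarrow> j \<ge> K k \<Longrightarrow> L2.dst (\<sigma> i) (\<sigma> j) < (1/4) ^ k"
    by metis
  \<comment> \<open>the partial sums of \<open>K\<close> increase and stay above \<open>K\<close>\<close>
  define r where "r k = (\<Sum>i\<le>k. K i)" for k
  have r_ge: "K k \<le> r l" if "k \<le> l" for k l
    unfolding r_def using that by (intro member_le_sum) auto
  define s where "s k = \<sigma> (r k)" for k
  have s: "s k \<in> L2" for k
    by (simp add: s_def \<sigma>)
  have s_step: "L2.dst (s k) (s (Suc k)) < (1/4) ^ k" for k
    unfolding s_def by (intro K r_ge) auto
  define n where "n k x = fibre_norm E x (s k x - s (Suc k) x)" for k x
  have n_eq: "(\<integral>\<^sup>+x. ennreal ((n k x)\<^sup>2) \<partial>M) = ennreal ((L2.dst (s k) (s (Suc k)))\<^sup>2)" for k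
    using energy_eq[OF L2_comb[OF s s], of k "- 1" "Suc k"]
    by (simp add: energy_def n_def sec_comb_def minus_vec_as_comb L2.dst_def)
  have n_meas: "(\<lambda>x. ennreal (4 ^ k * (n k x)\<^sup>2)) \<in> borel_measurable M" for k
    using fibre_norm_measurable[OF L2D(1)[OF L2_comb[OF s s]], of k "- 1" "Suc k"]
    by (simp add: n_def sec_comb_def minus_vec_as_comb)
  define H where "H x = (\<Sum>k. ennreal (4 ^ k * (n k x)\<^sup>2))" for x
  have H_meas: "H \<in> borel_measurable M"
    unfolding H_def using n_meas by measurable
  have "(\<integral>\<^sup>+x. H x \<partial>M) = (\<Sum>k. \<integral>\<^sup>+x. ennreal (4 ^ k * (n k x)\<^sup>2) \<partial>M)"
    unfolding H_def using n_meas by (rule nn_integral_suminf)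
  also have "\<dots> \<le> (\<Sum>k. ennreal ((1/4) ^ k))"
  proof (intro suminf_le summableI)
    fix k
    have "(\<integral>\<^sup>+x. ennreal (4 ^ k * (n k x)\<^sup>2) \<partial>M) = (\<integral>\<^sup>+x. ennreal (4 ^ k) * ennreal ((n k x)\<^sup>2) \<partial>M)"
      by (simp add: ennreal_mult)
    also have "\<dots> = ennreal (4 ^ k) * (\<integral>\<^sup>+x. ennreal ((n k x)\<^sup>2) \<partial>M)"
      using fibre_norm_measurable[OF L2D(1)[OF L2_comb[OF s s]], of k "- 1" "Suc k"]
      by (intro nn_integral_cmult) (simp add: n_def sec_comb_def minus_vec_as_comb)
    also have "\<dots> = ennreal (4 ^ k * (L2.dst (s k) (s (Suc k)))\<^sup>2)"
      by (simp add: n_eq ennreal_mult)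
    also have "\<dots> \<le> ennreal (4 ^ k * ((1/4) ^ k)\<^sup>2)"
      using s_step[of k] L2.dst_nonneg[OF s s] by (intro ennreal_leI mult_left_mono power_mono) auto
    also have "4 ^ k * ((1/4) ^ k)\<^sup>2 = (1/4 :: real) ^ k"
      by (simp add: power2_eq_square field_simps flip: power_mult_distrib)
    finally show "(\<integral>\<^sup>+x. ennreal (4 ^ k * (n k x)\<^sup>2) \<partial>M) \<le> ennreal ((1/4) ^ k)" .
  qed
  also have "\<dots> < \<infinity>"
    by (subst suminf_ennreal2) (auto intro!: summable_geometric)
  finally have "(\<integral>\<^sup>+x. H x \<partial>M) \<noteq> \<infinity>"
    by simp
  then have ae: "AE x in M. H x \<noteq> \<infinity>"
    using H_meas nn_integral_PInf_AE by blast
  define G where "G = {x \<in> space M. H x \<noteq> \<infinity>}"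
  have G_D: "G \<subseteq> D"
    by (auto simp: G_def space_M)
  have "G \<in> sets M"
    unfolding G_def using H_meas by measurable
  then have G_borel: "G \<in> sets borel"
    using D_meas by (simp add: sets_restrict_space_iff space_dx sets_dx)
  have "\<exists>v. v \<in> carrier_vec (rk E) \<and> (\<lambda>k. fibre_norm E x (s k x - v)) \<longlonglongrightarrow> 0" if x: "x \<in> G" for x
  proof -
    have xD: "x \<in> D"
      using x G_D by auto
    have sx: "s k x \<in> carrier_vec (rk E)" for k
      using L2D(2)[OF s xD] .
    interpret F: semi_inner_space "carrier_vec (rk E)" "\<lambda>v c w. v + c \<cdot>\<^sub>v w" "metric E x"
      using fibre[OF xD] .
    have n0: "n k x \<ge> 0" for k
      using sx xD by (simp add: n_def fibre_norm_nonneg)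
    define B where "B = (\<Sum>k. 4 ^ k * (n k x)\<^sup>2)"
    have sum: "summable (\<lambda>k. 4 ^ k * (n k x)\<^sup>2)"
      using x by (intro summable_suminf_not_top) (auto simp: G_def H_def top_unique infinity_ennreal_def)
    have n_le: "n k x \<le> sqrt B * (1/2) ^ k" for k
    proof -
      have "4 ^ k * (n k x)\<^sup>2 \<le> B"
        unfolding B_def using sum_le_suminf[OF sum, of "{k}"] by simp
      moreover have "4 ^ k * (n k x)\<^sup>2 = (2 ^ k * n k x)\<^sup>2"
        by (simp add: power_mult_distrib power2_eq_square flip: power_mult_distrib)
      ultimately have "2 ^ k * n k x \<le> sqrt B"
        by (simp add: real_le_rsqrt)
      then show ?thesis
        by (simp add: field_simps)
    qed
    have "summable (\<lambda>k. n k x)"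
    proof (rule summable_comparison_test')
      show "summable (\<lambda>k. sqrt B * (1/2) ^ k)"
        by (intro summable_mult summable_geometric) simp
      show "norm (n k x) \<le> sqrt B * (1/2) ^ k" for k
        using n_le n0 by simp
    qed
    then have sum': "summable (\<lambda>k. F.dst (s k x) (s (Suc k) x))"
      by (simp add: n_def fibre_norm_eq_dst xD)
    have "\<exists>K. \<forall>j\<ge>K. \<forall>k\<ge>K. fibre_norm E x (s j x - s k x) < e" if "e > 0" for e
      using F.summable_dst_imp_Cauchy[OF sx sum' that] by (simp add: fibre_norm_eq_dst xD)
    from fibre_complete[OF herm D_X[OF xD] sx this] show ?thesis
      by blast
  qed
  then obtain w' where w': "\<And>x. x \<in> G \<Longrightarrow> w' x \<in> carrier_vec (rk E)"
    "\<And>x. x \<in> G \<Longrightarrow> (\<lambda>k. fibre_norm E x (s k x - w' x)) \<longlonglongrightarrow> 0"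
    by metis
  define w where "w x = (if x \<in> G then w' x else 0\<^sub>v (rk E))" for x
  have w_meas: "measurable_section w"
    unfolding measurable_section_def
  proof (intro conjI ballI allI impI)
    show "w x \<in> carrier_vec (rk E)" for x
      using w' by (simp add: w_def)
  next
    fix t i assume t: "t \<in> trivs E" and i: "i < rk E"
    let ?N = "restrict_space borel (D \<inter> fst t)"
    show "(\<lambda>x. in_triv t w x $ i) \<in> borel_measurable ?N"
    proof (rule borel_measurable_LIMSEQ_metric)
      have "(\<lambda>x. indicator G x :: complex) \<in> borel_measurable ?N"
        using G_borel by (intro measurable_restrict_space1 borel_measurable_indicator) auto
      then show "(\<lambda>x. indicator G x * in_triv t (s k) x $ i) \<in> borel_measurable ?N" for k
        using measurable_sectionD(2)[OF L2D(1)[OF s] t i] by (intro borel_measurable_times)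
      fix x assume "x \<in> space ?N"
      then have x: "x \<in> D" "x \<in> fst t"
        by (auto simp: space_restrict_space)
      show "(\<lambda>k. indicator G x * in_triv t (s k) x $ i) \<longlonglongrightarrow> in_triv t w x $ i"
      proof (cases "x \<in> G")
        case True
        with x show ?thesis
          using fibre_norm_tendsto_imp_coordinates[OF herm t x(2) L2D(2)[OF s x(1)] w'(1) w'(2) i]
          by (simp add: in_triv_def w_def)
      next
        case False
        with x i triv_mat[OF t x(2)] show ?thesis
          by (simp add: in_triv_def w_def)
      qed
    qed
  qed
  have energy_le: "energy (sec_comb (\<sigma> j) (- 1) w) \<le> ennreal (((1/4) ^ k)\<^sup>2)" if j: "j \<ge> K k" for j k
  proof -
    have "energy (sec_comb (\<sigma> j) (- 1) w) \<le>
        (\<integral>\<^sup>+x. liminf (\<lambda>l. ennreal ((fibre_norm E x (sec_comb (\<sigma> j) (- 1) (s l) x))\<^sup>2)) \<partial>M)"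
      unfolding energy_def
    proof (rule nn_integral_mono_AE)
      show "AE x in M. ennreal ((fibre_norm E x (sec_comb (\<sigma> j) (- 1) w x))\<^sup>2) \<le>
          liminf (\<lambda>l. ennreal ((fibre_norm E x (sec_comb (\<sigma> j) (- 1) (s l) x))\<^sup>2))"
        using ae AE_space
      proof (eventually_elim, goal_cases)
        case (1 x)
        then have xG: "x \<in> G" and xD: "x \<in> D"
          by (auto simp: G_def space_M)
        interpret F: semi_inner_space "carrier_vec (rk E)" "\<lambda>v c w. v + c \<cdot>\<^sub>v w" "metric E x"
          using fibre[OF xD] .
        have c: "\<sigma> j x \<in> carrier_vec (rk E)" "s l x \<in> carrier_vec (rk E)" "w x \<in> carrier_vec (rk E)" for l
          using L2D(2)[OF \<sigma> xD] L2D(2)[OF s xD] measurable_sectionD(1)[OF w_meas xD] by auto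
        have "(\<lambda>l. F.dst (s l x) (w x)) \<longlonglongrightarrow> 0"
          using w'(2)[OF xG] xG by (simp add: w_def fibre_norm_eq_dst[OF xD])
        then have "(\<lambda>l. F.dst (\<sigma> j x) (s l x) - F.dst (\<sigma> j x) (w x)) \<longlonglongrightarrow> 0"
        proof (rule Lim_null_comparison[rotated], intro always_eventually allI)
          fix l
          show "norm (F.dst (\<sigma> j x) (s l x) - F.dst (\<sigma> j x) (w x)) \<le> F.dst (s l x) (w x)"
            using F.dst_triangle[OF c(1) c(2) c(3), of l] F.dst_triangle[OF c(1) c(3) c(2), of l]
              F.dst_commute[OF c(2) c(3), of l] by simp
        qed
        then have "(\<lambda>l. F.dst (\<sigma> j x) (s l x)) \<longlonglongrightarrow> F.dst (\<sigma> j x) (w x)"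
          by (simp add: LIM_zero_iff)
        then have "(\<lambda>l. fibre_norm E x (sec_comb (\<sigma> j) (- 1) (s l) x)) \<longlonglongrightarrow>
            fibre_norm E x (sec_comb (\<sigma> j) (- 1) w x)"
          by (simp add: sec_comb_def F.dst_def fibre_norm_eq_nm[OF xD])
        then have "(\<lambda>l. ennreal ((fibre_norm E x (sec_comb (\<sigma> j) (- 1) (s l) x))\<^sup>2)) \<longlonglongrightarrow>
            ennreal ((fibre_norm E x (sec_comb (\<sigma> j) (- 1) w x))\<^sup>2)"
          by (intro tendsto_ennrealI tendsto_power)
        from lim_imp_Liminf[OF sequentially_bot this] show ?case
          by simp
      qed
    qed
    also have "\<dots> \<le> liminf (\<lambda>l. energy (sec_comb (\<sigma> j) (- 1) (s l)))"
      unfolding energy_def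
      using fibre_norm_measurable[OF L2D(1)[OF L2_comb[OF \<sigma> s]]] by (intro nn_integral_liminf) auto
    also have "\<dots> \<le> liminf (\<lambda>l::nat. ennreal (((1/4) ^ k)\<^sup>2))"
    proof (rule Liminf_mono)
      have "energy (sec_comb (\<sigma> j) (- 1) (s l)) \<le> ennreal (((1/4) ^ k)\<^sup>2)" if "l \<ge> k" for l
      proof -
        have "L2.dst (\<sigma> j) (s l) < (1/4) ^ k"
          unfolding s_def using j r_ge[OF that] by (intro K)
        then show ?thesis
          using energy_eq[OF L2_comb[OF \<sigma> s]] L2.dst_nonneg[OF \<sigma> s]
          by (auto simp: L2.dst_def intro!: ennreal_leI power_mono)
      qed
      then show "\<forall>\<^sub>F l in sequentially. energy (sec_comb (\<sigma> j) (- 1) (s l)) \<le> ennreal (((1/4) ^ k)\<^sup>2)"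
        by (auto simp: eventually_sequentially)
    qed
    finally show ?thesis
      by (simp add: Liminf_const)
  qed
  have diff_L2: "sec_comb (\<sigma> j) (- 1) w \<in> L2" if "j \<ge> K k" for j k
    unfolding L2_iff_energy
    using energy_le[OF that] measurable_section_comb[OF L2D(1)[OF \<sigma>] w_meas]
    by (auto simp: less_top[symmetric] top_unique elim: order_le_less_trans)
  have "w \<in> L2"
  proof (rule L2_cong)
    show "sec_comb (\<sigma> (K 0)) (- 1) (sec_comb (\<sigma> (K 0)) (- 1) w) \<in> L2"
      by (rule L2_comb[OF \<sigma> diff_L2[of 0]]) simp
    fix x assume "x \<in> D"
    then have "\<sigma> (K 0) x \<in> carrier_vec (rk E)" "w x \<in> carrier_vec (rk E)"
      using \<sigma> w_meas by (auto simp: L2D measurable_sectionD)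
    then show "sec_comb (\<sigma> (K 0)) (- 1) (sec_comb (\<sigma> (K 0)) (- 1) w) x = w x"
      unfolding sec_comb_def by (intro eq_vecI) auto
  qed
  have le: "L2.dst (\<sigma> j) w \<le> (1/4) ^ k" if "j \<ge> K k" for j k
  proof -
    have "ennreal ((L2.dst (\<sigma> j) w)\<^sup>2) \<le> ennreal (((1/4) ^ k)\<^sup>2)"
      using energy_le[OF that] energy_eq[OF diff_L2[OF that]] by (simp add: L2.dst_def)
    then have "(L2.dst (\<sigma> j) w)\<^sup>2 \<le> ((1/4) ^ k)\<^sup>2"
      by (subst (asm) ennreal_le_iff) auto
    then show ?thesis
      by (rule power2_le_imp_le) simp
  qed
  have "(\<lambda>j. L2.dst (\<sigma> j) w) \<longlonglongrightarrow> 0"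
  proof (rule LIMSEQ_I)
    fix e :: real assume "e > 0"
    then obtain k where k: "(1/4) ^ k < e"
      using real_arch_pow_inv[of e "1/4"] by auto
    have "norm (L2.dst (\<sigma> j) w - 0) < e" if "j \<ge> K k" for j
      using le[OF that] k L2.dst_nonneg[OF \<sigma> \<open>w \<in> L2\<close>, of j] by simp
    then show "\<exists>N. \<forall>j\<ge>N. norm (L2.dst (\<sigma> j) w - 0) < e"
      by blast
  qed
  with \<open>w \<in> L2\<close> show ?thesis
    by (rule that)
qed

end

section \<open>Differential operators on smooth sections\<close>

lemma has_derivative_cong_open:
  assumes "open V" "z \<in> V" "\<And>y. y \<in> V \<Longrightarrow> f y = g y"
  shows "(f has_derivative f') (at z) \<longleftrightarrow> (g has_derivative f') (at z)"
  using assms has_derivative_transform_within_open[of f f' z UNIV V g]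
    has_derivative_transform_within_open[of g f' z UNIV V f] by auto

lemma differentiable_cong_open:
  assumes "f differentiable (at z)" "open V" "z \<in> V" "\<And>y. y \<in> V \<Longrightarrow> f y = g y"
  shows "g differentiable (at z)"
  using assms(1) has_derivative_cong_open[OF assms(2-4)] by (simp add: differentiable_def)

lemma frechet_derivative_cong_open:
  assumes "open V" "z \<in> V" "\<And>y. y \<in> V \<Longrightarrow> f y = g y"
  shows "frechet_derivative f (at z) = frechet_derivative g (at z)"
  unfolding frechet_derivative_def using has_derivative_cong_open[OF assms] by presburger

text \<open>
  At interior points of \<open>S\<close> the iterated derivative within \<open>S\<close> depends only on the function near
  the point. Thus a smooth function may be replaced by its local smooth extension, and the set in
  which derivatives are taken may be changed.
\<close>

lemma partial_derivs_cong_open: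
  assumes V: "open V" "V \<subseteq> S" "V \<subseteq> S'" and eq: "\<And>y. y \<in> V \<Longrightarrow> f y = g y" and "z \<in> V"
  shows "partial_derivs S l f z = partial_derivs S' l g z"
  using \<open>z \<in> V\<close>
proof (induction l arbitrary: z)
  case (Cons i l)
  have "at z within S = at z" "at z within S' = at z"
    using V Cons.prems by (auto intro: at_within_open_subset)
  then show ?case
    using frechet_derivative_cong_open[OF V(1) Cons.prems Cons.IH] by simp
qed (simp add: eq)

lemma smooth_on_partial_derivs_differentiable:
  assumes f: "smooth_on V f" and V: "open V" "V \<subseteq> S" and z: "z \<in> V"
  shows "partial_derivs S l f differentiable (at z)"
proof -
  obtain W g where W: "z \<in> W" "C_infinity_on W g" and eq: "\<And>y. y \<in> V \<inter> W \<Longrightarrow> g y = f y"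
    using f z unfolding smooth_on_def by metis
  have "open W"
    using W(2) by (simp add: C_infinity_on_def)
  have d: "partial_derivs UNIV l g differentiable (at z)"
    using W \<open>open W\<close> by (simp add: C_infinity_on_def differentiable_on_eq_differentiable_at)
  have "partial_derivs UNIV l g y = partial_derivs S l f y" if "y \<in> V \<inter> W" for y
    using V \<open>open W\<close> by (intro partial_derivs_cong_open[OF _ _ _ eq that]) auto
  then show ?thesis
    using V(1) \<open>open W\<close> z W(1) by (intro differentiable_cong_open[OF d, of "V \<inter> W"]) auto
qed

lemma smooth_on_partial_derivs_continuous_on:
  assumes "smooth_on V f" "open V" "V \<subseteq> S"
  shows "continuous_on V (partial_derivs S l f)"
  using smooth_on_partial_derivs_differentiable[OF assms]
  by (intro continuous_at_imp_continuous_on ballI differentiable_imp_continuous_within)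

lemma partial_derivs_comb:
  fixes f g :: "real ^ 'n \<Rightarrow> complex"
  assumes V: "open V" "V \<subseteq> S"
    and f: "\<And>l z. z \<in> V \<Longrightarrow> partial_derivs S l f differentiable (at z)"
    and g: "\<And>l z. z \<in> V \<Longrightarrow> partial_derivs S l g differentiable (at z)"
    and "z \<in> V"
  shows "partial_derivs S l (\<lambda>y. f y + c * g y) z = partial_derivs S l f z + c * partial_derivs S l g z"
  using \<open>z \<in> V\<close>
proof (induction l arbitrary: z)
  case (Cons i l)
  let ?f = "partial_derivs S l f" and ?g = "partial_derivs S l g"
  have z: "at z within S = at z"
    using V Cons.prems by (auto intro: at_within_open_subset)
  have "((\<lambda>y. ?f y + c * ?g y) has_derivative
      (\<lambda>v. frechet_derivative ?f (at z) v + c * frechet_derivative ?g (at z) v)) (at z)"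
    using f[OF Cons.prems] g[OF Cons.prems]
    by (intro has_derivative_add has_derivative_mult_right) (simp_all add: frechet_derivative_works)
  then have "frechet_derivative (\<lambda>y. ?f y + c * ?g y) (at z) =
      (\<lambda>v. frechet_derivative ?f (at z) v + c * frechet_derivative ?g (at z) v)"
    by (rule frechet_derivative_at[symmetric])
  moreover have "frechet_derivative (partial_derivs S l (\<lambda>y. f y + c * g y)) (at z) =
      frechet_derivative (\<lambda>y. ?f y + c * ?g y) (at z)"
    by (rule frechet_derivative_cong_open[OF V(1) Cons.prems Cons.IH])
  ultimately show ?case
    by (simp add: z)
qed simp

lemma C_infinity_on_subset: "C_infinity_on V g \<Longrightarrow> open W \<Longrightarrow> W \<subseteq> V \<Longrightarrow> C_infinity_on W g"
  unfolding C_infinity_on_def using differentiable_on_subset by blast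

lemma C_infinity_on_comb:
  fixes f g :: "real ^ 'n \<Rightarrow> complex"
  assumes "C_infinity_on V f" "C_infinity_on V g"
  shows "C_infinity_on V (\<lambda>y. f y + c * g y)"
proof -
  have V: "open V"
    using assms(1) by (simp add: C_infinity_on_def)
  have d: "partial_derivs UNIV l f differentiable (at z)" "partial_derivs UNIV l g differentiable (at z)"
    if "z \<in> V" for l z
    using assms that V by (auto simp: C_infinity_on_def differentiable_on_eq_differentiable_at)
  have "partial_derivs UNIV l (\<lambda>y. f y + c * g y) differentiable (at z)" if z: "z \<in> V" for l z
  proof -
    have d': "(\<lambda>y. partial_derivs UNIV l f y + c * partial_derivs UNIV l g y) differentiable (at z)"
      using d[OF z] by (intro differentiable_add differentiable_mult differentiable_const)
    have "partial_derivs UNIV l f y + c * partial_derivs UNIV l g y =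
        partial_derivs UNIV l (\<lambda>y. f y + c * g y) y" if "y \<in> V" for y
      using that by (intro partial_derivs_comb[OF V _ d, symmetric]) auto
    then show ?thesis
      by (rule differentiable_cong_open[OF d' V z])
  qed
  then show ?thesis
    using V by (simp add: C_infinity_on_def differentiable_on_eq_differentiable_at)
qed

lemma smooth_on_comb:
  fixes f g :: "real ^ 'n \<Rightarrow> complex"
  assumes "smooth_on S f" "smooth_on S g"
  shows "smooth_on S (\<lambda>y. f y + c * g y)"
  unfolding smooth_on_def
proof
  fix y assume "y \<in> S"
  then obtain V f' W g' where V: "y \<in> V" "C_infinity_on V f'" "\<And>z. z \<in> S \<inter> V \<Longrightarrow> f' z = f z"
    and W: "y \<in> W" "C_infinity_on W g'" "\<And>z. z \<in> S \<inter> W \<Longrightarrow> g' z = g z"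
    using assms unfolding smooth_on_def by metis
  have "open (V \<inter> W)"
    using V(2) W(2) by (simp add: C_infinity_on_def open_Int)
  then have "C_infinity_on (V \<inter> W) (\<lambda>y. f' y + c * g' y)"
    by (intro C_infinity_on_comb C_infinity_on_subset[OF V(2)] C_infinity_on_subset[OF W(2)]) auto
  with V W show "\<exists>U h. y \<in> U \<and> C_infinity_on U h \<and> (\<forall>z\<in>S \<inter> U. h z = f z + c * g z)"
    by (intro exI[of _ "V \<inter> W"] exI[of _ "\<lambda>y. f' y + c * g' y"]) auto
qed

lemma smooth_on_subset:
  assumes "smooth_on S f" "T \<subseteq> S"
  shows "smooth_on T f"
  unfolding smooth_on_def
proof
  fix y assume "y \<in> T"
  with assms(2) have "y \<in> S"
    by auto
  then obtain V h where "y \<in> V" "C_infinity_on V h" "\<forall>z\<in>S \<inter> V. h z = f z"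
    using assms(1) unfolding smooth_on_def by blast
  with assms(2) show "\<exists>V h. y \<in> V \<and> C_infinity_on V h \<and> (\<forall>z\<in>T \<inter> V. h z = f z)"
    by (intro exI[of _ V] exI[of _ h]) auto
qed

lemma smooth_on_cong:
  assumes "smooth_on S f" "\<And>y. y \<in> S \<Longrightarrow> f y = g y"
  shows "smooth_on S g"
  unfolding smooth_on_def
proof
  fix y assume "y \<in> S"
  then obtain V h where "y \<in> V" "C_infinity_on V h" "\<forall>z\<in>S \<inter> V. h z = f z"
    using assms(1) unfolding smooth_on_def by blast
  with assms(2) show "\<exists>V h. y \<in> V \<and> C_infinity_on V h \<and> (\<forall>z\<in>S \<inter> V. h z = g z)"
    by (intro exI[of _ V] exI[of _ h]) auto
qed

lemma smooth_on_0:
  fixes S :: "(real ^ 'n::finite) set"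
  shows "smooth_on S (\<lambda>y. 0 :: 'b::real_normed_vector)"
proof -
  have "partial_derivs UNIV l (\<lambda>y. 0) = (\<lambda>y :: real ^ 'n. 0 :: 'b)" for l
    by (induction l) auto
  then have "C_infinity_on UNIV (\<lambda>y :: real ^ 'n. 0 :: 'b)"
    by (simp add: C_infinity_on_def)
  then show ?thesis
    unfolding smooth_on_def by blast
qed

lemma smooth_section_subset: "smooth_section atlas W E u \<Longrightarrow> W' \<subseteq> W \<Longrightarrow> smooth_section atlas W' E u"
  unfolding smooth_section_def smooth_fun_def
  by (blast intro: smooth_on_subset)

lemma smooth_section_comb:
  assumes charts: "\<And>c. c \<in> atlas \<Longrightarrow> is_chart c" and E: "is_vbundle atlas X E"
    and u: "smooth_section atlas W E u" and v: "smooth_section atlas W E v"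
  shows "smooth_section atlas W E (sec_comb u c v)"
  unfolding smooth_section_def smooth_fun_def
proof (intro conjI ballI allI impI)
  have uv: "u x \<in> carrier_vec (rk E)" "v x \<in> carrier_vec (rk E)" if "x \<in> W" for x
    using u v that by (auto simp: smooth_section_def)
  show "sec_comb u c v x \<in> carrier_vec (rk E)" if "x \<in> W" for x
    using uv[OF that] by (simp add: sec_comb_def)
  fix t i d assume t: "t \<in> trivs E" and i: "i < rk E" and d: "d \<in> atlas"
  let ?S = "snd d ` (fst d \<inter> (W \<inter> fst t))"
  have "smooth_on ?S (\<lambda>y. ((\<lambda>x. in_triv t u x $ i) \<circ> chart_inv d) y + c * ((\<lambda>x. in_triv t v x $ i) \<circ> chart_inv d) y)"
    by (rule smooth_on_comb) (use u v t i d in \<open>simp_all only: smooth_section_def smooth_fun_def\<close>)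
  then show "smooth_on ?S ((\<lambda>x. in_triv t (sec_comb u c v) x $ i) \<circ> chart_inv d)"
    by (rule smooth_on_cong)
      (auto simp: chart_inv_eq[OF charts[OF d]] in_triv_comb_index[OF E t] uv i)
qed

lemma smooth_section_0:
  assumes charts: "\<And>c. c \<in> atlas \<Longrightarrow> is_chart c" and E: "is_vbundle atlas X E"
  shows "smooth_section atlas W E (\<lambda>x. 0\<^sub>v (rk E))"
  unfolding smooth_section_def smooth_fun_def
proof (intro conjI ballI allI impI)
  fix t i d assume t: "t \<in> trivs E" and i: "i < rk E" and d: "d \<in> atlas"
  have "in_triv t (\<lambda>x. 0\<^sub>v (rk E)) x $ i = 0" if "x \<in> fst t" for x
    using is_vbundle_trivD(1)[OF E t that] i by (simp add: in_triv_def)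
  then show "smooth_on (snd d ` (fst d \<inter> (W \<inter> fst t))) ((\<lambda>x. in_triv t (\<lambda>x. 0\<^sub>v (rk E)) x $ i) \<circ> chart_inv d)"
    by (intro smooth_on_cong[OF smooth_on_0]) (auto simp: chart_inv_eq[OF charts[OF d]])
qed simp

lemma smooth_section_coordinate:
  assumes "smooth_section atlas W E u" "c \<in> atlas" "s \<in> trivs E" "j < rk E"
  shows "smooth_on (snd c ` (fst c \<inter> fst s \<inter> W)) (\<lambda>y. in_triv s u (chart_inv c y) $ j)"
proof -
  have "fst c \<inter> fst s \<inter> W = fst c \<inter> (W \<inter> fst s)"
    by auto
  then show ?thesis
    using assms by (simp add: smooth_section_def smooth_fun_def o_def)
qed

lemma diff_operator_formula:
  assumes P: "diff_operator atlas S E F k P" and W: "open W" "W \<subseteq> S" and u: "smooth_section atlas W E u"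
    and c: "c \<in> atlas" and s: "s \<in> trivs E" and t: "t \<in> trivs F"
    and x: "x \<in> fst c \<inter> fst s \<inter> fst t \<inter> W"
  shows "act P u x \<in> carrier_vec (rk F)"
    and "i < rk F \<Longrightarrow> in_triv t (act P u) x $ i = (\<Sum>l | length l \<le> k. \<Sum>j<rk E.
          coeff P c s t l x $$ (i, j) *
          partial_derivs (snd c ` (fst c \<inter> S)) l (\<lambda>y. in_triv s u (chart_inv c y) $ j) (snd c x))"
proof -
  have "openin (top_of_set S) W"
    using W by (rule open_subset[rotated])
  with u have W': "openin (top_of_set S) W \<and> smooth_section atlas W E u"
    by simp
  have x': "x \<in> fst c \<inter> fst s \<inter> fst t \<inter> S \<inter> W"
    using x W by auto
  have "act P u x \<in> carrier_vec (rk F) \<and>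
      in_triv t (act P u) x = vec (rk F) (\<lambda>i. \<Sum>l | length l \<le> k. \<Sum>j<rk E.
        coeff P c s t l x $$ (i, j) *
        partial_derivs (snd c ` (fst c \<inter> S)) l (\<lambda>y. in_triv s u (chart_inv c y) $ j) (snd c x))"
    using P[unfolded diff_operator_def Let_def, rule_format, OF c s t] W' x' by blast
  then show "act P u x \<in> carrier_vec (rk F)"
    and "i < rk F \<Longrightarrow> in_triv t (act P u) x $ i = (\<Sum>l | length l \<le> k. \<Sum>j<rk E.
          coeff P c s t l x $$ (i, j) *
          partial_derivs (snd c ` (fst c \<inter> S)) l (\<lambda>y. in_triv s u (chart_inv c y) $ j) (snd c x))"
    by auto
qed

text \<open>
  A differential operator is linear only through its local formula, which determines its value at
  \<open>x\<close> as long as the argument is smooth near \<open>x\<close>.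
\<close>

lemma act_comb:
  assumes charts: "\<And>c. c \<in> atlas \<Longrightarrow> is_chart c" and X: "X \<subseteq> carrier_of atlas"
    and E: "is_vbundle atlas X E" and F: "is_vbundle atlas S F" and "S \<subseteq> X"
    and P: "diff_operator atlas S E F k P" and W: "open W" "W \<subseteq> S"
    and u: "smooth_section atlas W E u" and v: "smooth_section atlas W E v" and x: "x \<in> W"
  shows "act P u x \<in> carrier_vec (rk F)"
    and "act P (sec_comb u a v) x = act P u x + a \<cdot>\<^sub>v act P v x"
proof -
  have "x \<in> X" "x \<in> S"
    using x W(2) \<open>S \<subseteq> X\<close> by auto
  obtain c where c: "c \<in> atlas" "x \<in> fst c"
    using X \<open>x \<in> X\<close> by (auto simp: carrier_of_def)
  obtain s where s: "s \<in> trivs E" "x \<in> fst s"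
    using is_vbundle_triv[OF E \<open>x \<in> X\<close>] .
  obtain t where t: "t \<in> trivs F" "x \<in> fst t"
    using is_vbundle_triv[OF F \<open>x \<in> S\<close>] .
  have x': "x \<in> fst c \<inter> fst s \<inter> fst t \<inter> W"
    using x c s t by simp
  note formula = diff_operator_formula[OF P W _ c(1) s(1) t(1) x']
  have w: "smooth_section atlas W E (sec_comb u a v)"
    using smooth_section_comb[OF charts E u v] .
  have uv: "u y \<in> carrier_vec (rk E)" "v y \<in> carrier_vec (rk E)" if "y \<in> W" for y
    using u v that by (auto simp: smooth_section_def)
  show act_u: "act P u x \<in> carrier_vec (rk F)"
    by (rule formula(1)[OF u])
  have act_v: "act P v x \<in> carrier_vec (rk F)"
    by (rule formula(1)[OF v])
  have act_w: "act P (sec_comb u a v) x \<in> carrier_vec (rk F)"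
    by (rule formula(1)[OF w])
  have ch: "is_chart c"
    by (rule charts[OF c(1)])
  let ?V = "snd c ` (fst c \<inter> fst s \<inter> W)" and ?S = "snd c ` (fst c \<inter> S)"
  let ?co = "\<lambda>u j y. in_triv s u (chart_inv c y) $ j"
  have "open (fst c \<inter> (fst s \<inter> W))"
    using is_vbundle_triv_open[OF E s(1) W(1)] W(2) \<open>S \<subseteq> X\<close> ch by (auto simp: is_chart_def)
  then have V: "open ?V"
    by (intro is_chart_open_image[OF ch]) (auto simp: Int_assoc)
  have VS: "?V \<subseteq> ?S"
    using W(2) by auto
  have xV: "snd c x \<in> ?V"
    using x' by auto
  have pd: "partial_derivs ?S l (?co (sec_comb u a v) j) (snd c x) =
      partial_derivs ?S l (?co u j) (snd c x) + a * partial_derivs ?S l (?co v j) (snd c x)"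
    if j: "j < rk E" for l j
  proof -
    have "partial_derivs ?S l (?co (sec_comb u a v) j) (snd c x) =
        partial_derivs ?S l (\<lambda>y. ?co u j y + a * ?co v j y) (snd c x)"
    proof (rule partial_derivs_cong_open[OF V VS VS _ xV])
      fix y assume "y \<in> ?V"
      then obtain q where "q \<in> fst c" "q \<in> fst s" "q \<in> W" "y = snd c q"
        by auto
      then show "?co (sec_comb u a v) j y = ?co u j y + a * ?co v j y"
        using in_triv_comb_index[OF E s(1)] uv j by (simp add: chart_inv_eq[OF ch])
    qed
    also have "\<dots> = partial_derivs ?S l (?co u j) (snd c x) + a * partial_derivs ?S l (?co v j) (snd c x)"
      using smooth_on_partial_derivs_differentiable[OF smooth_section_coordinate[OF _ c(1) s(1) j] V VS] u v
      by (intro partial_derivs_comb[OF V VS _ _ xV]) blast+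
    finally show ?thesis .
  qed
  have T: "snd t x \<in> carrier_mat (rk F) (rk F)" "invertible_mat (snd t x)"
    using is_vbundle_trivD[OF F t] by auto
  have "snd t x *\<^sub>v act P (sec_comb u a v) x = snd t x *\<^sub>v (act P u x + a \<cdot>\<^sub>v act P v x)"
  proof (intro eq_vecI)
    fix i assume "i < dim_vec (snd t x *\<^sub>v (act P u x + a \<cdot>\<^sub>v act P v x))"
    then have i: "i < rk F"
      using T by simp
    have "(snd t x *\<^sub>v act P (sec_comb u a v) x) $ i = in_triv t (act P (sec_comb u a v)) x $ i"
      by (simp add: in_triv_def)
    also have "\<dots> = in_triv t (act P u) x $ i + a * in_triv t (act P v) x $ i"
      unfolding formula(2)[OF u i] formula(2)[OF v i] formula(2)[OF w i]
      by (simp add: pd sum.distrib sum_distrib_left algebra_simps)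
    also have "\<dots> = (snd t x *\<^sub>v (act P u x + a \<cdot>\<^sub>v act P v x)) $ i"
      using mult_mat_vec_comb_index[OF T(1) act_u act_v i] by (simp add: in_triv_def)
    finally show "(snd t x *\<^sub>v act P (sec_comb u a v) x) $ i = (snd t x *\<^sub>v (act P u x + a \<cdot>\<^sub>v act P v x)) $ i" .
  qed (use T in auto)
  then show "act P (sec_comb u a v) x = act P u x + a \<cdot>\<^sub>v act P v x"
    by (rule mult_mat_vec_invertible_cancel[OF T, rotated 2]) (use act_u act_v act_w in auto)
qed

text \<open>The zero section equals its difference with itself.\<close>

lemma act_0:
  assumes "\<And>c. c \<in> atlas \<Longrightarrow> is_chart c" "X \<subseteq> carrier_of atlas"
    and "is_vbundle atlas X E" "is_vbundle atlas S F" "S \<subseteq> X"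
    and "diff_operator atlas S E F k P" "open W" "W \<subseteq> S" "x \<in> W"
  shows "act P (\<lambda>x. 0\<^sub>v (rk E)) x = 0\<^sub>v (rk F)"
proof -
  let ?z = "\<lambda>x :: 'a. 0\<^sub>v (rk E) :: complex vec"
  have z: "smooth_section atlas W E ?z"
    using assms by (intro smooth_section_0)
  note lin = act_comb[OF assms(1-8) z z assms(9)]
  have "sec_comb ?z (- 1) ?z = ?z"
    unfolding sec_comb_def by (intro ext eq_vecI) auto
  then have "act P ?z x = act P ?z x + (- 1) \<cdot>\<^sub>v act P ?z x"
    using lin(2)[of "- 1"] by simp
  also have "\<dots> = 0\<^sub>v (rk F)"
    using lin(1) by (intro eq_vecI) auto
  finally show ?thesis .
qed

text \<open>All that integration over \<open>D\<close> needs to know about \<open>u\<close> and \<open>A u\<close> is that they are continuous.\<close>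

definition continuous_section ::
  "'p::topological_space set \<Rightarrow> ('p, 'z) vbundle_scheme \<Rightarrow> 'p bsection \<Rightarrow> bool" where
  "continuous_section W E u \<longleftrightarrow> (\<forall>x\<in>W. u x \<in> carrier_vec (rk E)) \<and>
     (\<forall>t\<in>trivs E. \<forall>i<rk E. continuous_on (W \<inter> fst t) (\<lambda>x. in_triv t u x $ i))"

lemma smooth_section_imp_continuous_section:
  fixes W :: "'p::t2_space set"
  assumes "\<And>c. c \<in> atlas \<Longrightarrow> is_chart c" "W \<subseteq> carrier_of atlas" "smooth_section atlas W E u"
  shows "continuous_section W E u"
  unfolding continuous_section_def
proof (intro conjI ballI allI impI)
  fix t i assume "t \<in> trivs E" "i < rk E"
  then have "smooth_fun atlas (W \<inter> fst t) (\<lambda>x. in_triv t u x $ i)"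
    using assms(3) by (auto simp: smooth_section_def)
  then show "continuous_on (W \<inter> fst t) (\<lambda>x. in_triv t u x $ i)"
    using assms(2) by (intro smooth_fun_imp_continuous_on[OF assms(1)]) auto
qed (use assms(3) in \<open>auto simp: smooth_section_def\<close>)

lemma act_continuous_section:
  fixes W :: "'p::t2_space set" and atlas :: "('p, 'n::finite) chart set"
  assumes charts: "\<And>c. c \<in> atlas \<Longrightarrow> is_chart c" and X: "X \<subseteq> carrier_of atlas"
    and E: "is_vbundle atlas X E" and F: "is_vbundle atlas X F"
    and P: "diff_operator atlas X E F k P" and W: "open W" "W \<subseteq> X"
    and u: "smooth_section atlas W E u"
  shows "continuous_section W F (act P u)"
  unfolding continuous_section_def
proof (intro conjI ballI allI impI)
  fix x assume "x \<in> W"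
  then show "act P u x \<in> carrier_vec (rk F)"
    using act_comb(1)[OF charts X E F _ P W u u] by simp
next
  fix t i assume t: "t \<in> trivs F" and i: "i < rk F"
  show "continuous_on (W \<inter> fst t) (\<lambda>x. in_triv t (act P u) x $ i)"
  proof (rule continuous_on_locally)
    fix x assume x: "x \<in> W \<inter> fst t"
    then have "x \<in> X"
      using W(2) by auto
    obtain c where c: "c \<in> atlas" "x \<in> fst c"
      using X \<open>x \<in> X\<close> by (auto simp: carrier_of_def)
    obtain s where s: "s \<in> trivs E" "x \<in> fst s"
      using is_vbundle_triv[OF E \<open>x \<in> X\<close>] .
    have ch: "is_chart c"
      by (rule charts[OF c(1)])
    let ?U = "fst c \<inter> fst s \<inter> W" and ?S = "snd c ` (fst c \<inter> X)"
    let ?\<Omega> = "fst c \<inter> fst s \<inter> fst t \<inter> X"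
    let ?co = "\<lambda>j y. in_triv s u (chart_inv c y) $ j"
    have "open (fst c \<inter> (fst s \<inter> W))"
      using is_vbundle_triv_open[OF E s(1) W] ch by (auto simp: is_chart_def)
    then have U: "open ?U"
      by (simp add: Int_assoc)
    then have V: "open (snd c ` ?U)"
      by (intro is_chart_open_image[OF ch]) auto
    let ?sum = "\<lambda>x. \<Sum>l | length l \<le> k. \<Sum>j<rk E.
      coeff P c s t l x $$ (i, j) * partial_derivs ?S l (?co j) (snd c x)"
    have "continuous_on (W \<inter> fst t \<inter> ?U) ?sum"
    proof (intro continuous_on_sum continuous_on_mult)
      fix l :: "'n list" and j assume "l \<in> {l. length l \<le> k}" and "j \<in> {..<rk E}"
      then have l: "length l \<le> k" and j: "j < rk E"
        by auto
      have "smooth_fun atlas ?\<Omega> (\<lambda>x. coeff P c s t l x $$ (i, j))"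
        using P[unfolded diff_operator_def Let_def, rule_format, OF c(1) s(1) t] l i j by blast
      then have "continuous_on ?\<Omega> (\<lambda>x. coeff P c s t l x $$ (i, j))"
        using X by (intro smooth_fun_imp_continuous_on[OF charts]) auto
      then show "continuous_on (W \<inter> fst t \<inter> ?U) (\<lambda>x. coeff P c s t l x $$ (i, j))"
        by (rule continuous_on_subset) (use W(2) in auto)
      have "continuous_on (snd c ` ?U) (partial_derivs ?S l (?co j))"
        by (rule smooth_on_partial_derivs_continuous_on[OF smooth_section_coordinate[OF u c(1) s(1) j] V])
          (use W(2) in auto)
      then have "continuous_on ?U (partial_derivs ?S l (?co j) \<circ> snd c)"
        using continuous_on_subset[OF is_chart_continuous_on[OF ch], of ?U]
        by (rule continuous_on_compose[rotated]) auto
      then show "continuous_on (W \<inter> fst t \<inter> ?U) (\<lambda>x. partial_derivs ?S l (?co j) (snd c x))"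
        unfolding o_def by (rule continuous_on_subset) auto
    qed
    then have "continuous_on (W \<inter> fst t \<inter> ?U) (\<lambda>x. in_triv t (act P u) x $ i)"
      by (rule continuous_on_eq) (use diff_operator_formula(2)[OF P W u c(1) s(1) t _ i] in auto)
    with U x c(2) s(2) show "\<exists>U. open U \<and> x \<in> U \<and> continuous_on (W \<inter> fst t \<inter> U) (\<lambda>x. in_triv t (act P u) x $ i)"
      by blast
  qed
qed

section \<open>Continuous sections are square integrable\<close>

text \<open>In a small closed coordinate ball the volume form has a bounded coefficient.\<close>

lemma induced_measure_compact_finite:
  fixes atlas :: "('p::t2_space, 'n::finite) chart set"
  assumes charts: "\<And>c. c \<in> atlas \<Longrightarrow> is_chart c" and X: "X \<subseteq> carrier_of atlas"
    and \<omega>: "volume_form atlas X \<omega>" and dx: "induced_measure atlas X \<omega> dx"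
    and K: "compact K" "K \<subseteq> interior X"
  shows "emeasure dx K < \<infinity>"
proof -
  have "\<exists>U. open U \<and> p \<in> U \<and> emeasure dx U < \<infinity>" if "p \<in> K" for p
  proof -
    have p: "p \<in> interior X" "p \<in> X"
      using that K(2) interior_subset by auto
    then obtain c where c: "c \<in> atlas" "p \<in> fst c"
      using X by (auto simp: carrier_of_def)
    have ch: "is_chart c"
      by (rule charts[OF c(1)])
    let ?V = "snd c ` (fst c \<inter> interior X)"
    let ?w = "\<lambda>y. \<bar>\<omega> c (chart_inv c y)\<bar>"
    have oU: "open (fst c \<inter> interior X)"
      using ch by (auto simp: is_chart_def)
    then have "open ?V"
      by (intro is_chart_open_image[OF ch]) auto
    then obtain r where r: "r > 0" "cball (snd c p) r \<subseteq> ?V"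
      using p c(2) open_contains_cball by (metis IntI imageI)
    have "smooth_on (snd c ` (fst c \<inter> (fst c \<inter> X))) (\<omega> c \<circ> chart_inv c)"
      using \<omega> c(1) unfolding volume_form_def smooth_fun_def by blast
    then have "continuous_on (snd c ` (fst c \<inter> (fst c \<inter> X))) (\<omega> c \<circ> chart_inv c)"
      by (rule smooth_on_imp_continuous_on)
    then have "continuous_on (cball (snd c p) r) (\<omega> c \<circ> chart_inv c)"
      by (rule continuous_on_subset) (use r(2) interior_subset[of X] in fastforce)
    then have "bounded ((\<omega> c \<circ> chart_inv c) ` cball (snd c p) r)"
      by (intro compact_imp_bounded compact_continuous_image compact_cball)
    then obtain b where "\<forall>y\<in>cball (snd c p) r. ?w y \<le> b"
      by (auto simp: bounded_iff)
    then have b: "?w y \<le> b" if "y \<in> cball (snd c p) r" for y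
      using that by blast
    define U where "U = fst c \<inter> interior X \<inter> snd c -` ball (snd c p) r"
    have "open U"
      unfolding U_def using oU continuous_on_subset[OF is_chart_continuous_on[OF ch]]
      by (intro continuous_open_preimage) auto
    have "U \<in> sets borel" "U \<subseteq> fst c \<inter> X"
      using \<open>open U\<close> interior_subset by (auto simp: U_def)
    then have "emeasure dx U = (\<integral>\<^sup>+y. ennreal (?w y) * indicator (snd c ` U) y \<partial>lborel)"
      using dx c(1) unfolding induced_measure_def by blast
    also have "\<dots> \<le> (\<integral>\<^sup>+y. ennreal b * indicator (cball (snd c p) r) y \<partial>lborel)"
      by (intro nn_integral_mono) (use b in \<open>auto simp: U_def indicator_def intro!: ennreal_leI\<close>)
    also have "\<dots> = ennreal b * emeasure lborel (cball (snd c p) r)"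
      by (intro nn_integral_cmult_indicator) auto
    also have "\<dots> < \<infinity>"
      using emeasure_bounded_finite[of "cball (snd c p) r"] by (simp add: ennreal_mult_less_top)
    finally have "emeasure dx U < \<infinity>" .
    moreover have "p \<in> U"
      using p c(2) r(1) by (simp add: U_def)
    ultimately show ?thesis
      using \<open>open U\<close> by blast
  qed
  then obtain U where U: "\<And>p. p \<in> K \<Longrightarrow> open (U p) \<and> p \<in> U p \<and> emeasure dx (U p) < \<infinity>"
    by metis
  obtain K' where K': "K' \<subseteq> K" "finite K'" "K \<subseteq> (\<Union>p\<in>K'. U p)"
    using compactE_image[OF K(1), of K U] U by blast
  have sets: "sets dx = sets borel"
    using dx by (simp add: induced_measure_def)
  have "open (\<Union>p\<in>K'. U p)"
    using K' U by auto
  then have "emeasure dx K \<le> emeasure dx (\<Union>p\<in>K'. U p)"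
    using K' by (intro emeasure_mono) (auto simp: sets)
  also have "\<dots> \<le> (\<Sum>p\<in>K'. emeasure dx (U p))"
    using K' U by (intro emeasure_subadditive_finite) (auto simp: sets)
  also have "\<dots> < \<infinity>"
    using K' U by (auto simp: less_top[symmetric])
  finally show ?thesis .
qed

lemma (in hermitian_domain) continuous_section_L2:
  assumes u: "continuous_section W E u" and W: "W \<subseteq> X" "closure D \<subseteq> W"
    and cpt: "compact (closure D)" and fin: "emeasure dx D < \<infinity>"
  shows "u \<in> L2"
  unfolding L2_iff_energy
proof
  have DW: "D \<subseteq> W"
    using W closure_subset by blast
  show m: "measurable_section u"
    unfolding measurable_section_def
  proof (intro conjI ballI allI impI)
    fix t i assume "t \<in> trivs E" "i < rk E"
    then have "continuous_on (W \<inter> fst t) (\<lambda>x. in_triv t u x $ i)"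
      using u by (auto simp: continuous_section_def)
    then have "continuous_on (D \<inter> fst t) (\<lambda>x. in_triv t u x $ i)"
      by (rule continuous_on_subset) (use DW in auto)
    then show "(\<lambda>x. in_triv t u x $ i) \<in> borel_measurable (restrict_space borel (D \<inter> fst t))"
      by (rule borel_measurable_continuous_on_restrict)
  qed (use u DW in \<open>auto simp: continuous_section_def\<close>)
  have "continuous_on W (\<lambda>x. metric E x (u x) (u x))"
  proof (rule continuous_on_locally)
    fix x assume x: "x \<in> W"
    obtain t where t: "t \<in> trivs E" "x \<in> fst t"
      using is_vbundle_triv[OF vbundle] x W by blast
    then obtain T where T: "open T" "fst t = X \<inter> T"
      using vbundle by (auto simp: is_vbundle_def openin_open)
    then have WT: "W \<inter> T = W \<inter> fst t"
      using W by auto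
    obtain g where g: "\<And>i j. i < rk E \<Longrightarrow> j < rk E \<Longrightarrow> smooth_fun atlas (fst t) (g i j)"
      and metric: "\<And>x v w. x \<in> fst t \<Longrightarrow> v \<in> carrier_vec (rk E) \<Longrightarrow> w \<in> carrier_vec (rk E) \<Longrightarrow>
        metric E x v w =
          (\<Sum>i<rk E. \<Sum>j<rk E. g i j x * (snd t x *\<^sub>v v) $ i * cnj ((snd t x *\<^sub>v w) $ j))"
      by (rule hermitian_bundle_local_formula[OF herm t(1)]) (rule that; simp)
    have "continuous_on (W \<inter> T) (\<lambda>x. \<Sum>i<rk E. \<Sum>j<rk E. g i j x * in_triv t u x $ i * cnj (in_triv t u x $ j))"
    proof (intro continuous_on_sum continuous_on_mult continuous_on_cnj)
      fix i j assume ij: "i \<in> {..<rk E}" "j \<in> {..<rk E}"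
      have "continuous_on (fst t) (g i j)"
        using g ij T X_covered by (intro smooth_fun_imp_continuous_on[OF charts]) auto
      then show "continuous_on (W \<inter> T) (g i j)"
        unfolding WT by (rule continuous_on_subset) auto
      show "continuous_on (W \<inter> T) (\<lambda>x. in_triv t u x $ i)" "continuous_on (W \<inter> T) (\<lambda>x. in_triv t u x $ j)"
        unfolding WT using u t(1) ij by (auto simp: continuous_section_def)
    qed
    then have "continuous_on (W \<inter> T) (\<lambda>x. metric E x (u x) (u x))"
      by (rule continuous_on_eq) (use u WT in \<open>auto simp: metric in_triv_def continuous_section_def\<close>)
    with T t x show "\<exists>U. open U \<and> x \<in> U \<and> continuous_on (W \<inter> U) (\<lambda>x. metric E x (u x) (u x))"
      by blast
  qed
  then have "continuous_on (closure D) (\<lambda>x. metric E x (u x) (u x))"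
    using W(2) by (rule continuous_on_subset)
  then have "bounded ((\<lambda>x. metric E x (u x) (u x)) ` closure D)"
    using cpt by (intro compact_imp_bounded compact_continuous_image)
  then obtain b where b: "\<And>x. x \<in> closure D \<Longrightarrow> cmod (metric E x (u x) (u x)) \<le> b"
    by (auto simp: bounded_iff)
  have le: "(fibre_norm E x (u x))\<^sup>2 \<le> b" if "x \<in> D" for x
    using b[of x] closure_subset[of D] that complex_Re_le_cmod[of "metric E x (u x) (u x)"]
      fibre_norm_power2[OF that measurable_sectionD(1)[OF m that]] by auto
  have "energy u \<le> (\<integral>\<^sup>+x. ennreal b \<partial>M)"
    unfolding energy_def by (intro nn_integral_mono ennreal_leI le) (simp add: space_M)
  also have "\<dots> = ennreal b * emeasure dx D"
    using D_meas by (simp add: space_M emeasure_restrict_space space_dx)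
  also have "\<dots> < \<infinity>"
    using fin by (simp add: ennreal_mult_less_top)
  finally show "energy u < \<infinity>" .
qed

section \<open>The operator on smooth sections with vanishing boundary data\<close>

lemma (in hermitian_domain) L2_inner_cong:
  assumes "\<And>x. x \<in> D \<Longrightarrow> u x = v x"
  shows "L2_inner dx D E u w = L2_inner dx D E v w"
  unfolding L2_inner_eq using assms by (intro Bochner_Integration.integral_cong) (auto simp: space_M)

lemma smooth_sections_vanishing_comb:
  assumes charts: "\<And>c. c \<in> atlas \<Longrightarrow> is_chart c" and X: "X \<subseteq> carrier_of atlas"
    and E: "is_vbundle atlas X E" and B: "dirichlet_system atlas X E D m N G ord B"
    and \<Gamma>: "\<Gamma> \<subseteq> frontier D"
    and u: "u \<in> smooth_sections_vanishing atlas X E D m G B \<Gamma>"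
    and v: "v \<in> smooth_sections_vanishing atlas X E D m G B \<Gamma>"
  shows "sec_comb u a v \<in> smooth_sections_vanishing atlas X E D m G B \<Gamma>"
proof -
  obtain U where U: "open U" "closure D \<subseteq> U" "U \<subseteq> X" "smooth_section atlas U E u"
    using u by (auto simp: smooth_sections_vanishing_def)
  obtain V where V: "open V" "closure D \<subseteq> V" "V \<subseteq> X" "smooth_section atlas V E v"
    using v by (auto simp: smooth_sections_vanishing_def)
  define W where "W = U \<inter> V"
  have W: "open W" "closure D \<subseteq> W" "W \<subseteq> X" "smooth_section atlas W E u" "smooth_section atlas W E v"
    using U V smooth_section_subset[OF U(4), of W] smooth_section_subset[OF V(4), of W]
    by (auto simp: W_def)
  have N: "open N" "frontier D \<subseteq> N" "N \<subseteq> X"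
    using B by (auto simp: dirichlet_system_def)
  have "act (B j) (sec_comb u a v) x = 0\<^sub>v (rk (G j))" if j: "j < m" and x: "x \<in> \<Gamma>" for j x
  proof -
    have Bj: "is_vbundle atlas N (G j)" "diff_operator atlas N E (G j) (ord j) (B j)"
      using B j by (auto simp: dirichlet_system_def)
    have x': "x \<in> W \<inter> N"
      using x \<Gamma> N(2) W(2) by (auto simp: frontier_def)
    have "open (W \<inter> N)"
      using W(1) N(1) by (rule open_Int)
    from act_comb(2)[OF charts X E Bj(1) N(3) Bj(2) this _ smooth_section_subset[OF W(4)] smooth_section_subset[OF W(5)] x']
    have "act (B j) (sec_comb u a v) x = act (B j) u x + a \<cdot>\<^sub>v act (B j) v x"
      by auto
    also have "\<dots> = 0\<^sub>v (rk (G j)) + a \<cdot>\<^sub>v 0\<^sub>v (rk (G j))"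
      using u v j x by (simp add: smooth_sections_vanishing_def)
    also have "\<dots> = 0\<^sub>v (rk (G j))"
      by (intro eq_vecI) auto
    finally show ?thesis .
  qed
  with W smooth_section_comb[OF charts E W(4,5)] show ?thesis
    unfolding smooth_sections_vanishing_def by blast
qed

lemma zero_in_smooth_sections_vanishing:
  assumes charts: "\<And>c. c \<in> atlas \<Longrightarrow> is_chart c" and X: "X \<subseteq> carrier_of atlas"
    and E: "is_vbundle atlas X E" and B: "dirichlet_system atlas X E D m N G ord B"
    and \<Gamma>: "\<Gamma> \<subseteq> frontier D" and D: "closure D \<subseteq> interior X"
  shows "(\<lambda>x. 0\<^sub>v (rk E)) \<in> smooth_sections_vanishing atlas X E D m G B \<Gamma>"
  unfolding smooth_sections_vanishing_def
proof (intro CollectI conjI allI impI ballI)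
  show "\<exists>W. open W \<and> closure D \<subseteq> W \<and> W \<subseteq> X \<and> smooth_section atlas W E (\<lambda>x. 0\<^sub>v (rk E))"
    using D interior_subset smooth_section_0[OF charts E] by blast
  fix j x assume j: "j < m" and x: "x \<in> \<Gamma>"
  have N: "is_vbundle atlas N (G j)" "N \<subseteq> X" "diff_operator atlas N E (G j) (ord j) (B j)" "open N" "x \<in> N"
    using B j x \<Gamma> by (auto simp: dirichlet_system_def)
  show "act (B j) (\<lambda>x. 0\<^sub>v (rk E)) x = 0\<^sub>v (rk (G j))"
    by (rule act_0[OF charts X E N(1-4) order_refl N(5)])
qed

text \<open>
  Apart from the linearity of \<open>A\<close> and of the boundary operators, what has to be checked is that
  \<open>u\<close> and \<open>A u\<close> are square integrable over \<open>D\<close>: they are continuous near the compact closure of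
  \<open>D\<close>, which has finite volume.
\<close>

lemma graph_completion_smooth_sections:
  fixes atlas :: "('p::{t2_space,second_countable_topology}, 'n::finite) chart set"
  assumes M: "closed_manifold atlas" and X: "submanifold_with_boundary atlas X"
    and \<omega>: "volume_form atlas X \<omega>" "induced_measure atlas X \<omega> dx"
    and E: "hermitian_bundle atlas X E" and F: "hermitian_bundle atlas X F"
    and A: "diff_operator atlas X E F m A"
    and D: "smooth_domain atlas X D" and \<Gamma>: "\<Gamma> \<subseteq> frontier D"
    and B: "dirichlet_system atlas X E D m N G ord B"
  shows "graph_completion (L2_sections dx D E) sec_comb (L2_inner dx D E)
    (L2_sections dx D F) sec_comb (L2_inner dx D F)
    (smooth_sections_vanishing atlas X E D m G B \<Gamma>) (act A)"
proof -
  have charts: "is_chart c" if "c \<in> atlas" for c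
    using M that by (auto simp: closed_manifold_def)
  have X': "X \<subseteq> carrier_of atlas"
    using X by (simp add: submanifold_with_boundary_def)
  have D': "open D" "compact (closure D)" "closure D \<subseteq> interior X"
    using D by (auto simp: smooth_domain_def)
  have DX: "D \<subseteq> X"
    using D'(3) closure_subset interior_subset by blast
  have sets: "sets dx = sets borel"
    using \<omega>(2) by (simp add: induced_measure_def)
  have "emeasure dx D \<le> emeasure dx (closure D)"
    by (intro emeasure_mono closure_subset) (simp add: sets)
  also have "\<dots> < \<infinity>"
    by (rule induced_measure_compact_finite[OF charts X' \<omega> D'(2,3)])
  finally have fin: "emeasure dx D < \<infinity>" .
  have bE: "is_vbundle atlas X E" and bF: "is_vbundle atlas X F"
    using E F by (auto simp: hermitian_bundle_def)
  interpret E: hermitian_domain atlas X D dx E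
    by unfold_locales (use charts X' E D' DX sets in auto)
  interpret F: hermitian_domain atlas X D dx F
    by unfold_locales (use charts X' F D' DX sets in auto)
  let ?S = "smooth_sections_vanishing atlas X E D m G B \<Gamma>"
  have S: "\<exists>W. open W \<and> closure D \<subseteq> W \<and> W \<subseteq> X \<and> smooth_section atlas W E u" if "u \<in> ?S" for u
    using that by (auto simp: smooth_sections_vanishing_def)
  show ?thesis
  proof (intro graph_completion.intro graph_completion_axioms.intro E.L2_semi_inner_space F.L2_semi_inner_space)
    show "?S \<subseteq> L2_sections dx D E"
    proof
      fix u assume "u \<in> ?S"
      then obtain W where W: "open W" "closure D \<subseteq> W" "W \<subseteq> X" "smooth_section atlas W E u"
        using S by blast
      then have "continuous_section W E u"
        using X' by (intro smooth_section_imp_continuous_section[OF charts]) auto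
      then show "u \<in> L2_sections dx D E"
        using W D'(2) fin by (intro E.continuous_section_L2)
    qed
    show "?S \<noteq> {}"
      using zero_in_smooth_sections_vanishing[OF charts X' bE B \<Gamma> D'(3)] by blast
    show "sec_comb u c v \<in> ?S" if "u \<in> ?S" "v \<in> ?S" for u v c
      by (rule smooth_sections_vanishing_comb[OF charts X' bE B \<Gamma> that])
    show "act A u \<in> L2_sections dx D F" if u: "u \<in> ?S" for u
    proof -
      obtain W where W: "open W" "closure D \<subseteq> W" "W \<subseteq> X" "smooth_section atlas W E u"
        using S[OF u] by blast
      have "continuous_section W F (act A u)"
        by (rule act_continuous_section[OF charts X' bE bF A W(1,3,4)])
      then show ?thesis
        using W D'(2) fin by (intro F.continuous_section_L2)
    qed
    show "L2_inner dx D F (act A (sec_comb u c v)) z = L2_inner dx D F (sec_comb (act A u) c (act A v)) z"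
      if u: "u \<in> ?S" and v: "v \<in> ?S" for u v c z
    proof (rule F.L2_inner_cong)
      fix x assume x: "x \<in> D"
      obtain U where U: "open U" "closure D \<subseteq> U" "U \<subseteq> X" "smooth_section atlas U E u"
        using S[OF u] by blast
      obtain V where V: "open V" "closure D \<subseteq> V" "V \<subseteq> X" "smooth_section atlas V E v"
        using S[OF v] by blast
      have UV: "open (U \<inter> V)" "U \<inter> V \<subseteq> X" "x \<in> U \<inter> V"
        using U V x closure_subset[of D] by auto
      show "act A (sec_comb u c v) x = sec_comb (act A u) c (act A v) x"
        using act_comb(2)[OF charts X' bE bF order_refl A UV(1,2) smooth_section_subset[OF U(4)] smooth_section_subset[OF V(4)] UV(3)]
        by (simp add: sec_comb_def)
    qed
    show "\<exists>w\<in>L2_sections dx D E. (\<lambda>k. E.L2.dst (\<sigma> k) w) \<longlonglongrightarrow> 0"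
      if "\<And>k. \<sigma> k \<in> L2_sections dx D E"
        and "\<And>e. e > 0 \<Longrightarrow> \<exists>N. \<forall>j\<ge>N. \<forall>k\<ge>N. E.L2.dst (\<sigma> j) (\<sigma> k) < e" for \<sigma>
      using E.L2_complete[OF that] by blast
    show "\<exists>w\<in>L2_sections dx D F. (\<lambda>k. F.L2.dst (\<sigma> k) w) \<longlonglongrightarrow> 0"
      if "\<And>k. \<sigma> k \<in> L2_sections dx D F"
        and "\<And>e. e > 0 \<Longrightarrow> \<exists>N. \<forall>j\<ge>N. \<forall>k\<ge>N. F.L2.dst (\<sigma> j) (\<sigma> k) < e" for \<sigma>
      using F.L2_complete[OF that] by blast
  qed
qed

theorem lemma3p1:
  fixes atlas :: "('p::{t2_space,second_countable_topology}, 'n::finite) chart set"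
    and X D N \<Gamma> :: "'p set"
    and \<omega> :: "('p, 'n) chart \<Rightarrow> 'p \<Rightarrow> real"
    and dx :: "'p measure"
    and E F :: "'p hbundle"
    and A :: "('p, 'n) diffop"
    and m :: nat
    and G :: "nat \<Rightarrow> 'p vbundle"
    and ord :: "nat \<Rightarrow> nat"
    and B :: "nat \<Rightarrow> ('p, 'n) diffop"
    and \<epsilon> :: real
    and f h :: "'p bsection"
  assumes "closed_manifold atlas"
    and "submanifold_with_boundary atlas X"
    and "volume_form atlas X \<omega>"
    and "induced_measure atlas X \<omega> dx"
    and "hermitian_bundle atlas X E"
    and "hermitian_bundle atlas X F"
    and "diff_operator atlas X E F m A"
    and "injective_symbol atlas X E F m A"
    and "smooth_domain atlas X D"
    and "closed \<Gamma>" and "\<Gamma> \<subseteq> frontier D"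
    and "dirichlet_system atlas X E D m N G ord B"
    and "\<epsilon> > 0"
    and "f \<in> L2_sections dx D F"
    and "h \<in> L2_sections dx D E"
  shows "(\<exists>!u. u \<in> D_T atlas X dx E F A D m G B \<Gamma> \<and>
            solves dx D E F A (D_T atlas X dx E F A D m G B \<Gamma>) \<epsilon> f h u) \<and>
         (\<forall>u \<in> D_T atlas X dx E F A D m G B \<Gamma>.
            solves dx D E F A (D_T atlas X dx E F A D m G B \<Gamma>) \<epsilon> f h u \<longrightarrow>
            eps_norm dx D E F A \<epsilon> u \<le> L2_norm dx D F f + sqrt \<epsilon> * L2_norm dx D E h)"
proof -
  let ?S = "smooth_sections_vanishing atlas X E D m G B \<Gamma>"
  interpret C: graph_completion "L2_sections dx D E" sec_comb "L2_inner dx D E"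
    "L2_sections dx D F" sec_comb "L2_inner dx D F" ?S "act A"
    by (rule graph_completion_smooth_sections[OF assms(1-7,9,11,12)])
  let ?DT = "D_T atlas X dx E F A D m G B \<Gamma>"
  have DT: "?DT = completion ?S C.gdist"
    unfolding D_T_def C.gdist_def[abs_def] D_norm_def D_inner_def section_diff_eq_sec_comb Let_def ..
  have norms: "L2_norm dx D E = C.H.nm" "L2_norm dx D F = C.K.nm"
    by (auto simp: L2_norm_def C.H.nm_def C.K.nm_def)
  have emb: "to_L2 dx D E = C.emb"
    by (intro ext) (simp add: to_L2_def C.emb_def norms section_diff_eq_sec_comb C.H.dst_def)
  have ext: "A_ext dx D F A = C.ext"
    by (intro HOL.ext) (simp add: A_ext_def C.ext_def norms section_diff_eq_sec_comb C.K.dst_def)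
  have solves: "solves dx D E F A ?DT \<epsilon> f h u \<longleftrightarrow> C.weak_solution \<epsilon> f h u" for u
    by (simp add: solves_def C.weak_solution_def DT emb ext C.pair_ip_def)
  have eps: "eps_norm dx D E F A \<epsilon> u = sqrt (Re (C.pair_ip \<epsilon> (C.limit_pair u) (C.limit_pair u)))" for u
    by (simp add: eps_norm_def eps_inner_def C.pair_ip_def emb ext)
  obtain U where U: "U \<in> ?DT" "C.weak_solution \<epsilon> f h U"
    using C.weak_solution_exists[OF assms(13-15)] unfolding DT by blast
  show ?thesis
    unfolding solves eps norms
  proof (intro conjI ballI impI ex1I[of _ U])
    show "V = U" if "V \<in> ?DT \<and> C.weak_solution \<epsilon> f h V" for V
      using C.weak_solution_unique[OF assms(13)] that U unfolding DT by blast
    show "sqrt (Re (C.pair_ip \<epsilon> (C.limit_pair V) (C.limit_pair V))) \<le> C.K.nm f + sqrt \<epsilon> * C.H.nm h"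
      if "V \<in> ?DT" "C.weak_solution \<epsilon> f h V" for V
      using C.weak_solution_bound[OF assms(13-15)] that unfolding DT by blast
  qed (use U in auto)
qed

end
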